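(* Let $R$ be a ring. The following statements are equivalent. 1. The ring $R$ has a left Artinian left quotient ring $Q$. 2. The following conditions (a)--(e) hold: (a) The ring $\overline{R}$ is a left Goldie ring. (b) $\mathfrak{n}$ is a nilpotent ideal. (c) $\mathcal{C}'\subseteq\mathcal{C}$. (d) If $c\in\mathcal{C}'$ and $n\in\mathfrak{n}$ then there exist elements $c_1\in\mathcal{C}'$ and $n_1\in\mathfrak{n}$ such that $c_1n=n_1c$. (e) The ring $R$ satisfies the ascending chain condition for $\mathcal{C}'$-closed left ideals.
   Context: Rings have $1$. For a ring $R$: $\mathcal{C}$ is the set of regular elements (non-zero-divisors) of $R$; the left quotient ring of $R$ is $Q=\mathcal{C}^{-1}R$ (it exists iff $\mathcal{C}$ is a left Ore set); $\mathfrak{n}$ is the prime radical of $R$; $\overline{R}:=R/\mathfrak{n}$; $\overline{\mathcal{C}}$ is the set of regular elements of $\overline{R}$; $\mathcal{C}':=\{c\in R\mid c+\mathfrak{n}\in\overline{\mathcal{C}}\}$. A ring is a left Goldie ring if it satisfies the ascending chain condition on left annihilators and contains no infinite direct sums of nonzero left ideals. A left ideal $I$ of $R$ is $\mathcal{C}'$-closed if, for elements $c\in\mathcal{C}'$ and $r\in R$, $cr\in I$ implies $r\in I$. *)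

theory Defs
  imports "HOL-Algebra.Algebra"
begin

text \<open>
  The locale \<^locale>\<open>ring\<close> is that of associative rings with identity; the zero ring is allowed.
\<close>

definition regular_elements :: "('a, 'm) ring_scheme \<Rightarrow> 'a set" where
  "regular_elements R = {c \<in> carrier R. \<forall>r \<in> carrier R.
     (c \<otimes>\<^bsub>R\<^esub> r = \<zero>\<^bsub>R\<^esub> \<longrightarrow> r = \<zero>\<^bsub>R\<^esub>) \<and> (r \<otimes>\<^bsub>R\<^esub> c = \<zero>\<^bsub>R\<^esub> \<longrightarrow> r = \<zero>\<^bsub>R\<^esub>)}"

definition left_ideal :: "'a set \<Rightarrow> ('a, 'm) ring_scheme \<Rightarrow> bool" where
  "left_ideal I R \<longleftrightarrow> additive_subgroup I R \<and> (\<forall>r \<in> carrier R. \<forall>x \<in> I. r \<otimes>\<^bsub>R\<^esub> x \<in> I)"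

definition acc_on :: "'a set set \<Rightarrow> bool" where
  "acc_on F \<longleftrightarrow> (\<forall>I :: nat \<Rightarrow> 'a set.
     (\<forall>n. I n \<in> F \<and> I n \<subseteq> I (Suc n)) \<longrightarrow> (\<exists>N. \<forall>n \<ge> N. I n = I N))"

definition dcc_on :: "'a set set \<Rightarrow> bool" where
  "dcc_on F \<longleftrightarrow> (\<forall>I :: nat \<Rightarrow> 'a set.
     (\<forall>n. I n \<in> F \<and> I (Suc n) \<subseteq> I n) \<longrightarrow> (\<exists>N. \<forall>n \<ge> N. I n = I N))"

definition left_artinian :: "('a, 'm) ring_scheme \<Rightarrow> bool" where
  "left_artinian R \<longleftrightarrow> ring R \<and> dcc_on {I. left_ideal I R}"

definition left_annihilator :: "('a, 'm) ring_scheme \<Rightarrow> 'a set \<Rightarrow> 'a set" where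
  "left_annihilator R Y = {r \<in> carrier R. \<forall>x \<in> Y. r \<otimes>\<^bsub>R\<^esub> x = \<zero>\<^bsub>R\<^esub>}"

text \<open>The sum of the subgroups \<open>I n\<close> is direct.\<close>

definition direct_family :: "('a, 'm) ring_scheme \<Rightarrow> (nat \<Rightarrow> 'a set) \<Rightarrow> bool" where
  "direct_family R I \<longleftrightarrow> (\<forall>A x. finite A \<and> (\<forall>n \<in> A. x n \<in> I n) \<and> finsum R x A = \<zero>\<^bsub>R\<^esub>
     \<longrightarrow> (\<forall>n \<in> A. x n = \<zero>\<^bsub>R\<^esub>))"

text \<open>
  An infinite direct sum contains a countably infinite one, so families indexed by \<^typ>\<open>nat\<close> suffice.
\<close>

definition left_goldie :: "('a, 'm) ring_scheme \<Rightarrow> bool" where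
  "left_goldie R \<longleftrightarrow> ring R \<and>
     acc_on {left_annihilator R Y | Y. Y \<subseteq> carrier R} \<and>
     \<not> (\<exists>I :: nat \<Rightarrow> 'a set.
          (\<forall>n. left_ideal (I n) R \<and> I n \<noteq> {\<zero>\<^bsub>R\<^esub>}) \<and> direct_family R I)"

text \<open>
  The library's \<^locale>\<open>primeideal\<close> requires a commutative ring and is elementwise; this is the
  notion for arbitrary rings, in terms of products of two-sided ideals.
\<close>

definition prime_ideal :: "'a set \<Rightarrow> ('a, 'm) ring_scheme \<Rightarrow> bool" where
  "prime_ideal P R \<longleftrightarrow> ideal P R \<and> P \<noteq> carrier R \<and>
     (\<forall>A B. ideal A R \<and> ideal B R \<and> ideal_prod R A B \<subseteq> P \<longrightarrow> A \<subseteq> P \<or> B \<subseteq> P)"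

text \<open>The intersection with the carrier only matters for the zero ring, which has no primes.\<close>

definition prime_radical :: "('a, 'm) ring_scheme \<Rightarrow> 'a set" where
  "prime_radical R = carrier R \<inter> \<Inter>{P. prime_ideal P R}"

fun ideal_power :: "('a, 'm) ring_scheme \<Rightarrow> 'a set \<Rightarrow> nat \<Rightarrow> 'a set" where
  "ideal_power R I 0 = carrier R"
| "ideal_power R I (Suc k) = ideal_prod R I (ideal_power R I k)"

definition nilpotent_ideal :: "'a set \<Rightarrow> ('a, 'm) ring_scheme \<Rightarrow> bool" where
  "nilpotent_ideal I R \<longleftrightarrow> ideal I R \<and> (\<exists>k. ideal_power R I k = {\<zero>\<^bsub>R\<^esub>})"

text \<open>\<open>\<C>'\<close>: the elements of \<open>R\<close> that are regular modulo the prime radical.\<close>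

definition regular_mod_radical :: "('a, 'm) ring_scheme \<Rightarrow> 'a set" where
  "regular_mod_radical R =
     {c \<in> carrier R. prime_radical R +>\<^bsub>R\<^esub> c \<in> regular_elements (R Quot prime_radical R)}"

definition closed_under :: "('a, 'm) ring_scheme \<Rightarrow> 'a set \<Rightarrow> 'a set \<Rightarrow> bool" where
  "closed_under R S I \<longleftrightarrow> (\<forall>c \<in> S. \<forall>r \<in> carrier R. c \<otimes>\<^bsub>R\<^esub> r \<in> I \<longrightarrow> r \<in> I)"

text \<open>
  \<open>Q\<close>, with the embedding \<open>f\<close> of \<open>R\<close> into it, is \<open>\<C>\<^sup>-\<^sup>1R\<close> for the set \<open>\<C>\<close> of regular elements.
  The map \<open>f\<close> is injective because no nonzero element of \<open>R\<close> is killed by an element of \<open>\<C>\<close>.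
\<close>

definition left_quotient_ring ::
    "('a, 'm) ring_scheme \<Rightarrow> ('b, 'n) ring_scheme \<Rightarrow> ('a \<Rightarrow> 'b) \<Rightarrow> bool" where
  "left_quotient_ring R Q f \<longleftrightarrow>
     ring Q \<and> f \<in> ring_hom R Q \<and> inj_on f (carrier R) \<and>
     (\<forall>c \<in> regular_elements R. f c \<in> Units Q) \<and>
     (\<forall>q \<in> carrier Q. \<exists>c \<in> regular_elements R. \<exists>r \<in> carrier R. q = inv\<^bsub>Q\<^esub> (f c) \<otimes>\<^bsub>Q\<^esub> f r)"

lemma left_ideal_vimage:
  assumes "ring Q" "ring Q'" and g: "g \<in> ring_hom Q Q'" and L: "left_ideal I Q'"
  shows "left_ideal {q \<in> carrier Q. g q \<in> I} Q"
proof -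
  interpret Q: ring Q by fact
  interpret Q': ring Q' by fact
  interpret g: ring_hom_ring Q Q' g
    using ring_hom_ringI2[OF assms(1,2) g] .
  interpret I: additive_subgroup I Q' using L by (simp add: left_ideal_def)
  have "subgroup {q \<in> carrier Q. g q \<in> I} (add_monoid Q)"
    by (rule Q.add.subgroupI)
       (auto simp flip: a_inv_def intro: exI[of _ "\<zero>\<^bsub>Q\<^esub>"])
  then show ?thesis
    using L by (auto simp: left_ideal_def additive_subgroup_def)
qed

lemma left_artinian_iso:
  assumes A: "left_artinian Q" and Q': "ring Q'" and g: "g \<in> ring_iso Q Q'"
  shows "left_artinian Q'"
  unfolding left_artinian_def dcc_on_def
proof (intro conjI allI impI)
  have Q: "ring Q" using A by (simp add: left_artinian_def)
  have hom: "g \<in> ring_hom Q Q'" and bij: "bij_betw g (carrier Q) (carrier Q')"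
    using g by (auto simp: ring_iso_def)
  fix I :: "nat \<Rightarrow> _" assume I: "\<forall>n. I n \<in> {I. left_ideal I Q'} \<and> I (Suc n) \<subseteq> I n"
  let ?J = "\<lambda>n. {q \<in> carrier Q. g q \<in> I n}"
  have "\<forall>n. ?J n \<in> {I. left_ideal I Q} \<and> ?J (Suc n) \<subseteq> ?J n"
    using left_ideal_vimage[OF Q Q' hom] I by auto
  moreover have "dcc_on {I. left_ideal I Q}" using A by (simp add: left_artinian_def)
  ultimately have "\<exists>N. \<forall>n\<ge>N. ?J n = ?J N"
    unfolding dcc_on_def by (rule_tac allE[of _ ?J]) auto
  then obtain N where N: "\<forall>n\<ge>N. ?J n = ?J N" ..
  have img: "g ` ?J n = I n" for n
  proof -
    have "I n \<subseteq> carrier Q'"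
      using I by (intro additive_subgroup.a_subset) (simp add: left_ideal_def)
    also have "carrier Q' = g ` carrier Q" using bij by (simp add: bij_betw_def)
    finally show ?thesis by auto
  qed
  have "I n = I N" if "n \<ge> N" for n
    using arg_cong[OF N[rule_format, OF that], of "image g"] by (simp only: img)
  then show "\<exists>N. \<forall>n\<ge>N. I n = I N" by blast
qed (fact Q')

text \<open>
  A left quotient ring of \<open>R\<close> on any type has an isomorphic copy on the type of sets of pairs of
  elements of \<open>R\<close>: send \<open>q\<close> to the set of its presentations as a left fraction. Hence asking for
  one on that type is no restriction.
\<close>

lemma left_quotient_ring_on_fractions:
  fixes R :: "('a, 'm) ring_scheme" and Q :: "('b, 'n) ring_scheme"
  assumes R: "ring R" and Q: "left_quotient_ring R Q f"
  shows "\<exists>(Q' :: ('a \<times> 'a) set ring) g. g \<in> ring_iso Q Q' \<and> left_quotient_ring R Q' (g \<circ> f)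
           \<and> (left_artinian Q \<longrightarrow> left_artinian Q')"
proof -
  interpret Q: ring Q using Q by (simp add: left_quotient_ring_def)
  have f: "f \<in> ring_hom R Q" "inj_on f (carrier R)"
    and U: "\<And>c. c \<in> regular_elements R \<Longrightarrow> f c \<in> Units Q"
    and frac: "\<And>q. q \<in> carrier Q \<Longrightarrow>
      \<exists>c \<in> regular_elements R. \<exists>r \<in> carrier R. q = inv\<^bsub>Q\<^esub> (f c) \<otimes>\<^bsub>Q\<^esub> f r"
    using Q by (auto simp: left_quotient_ring_def)
  have fc: "\<And>r. r \<in> carrier R \<Longrightarrow> f r \<in> carrier Q" using f by (simp add: ring_hom_closed)
  define g where "g q = {(c, r). c \<in> regular_elements R \<and> r \<in> carrier R \<and> f c \<otimes>\<^bsub>Q\<^esub> q = f r}" for q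
  have inj: "inj_on g (carrier Q)"
  proof (rule inj_onI)
    fix p q assume p: "p \<in> carrier Q" and q: "q \<in> carrier Q" and eq: "g p = g q"
    obtain c r where c: "c \<in> regular_elements R" and r: "r \<in> carrier R"
      and pe: "p = inv\<^bsub>Q\<^esub> (f c) \<otimes>\<^bsub>Q\<^esub> f r" using frac[OF p] by auto
    have "f c \<otimes>\<^bsub>Q\<^esub> p = f r"
      unfolding pe using U[OF c] fc[OF r] Q.Units_closed Q.Units_inv_closed Q.Units_r_inv
      by (metis Q.m_assoc Q.l_one)
    then have "(c, r) \<in> g p" using c r by (simp add: g_def)
    then have "(c, r) \<in> g q" using eq by (simp only:)
    then have "f c \<otimes>\<^bsub>Q\<^esub> q = f r" by (simp add: g_def)
    then show "p = q"
      using \<open>f c \<otimes>\<^bsub>Q\<^esub> p = f r\<close> U[OF c] p q by (metis Q.Units_l_cancel)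
  qed
  let ?Q' = "image_ring g Q"
  have iso: "g \<in> ring_iso Q ?Q'" using inj by (rule inj_imp_image_ring_iso)
  have Q': "ring ?Q'"
    using Q.ring_iso_imp_img_ring[OF iso]
    by (simp add: image_ring_def monoid.defs)
  interpret Q': ring ?Q' by fact
  have g: "g \<in> ring_hom Q ?Q'" and bij: "bij_betw g (carrier Q) (carrier ?Q')"
    using iso by (auto simp: ring_iso_def)
  have gU: "g u \<in> Units ?Q' \<and> inv\<^bsub>?Q'\<^esub> (g u) = g (inv\<^bsub>Q\<^esub> u)" if u: "u \<in> Units Q" for u
  proof -
    have 1: "g u \<otimes>\<^bsub>?Q'\<^esub> g (inv\<^bsub>Q\<^esub> u) = \<one>\<^bsub>?Q'\<^esub>" "g (inv\<^bsub>Q\<^esub> u) \<otimes>\<^bsub>?Q'\<^esub> g u = \<one>\<^bsub>?Q'\<^esub>"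
      using u ring_hom_mult[OF g, of u "inv\<^bsub>Q\<^esub> u"] ring_hom_mult[OF g, of "inv\<^bsub>Q\<^esub> u" u]
        ring_hom_one[OF g] by (auto simp: Q.Units_closed)
    have 2: "g u \<in> carrier ?Q'" "g (inv\<^bsub>Q\<^esub> u) \<in> carrier ?Q'"
      using u ring_hom_closed[OF g] by (auto simp: Q.Units_closed)
    then have "g u \<in> Units ?Q'" using 1 by (auto simp: Units_def)
    moreover have "inv\<^bsub>?Q'\<^esub> (g u) = g (inv\<^bsub>Q\<^esub> u)"
      using Q'.inv_unique' 1 2 by metis
    ultimately show ?thesis ..
  qed
  have "left_quotient_ring R ?Q' (g \<circ> f)"
    unfolding left_quotient_ring_def
  proof (intro conjI ballI)
    show "g \<circ> f \<in> ring_hom R ?Q'" using ring_hom_trans[OF f(1) g] .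
    show "inj_on (g \<circ> f) (carrier R)"
      using f(2) by (rule comp_inj_on) (use inj fc in \<open>auto intro: inj_on_subset\<close>)
    show "(g \<circ> f) c \<in> Units ?Q'" if "c \<in> regular_elements R" for c
      using gU[OF U[OF that]] by simp
    fix q' assume "q' \<in> carrier ?Q'"
    then obtain q where q: "q \<in> carrier Q" "q' = g q" using bij by (auto simp: bij_betw_def)
    obtain c r where c: "c \<in> regular_elements R" and r: "r \<in> carrier R"
      and qe: "q = inv\<^bsub>Q\<^esub> (f c) \<otimes>\<^bsub>Q\<^esub> f r" using frac[OF q(1)] by auto
    have "q' = inv\<^bsub>?Q'\<^esub> ((g \<circ> f) c) \<otimes>\<^bsub>?Q'\<^esub> (g \<circ> f) r"
      using q(2) qe gU[OF U[OF c]] ring_hom_mult[OF g, of "inv\<^bsub>Q\<^esub> (f c)" "f r"] U[OF c] fc[OF r]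
      by simp
    then show "\<exists>c \<in> regular_elements R. \<exists>r \<in> carrier R.
        q' = inv\<^bsub>?Q'\<^esub> ((g \<circ> f) c) \<otimes>\<^bsub>?Q'\<^esub> (g \<circ> f) r"
      using c r by blast
  qed (fact Q')
  then show ?thesis using iso left_artinian_iso[OF _ Q' iso] by blast
qed

end

theory Submission
  imports Defs
begin

text \<open>
  If \<open>Q\<close> exists, it is left Noetherian (Hopkins--Levitzki), so its prime radical is nilpotent and its
  primes contract to primes of \<open>R\<close>; hence \<open>\<n> = R \<inter> rad Q\<close>. An element of \<open>R\<close> is regular modulo
  \<open>\<n>\<close> iff it is a unit of \<open>Q\<close>, so \<open>\<C>' = \<C>\<close>, and (d) follows from the left Ore condition. The
  \<open>\<C>\<close>-closed left ideals of \<open>R\<close> are the contractions of the left ideals of \<open>Q\<close>, which gives (e).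
  Both Goldie conditions for \<open>R/\<n>\<close> come from (e): annihilators are closed, and an infinite direct sum
  would give a strictly ascending chain of closures of its partial sums.

  Conversely, \<open>R/\<n>\<close> is semiprime left Goldie, so each of its essential left ideals contains a regular
  element. This yields the left Ore condition, which (d) lifts to \<open>\<C>'\<close>, and the descending chain
  condition on closed left ideals of \<open>R/\<n>\<close>. Now \<open>Q = \<C>'\<^sup>-\<^sup>1R\<close> is left Noetherian by (e), satisfies
  the descending chain condition above the left ideal \<open>Q\<n>\<close>, and is therefore left Artinian, as \<open>\<n>\<close> is
  nilpotent. Elements of \<open>\<C>\<close> have no left annihilator in \<open>Q\<close>, so they are units.
\<close>

section \<open>Chain conditions\<close>

text \<open>Condition (d) repairs the Ore condition: Goldie's theorem gives
  \<open>c1 r = r1 c\<close> only up to an error in the radical, and (d) turns that error, after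
  multiplication by some \<open>c2\<close>, into a left multiple of \<open>c\<close>. An ideal of
  \<open>R\<close> need not obviously extend to a two-sided ideal of \<open>Q\<close>. From
  \<open>Q\<close> to \<open>R\<close> the Noetherian property settles this, so the passage from
  Artinian to Noetherian precedes any comparison of primes. From \<open>R\<close> to
  \<open>Q\<close> the extended radical is handled as a left ideal only, and nilpotency enters
  through the hypothesis \<open>socle\<close> of \<open>left_noetherian_imp_artinian\<close>. The
  absence of infinite direct sums is always applied in one form: in a descending chain of left
  ideals, some term is essential in its predecessor. Quotient modules are never formed. Chains are
  compared through sums, intersections and colon left ideals. Nilpotency is phrased by k-fold
  products of elements wherever it has to cross the embedding \<open>f\<close>.\<close>

lemma acc_on_subset: "acc_on F \<Longrightarrow> G \<subseteq> F \<Longrightarrow> acc_on G"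
  unfolding acc_on_def by (meson subsetD)

lemma acc_on_maximal:
  assumes acc: "acc_on F" and "S \<subseteq> F" and "S \<noteq> {}"
  shows "\<exists>M\<in>S. \<forall>Z\<in>S. M \<subseteq> Z \<longrightarrow> Z = M"
proof (rule ccontr)
  assume "\<not> ?thesis"
  then have step: "\<exists>Y. Y \<in> S \<and> Z \<subset> Y" if "Z \<in> S" for Z
    using that by blast
  have "\<exists>I :: nat \<Rightarrow> _. \<forall>n. I n \<in> S \<and> I n \<subset> I (Suc n)"
    using \<open>S \<noteq> {}\<close> step by (intro dependent_nat_choice) auto
  then obtain I :: "nat \<Rightarrow> _" where I: "\<And>n. I n \<in> S" "\<And>n. I n \<subset> I (Suc n)"
    by blast
  then have "\<exists>N. \<forall>n\<ge>N. I n = I N"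
    using acc \<open>S \<subseteq> F\<close> unfolding acc_on_def by (meson psubset_imp_subset subsetD)
  then show False
    using I(2) by (metis le_SucI order_refl psubset_eq)
qed

lemma dcc_on_minimal:
  assumes dcc: "dcc_on F" and "S \<subseteq> F" and "S \<noteq> {}"
  shows "\<exists>M\<in>S. \<forall>Z\<in>S. Z \<subseteq> M \<longrightarrow> Z = M"
proof (rule ccontr)
  assume "\<not> ?thesis"
  then have step: "\<exists>Y. Y \<in> S \<and> Y \<subset> Z" if "Z \<in> S" for Z
    using that by blast
  have "\<exists>I :: nat \<Rightarrow> _. \<forall>n. I n \<in> S \<and> I (Suc n) \<subset> I n"
    using \<open>S \<noteq> {}\<close> step by (intro dependent_nat_choice) auto
  then obtain I :: "nat \<Rightarrow> _" where I: "\<And>n. I n \<in> S" "\<And>n. I (Suc n) \<subset> I n"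
    by blast
  then have "\<exists>N. \<forall>n\<ge>N. I n = I N"
    using dcc \<open>S \<subseteq> F\<close> unfolding dcc_on_def by (meson psubset_imp_subset subsetD)
  then show False
    using I(2) by (metis le_SucI order_refl psubset_eq)
qed

text \<open>A chain that never stabilises has a strictly descending subsequence, so finding one
  repeated step in every chain is enough. \<open>goldie_dcc_closed\<close> supplies exactly one such
  step.\<close>

lemma dcc_onI:
  assumes step: "\<And>I :: nat \<Rightarrow> _. (\<And>n. I n \<in> F) \<Longrightarrow> (\<And>n. I (Suc n) \<subseteq> I n) \<Longrightarrow> \<exists>n. I (Suc n) = I n"
  shows "dcc_on F"
  unfolding dcc_on_def
proof (intro allI impI, rule ccontr)
  fix I :: "nat \<Rightarrow> _"
  assume I: "\<forall>n. I n \<in> F \<and> I (Suc n) \<subseteq> I n" and "\<not> (\<exists>N. \<forall>n\<ge>N. I n = I N)"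
  then have "\<exists>m\<ge>n. I m \<noteq> I n" for n by blast
  moreover have "I m \<subseteq> I n" if "n \<le> m" for m n
    using lift_Suc_antimono_le[of I] I that by blast
  ultimately have "\<exists>m. I m \<subset> I n" for n by (metis psubsetI)
  then have "\<exists>k :: nat \<Rightarrow> nat. \<forall>n. True \<and> I (k (Suc n)) \<subset> I (k n)"
    by (intro dependent_nat_choice) auto
  then obtain k :: "nat \<Rightarrow> nat" where k: "\<And>n. I (k (Suc n)) \<subset> I (k n)" by blast
  show False
    using step[of "\<lambda>n. I (k n)"] I k by (metis psubset_eq)
qed

lemma acc_onD:
  assumes "acc_on F" "\<And>n. I n \<in> F" "\<And>n. I n \<subseteq> I (Suc n)"
  shows "\<exists>N. \<forall>n\<ge>N. I n = I N"
  using assms unfolding acc_on_def by blast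

lemma dcc_onD:
  assumes "dcc_on F" "\<And>n. I n \<in> F" "\<And>n. I (Suc n) \<subseteq> I n"
  shows "\<exists>N. \<forall>n\<ge>N. I n = I N"
  using assms unfolding dcc_on_def by blast

section \<open>Left ideals\<close>

definition left_multiples :: "('a, 'm) ring_scheme \<Rightarrow> 'a set \<Rightarrow> 'a \<Rightarrow> 'a set" where
  "left_multiples R A x = (\<lambda>a. a \<otimes>\<^bsub>R\<^esub> x) ` A"

lemma mem_set_add: "x \<in> A <+>\<^bsub>R\<^esub> B \<longleftrightarrow> (\<exists>a\<in>A. \<exists>b\<in>B. x = a \<oplus>\<^bsub>R\<^esub> b)"
  by (auto simp: set_add_def')

context ring
begin

text \<open>Closure under negation is obtained from
  \<open>\<ominus> x = (\<ominus> \<one>) \<otimes> x\<close>, a left multiple.\<close>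

lemma left_ideal_iff:
  "left_ideal I R \<longleftrightarrow> I \<subseteq> carrier R \<and> \<zero> \<in> I \<and> (\<forall>x\<in>I. \<forall>y\<in>I. x \<oplus> y \<in> I)
     \<and> (\<forall>r\<in>carrier R. \<forall>x\<in>I. r \<otimes> x \<in> I)" (is "_ \<longleftrightarrow> ?R")
proof
  assume "left_ideal I R"
  then interpret I: additive_subgroup I R by (simp add: left_ideal_def)
  show ?R using \<open>left_ideal I R\<close> I.a_subset by (simp add: left_ideal_def)
next
  assume I: ?R
  have "\<ominus> x \<in> I" if "x \<in> I" for x
    using I that l_minus[of \<one> x] by (metis a_inv_closed l_one one_closed subsetD)
  then have "subgroup I (add_monoid R)"
    using I by (intro add.subgroupI) (auto simp flip: a_inv_def)
  then show "left_ideal I R"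
    using I by (simp add: left_ideal_def additive_subgroup_def)
qed

lemma left_idealI:
  assumes "I \<subseteq> carrier R" "\<zero> \<in> I" "\<And>x y. x \<in> I \<Longrightarrow> y \<in> I \<Longrightarrow> x \<oplus> y \<in> I"
    "\<And>r x. r \<in> carrier R \<Longrightarrow> x \<in> I \<Longrightarrow> r \<otimes> x \<in> I"
  shows "left_ideal I R"
  using assms by (simp add: left_ideal_iff)

lemma left_idealD:
  assumes "left_ideal I R"
  shows "I \<subseteq> carrier R" "\<And>x. x \<in> I \<Longrightarrow> x \<in> carrier R" "\<zero> \<in> I"
    "\<And>x y. x \<in> I \<Longrightarrow> y \<in> I \<Longrightarrow> x \<oplus> y \<in> I"
    "\<And>r x. r \<in> carrier R \<Longrightarrow> x \<in> I \<Longrightarrow> r \<otimes> x \<in> I"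
  using assms by (auto simp: left_ideal_iff)

lemma left_ideal_a_inv: "left_ideal I R \<Longrightarrow> x \<in> I \<Longrightarrow> \<ominus> x \<in> I"
  by (metis additive_subgroup.a_inv_closed left_ideal_def ring_axioms ring_def abelian_group_def)

lemma left_ideal_minus: "left_ideal I R \<Longrightarrow> x \<in> I \<Longrightarrow> y \<in> I \<Longrightarrow> x \<ominus> y \<in> I"
  by (simp add: a_minus_def left_idealD(4) left_ideal_a_inv)

lemma left_ideal_cancel:
  assumes I: "left_ideal I R" and "x \<oplus> y \<in> I" "x \<in> I" "x \<in> carrier R" "y \<in> carrier R"
  shows "y \<in> I"
proof -
  have "y = (x \<oplus> y) \<ominus> x" using assms by algebra
  then show ?thesis using left_ideal_minus[OF I assms(2,3)] by simp
qed

lemma left_ideal_carrier: "left_ideal (carrier R) R"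
  by (auto simp: left_ideal_iff)

lemma left_ideal_zero: "left_ideal {\<zero>} R"
  by (auto simp: left_ideal_iff)

lemma left_ideal_Int: "left_ideal I R \<Longrightarrow> left_ideal J R \<Longrightarrow> left_ideal (I \<inter> J) R"
  by (auto simp: left_ideal_iff)

lemma left_ideal_of_ideal: "ideal I R \<Longrightarrow> left_ideal I R"
  by (simp add: left_ideal_def ideal.axioms(1) ideal.I_l_closed)

lemma left_ideal_set_add:
  assumes A: "left_ideal A R" and B: "left_ideal B R"
  shows "left_ideal (A <+>\<^bsub>R\<^esub> B) R"
proof (rule left_idealI)
  note [simp] = left_idealD[OF A] left_idealD[OF B]
  show "A <+>\<^bsub>R\<^esub> B \<subseteq> carrier R" by (auto simp: mem_set_add)
  show "\<zero> \<in> A <+>\<^bsub>R\<^esub> B" unfolding mem_set_add by (rule bexI[of _ \<zero>])+ auto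
  fix x y assume "x \<in> A <+>\<^bsub>R\<^esub> B" "y \<in> A <+>\<^bsub>R\<^esub> B"
  then obtain a b a' b' where *: "a \<in> A" "b \<in> B" "x = a \<oplus> b" "a' \<in> A" "b' \<in> B" "y = a' \<oplus> b'"
    by (auto simp: mem_set_add)
  then have "a \<in> carrier R" "b \<in> carrier R" "a' \<in> carrier R" "b' \<in> carrier R" by simp_all
  then have "x \<oplus> y = (a \<oplus> a') \<oplus> (b \<oplus> b')" unfolding * by algebra
  then show "x \<oplus> y \<in> A <+>\<^bsub>R\<^esub> B" using * unfolding mem_set_add by (metis left_idealD(4) A B)
next
  fix r x assume "r \<in> carrier R" "x \<in> A <+>\<^bsub>R\<^esub> B"
  then show "r \<otimes> x \<in> A <+>\<^bsub>R\<^esub> B"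
    unfolding mem_set_add by (metis A B left_idealD(2,5) r_distr)
qed

lemma set_add_upper:
  assumes "left_ideal A R" "left_ideal B R"
  shows "A \<subseteq> A <+>\<^bsub>R\<^esub> B" "B \<subseteq> A <+>\<^bsub>R\<^esub> B"
proof -
  have "a = a \<oplus> \<zero>" if "a \<in> A" for a using left_idealD(2)[OF assms(1) that] by simp
  then show "A \<subseteq> A <+>\<^bsub>R\<^esub> B" using left_idealD(3)[OF assms(2)] unfolding subset_iff mem_set_add by blast
  have "b = \<zero> \<oplus> b" if "b \<in> B" for b using left_idealD(2)[OF assms(2) that] by simp
  then show "B \<subseteq> A <+>\<^bsub>R\<^esub> B" using left_idealD(3)[OF assms(1)] unfolding subset_iff mem_set_add by blast
qed

lemma set_add_least:
  assumes "left_ideal I R" "A \<subseteq> I" "B \<subseteq> I"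
  shows "A <+>\<^bsub>R\<^esub> B \<subseteq> I"
  using assms(2,3) left_idealD(4)[OF assms(1)] unfolding subset_iff mem_set_add by blast

lemma set_add_mono_left: "A \<subseteq> A' \<Longrightarrow> A <+>\<^bsub>R\<^esub> B \<subseteq> A' <+>\<^bsub>R\<^esub> B"
  unfolding subset_iff mem_set_add by blast

lemma left_ideal_left_multiples:
  assumes A: "left_ideal A R" and x: "x \<in> carrier R"
  shows "left_ideal (left_multiples R A x) R"
proof (rule left_idealI)
  note [simp] = left_idealD[OF A] x
  show "left_multiples R A x \<subseteq> carrier R" by (auto simp: left_multiples_def)
  show "\<zero> \<in> left_multiples R A x"
    unfolding left_multiples_def by (rule image_eqI[of _ _ \<zero>]) auto
  fix y z assume "y \<in> left_multiples R A x" "z \<in> left_multiples R A x"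
  then obtain a b where "a \<in> A" "b \<in> A" "y = a \<otimes> x" "z = b \<otimes> x"
    by (auto simp: left_multiples_def)
  then have "y \<oplus> z = (a \<oplus> b) \<otimes> x" "a \<oplus> b \<in> A" by (simp_all add: l_distr)
  then show "y \<oplus> z \<in> left_multiples R A x" unfolding left_multiples_def by blast
next
  fix r y assume r: "r \<in> carrier R" and "y \<in> left_multiples R A x"
  then obtain a where "a \<in> A" "y = a \<otimes> x" by (auto simp: left_multiples_def)
  then have "r \<otimes> y = (r \<otimes> a) \<otimes> x" "r \<otimes> a \<in> A" using r A x by (simp_all add: m_assoc left_idealD)
  then show "r \<otimes> y \<in> left_multiples R A x" unfolding left_multiples_def by blast
qed

lemma left_multiples_subset:
  assumes "left_ideal I R" "x \<in> I" "A \<subseteq> carrier R"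
  shows "left_multiples R A x \<subseteq> I"
  using left_idealD(5)[OF assms(1)] assms by (auto simp: left_multiples_def)

lemma self_in_left_multiples: "x \<in> carrier R \<Longrightarrow> x \<in> left_multiples R (carrier R) x"
  unfolding left_multiples_def by (rule image_eqI[of _ _ \<one>]) auto

lemma left_ideal_colon:
  assumes I: "left_ideal I R" and a: "a \<in> carrier R"
  shows "left_ideal {x \<in> carrier R. x \<otimes> a \<in> I} R"
  using left_idealD[OF I] a by (intro left_idealI) (auto simp: l_distr m_assoc)

lemma left_ideal_ideal_prod:
  assumes A: "left_ideal A R" and "L \<noteq> {}" "L \<subseteq> carrier R"
  shows "left_ideal (A \<cdot> L) R"
proof (rule left_idealI)
  show "A \<cdot> L \<subseteq> carrier R"
  proof
    fix x assume "x \<in> A \<cdot> L" then show "x \<in> carrier R"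
      using left_idealD(2)[OF A] assms(3) by induct auto
  qed
  obtain l where "l \<in> L" using \<open>L \<noteq> {}\<close> by blast
  then have "\<zero> \<otimes> l \<in> A \<cdot> L" using left_idealD(3)[OF A] by (rule_tac ideal_prod.prod)
  then show "\<zero> \<in> A \<cdot> L" using \<open>l \<in> L\<close> assms(3) by auto
  show "x \<oplus> y \<in> A \<cdot> L" if "x \<in> A \<cdot> L" "y \<in> A \<cdot> L" for x y using that by (rule ideal_prod.sum)
  fix r x assume r: "r \<in> carrier R" and "x \<in> A \<cdot> L"
  from this(2) show "r \<otimes> x \<in> A \<cdot> L"
  proof induct
    case (prod a l)
    then have "r \<otimes> (a \<otimes> l) = (r \<otimes> a) \<otimes> l" "r \<otimes> a \<in> A"
      using r A assms(3) by (auto simp: m_assoc left_idealD)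
    then show ?case using ideal_prod.prod[of "r \<otimes> a" A l L R] prod by simp
  next
    case (sum x y)
    have "x \<in> carrier R" "y \<in> carrier R" using sum \<open>A \<cdot> L \<subseteq> carrier R\<close> by auto
    then show ?case using sum ideal_prod.sum r by (metis r_distr)
  qed
qed

lemma ideal_prod_least:
  assumes I: "left_ideal I R" and "\<And>a l. a \<in> A \<Longrightarrow> l \<in> L \<Longrightarrow> a \<otimes> l \<in> I"
  shows "A \<cdot> L \<subseteq> I"
proof
  fix x assume "x \<in> A \<cdot> L" then show "x \<in> I"
    by induct (use assms(2) left_idealD(4)[OF I] in auto)
qed

text \<open>The modular law in the form used for chains: once the intersections with
  \<open>A\<close> and the sums with \<open>A\<close> have stabilised, so has the chain.\<close>

lemma left_ideal_modular_eq:
  assumes Z: "left_ideal Z R" "left_ideal Z' R" and A: "left_ideal A R" and "Z \<subseteq> Z'"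
    and int: "Z' \<inter> A \<subseteq> Z" and sum: "Z' \<subseteq> Z <+>\<^bsub>R\<^esub> A"
  shows "Z' = Z"
proof (rule antisym[OF subsetI])
  fix x assume x: "x \<in> Z'"
  then obtain y a where ya: "y \<in> Z" "a \<in> A" "x = y \<oplus> a" using sum unfolding subset_iff mem_set_add by blast
  then have "a \<in> Z'"
    using left_ideal_cancel[of Z' y a] Z \<open>Z \<subseteq> Z'\<close> x left_idealD(2)[OF Z(1)] left_idealD(2)[OF A]
    by auto
  then show "x \<in> Z" using int ya left_idealD(4)[OF Z(1)] by blast
qed fact

section \<open>Left Artinian rings are left Noetherian\<close>

lemma acc_on_set_add:
  assumes A: "left_ideal A R" "acc_on {I. left_ideal I R \<and> I \<subseteq> A}"
    and B: "left_ideal B R" "acc_on {I. left_ideal I R \<and> I \<subseteq> B}"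
  shows "acc_on {I. left_ideal I R \<and> I \<subseteq> A <+>\<^bsub>R\<^esub> B}"
  unfolding acc_on_def
proof (intro allI impI)
  fix I :: "nat \<Rightarrow> _"
  assume "\<forall>n. I n \<in> {I. left_ideal I R \<and> I \<subseteq> A <+>\<^bsub>R\<^esub> B} \<and> I n \<subseteq> I (Suc n)"
  then have I: "\<And>n. left_ideal (I n) R" "\<And>n. I n \<subseteq> A <+>\<^bsub>R\<^esub> B" and mono: "\<And>n. I n \<subseteq> I (Suc n)"
    by auto
  have le: "I m \<subseteq> I n" if "m \<le> n" for m n using mono that by (rule lift_Suc_mono_le)
  obtain N1 where N1: "\<forall>n\<ge>N1. I n \<inter> A = I N1 \<inter> A"
    using acc_onD[OF A(2), of "\<lambda>n. I n \<inter> A"] left_ideal_Int[OF I(1) A(1)] mono by fastforce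
  \<comment> \<open>The trace \<open>(I n + A) \<inter> B\<close> stands for the image of the chain
    in \<open>(A + B)/A\<close>.\<close>
  obtain N2 where N2: "\<forall>n\<ge>N2. (I n <+>\<^bsub>R\<^esub> A) \<inter> B = (I N2 <+>\<^bsub>R\<^esub> A) \<inter> B"
    using acc_onD[OF B(2), of "\<lambda>n. (I n <+>\<^bsub>R\<^esub> A) \<inter> B"]
      left_ideal_Int[OF left_ideal_set_add[OF I(1) A(1)] B(1)] set_add_mono_left[OF mono] by blast
  define N where "N = max N1 N2"
  have "I n = I N" if "n \<ge> N" for n
  proof (rule left_ideal_modular_eq[OF I(1) I(1) A(1) le[OF that]])
    show "I n \<inter> A \<subseteq> I N" using N1 that by (metis N_def inf.cobounded1 max.bounded_iff order_refl)
    show "I n \<subseteq> I N <+>\<^bsub>R\<^esub> A"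
    proof
      fix x assume x: "x \<in> I n"
      then obtain a b where ab: "a \<in> A" "b \<in> B" "x = a \<oplus> b" using I(2) by (force simp: mem_set_add)
      have c: "x \<in> carrier R" "a \<in> carrier R" "b \<in> carrier R"
        using x ab I(1) A(1) B(1) by (auto dest: left_idealD)
      then have "b = x \<oplus> \<ominus> a" unfolding ab by algebra
      then have "b \<in> (I n <+>\<^bsub>R\<^esub> A) \<inter> B"
        using x ab left_ideal_a_inv[OF A(1)] by (auto simp: mem_set_add)
      also have "\<dots> = (I N <+>\<^bsub>R\<^esub> A) \<inter> B" using N2 that by (metis N_def max.bounded_iff order_refl)
      finally have "b \<in> I N <+>\<^bsub>R\<^esub> A" by blast
      moreover have "a \<in> I N <+>\<^bsub>R\<^esub> A" using ab set_add_upper[OF I(1) A(1)] by blast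
      ultimately show "x \<in> I N <+>\<^bsub>R\<^esub> A"
        using ab left_idealD(4)[OF left_ideal_set_add[OF I(1) A(1)]] by blast
    qed
  qed
  then show "\<exists>N. \<forall>n\<ge>N. I n = I N" by blast
qed

text \<open>\<open>R(x + y)\<close> lies in \<open>R x + R y\<close>, which is proper by
  \<open>hollow\<close>; this makes the non-generators of \<open>A\<close> closed under addition. If
  \<open>A\<close> is cyclic, they form its greatest proper left subideal.\<close>

lemma left_ideal_hollow_radical:
  assumes A: "left_ideal A R" "A \<noteq> {\<zero>}"
    and hollow: "\<And>B C. left_ideal B R \<Longrightarrow> left_ideal C R \<Longrightarrow> B \<subset> A \<Longrightarrow> C \<subset> A \<Longrightarrow> B <+>\<^bsub>R\<^esub> C \<noteq> A"
  shows "left_ideal {y \<in> A. left_multiples R (carrier R) y \<noteq> A} R" (is "left_ideal ?D R")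
proof (rule left_idealI)
  let ?p = "left_multiples R (carrier R)"
  note lp = left_ideal_left_multiples[OF left_ideal_carrier]
  have sub: "?p y \<subseteq> A" if "y \<in> A" for y using left_multiples_subset[OF A(1) that] by simp
  show "?D \<subseteq> carrier R" using left_idealD[OF A(1)] by auto
  have "?p \<zero> = {\<zero>}" by (auto simp: left_multiples_def)
  then show "\<zero> \<in> ?D" using A left_idealD by auto
  show "x \<oplus> y \<in> ?D" if "x \<in> ?D" "y \<in> ?D" for x y
  proof -
    have x: "x \<in> A" "x \<in> carrier R" "?p x \<subset> A" and y: "y \<in> A" "y \<in> carrier R" "?p y \<subset> A"
      using that sub left_idealD[OF A(1)] by auto
    have "?p (x \<oplus> y) \<subseteq> ?p x <+>\<^bsub>R\<^esub> ?p y"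
      using x(2) y(2) unfolding left_multiples_def subset_iff mem_set_add by (auto simp: r_distr)
    moreover have "?p x <+>\<^bsub>R\<^esub> ?p y \<subset> A"
      using hollow[OF lp lp x(3) y(3)] x y set_add_least[OF A(1)] by auto
    ultimately show ?thesis using x y left_idealD[OF A(1)] by auto
  qed
  show "r \<otimes> x \<in> ?D" if "r \<in> carrier R" "x \<in> ?D" for r x
  proof -
    have x: "x \<in> A" "x \<in> carrier R" "?p x \<subset> A"
      using that sub left_idealD[OF A(1)] by auto
    then have "?p (r \<otimes> x) \<subseteq> ?p x"
      using that(1) by (auto simp: left_multiples_def m_assoc[symmetric])
    then show ?thesis using x that(1) left_idealD[OF A(1)] by auto
  qed
qed

text \<open>
  A left ideal \<open>L\<close> minimal among the non-Noetherian ones is not a sum of two proper left subideals.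
  A left ideal \<open>A\<close> minimal with \<open>AL = L\<close> inherits this and is cyclic, hence has a greatest proper
  left subideal \<open>D\<close>. Then \<open>L/DL\<close> is a sum of simple modules and cannot be decomposed, so it is
  simple, which makes \<open>L\<close> cyclic and thus an extension of a simple module by a Noetherian one.
\<close>

theorem left_artinian_imp_noetherian:
  assumes dcc: "dcc_on {I. left_ideal I R}"
  shows "acc_on {I. left_ideal I R}"
proof (rule ccontr)
  let ?p = "left_multiples R (carrier R)"
  let ?noeth = "\<lambda>L. acc_on {I. left_ideal I R \<and> I \<subseteq> L}"
  note lp = left_ideal_left_multiples[OF left_ideal_carrier]
  assume "\<not> acc_on {I. left_ideal I R}"
  moreover have "{I. left_ideal I R} = {I. left_ideal I R \<and> I \<subseteq> carrier R}"
    by (auto dest: left_idealD)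
  ultimately have "carrier R \<in> {L. left_ideal L R \<and> \<not> ?noeth L}"
    using left_ideal_carrier by simp
  then obtain L where L: "left_ideal L R" "\<not> ?noeth L"
    and min: "\<And>Z. left_ideal Z R \<Longrightarrow> \<not> ?noeth Z \<Longrightarrow> Z \<subseteq> L \<Longrightarrow> Z = L"
    using dcc_on_minimal[OF dcc, of "{L. left_ideal L R \<and> \<not> ?noeth L}"] by blast
  note Lc = left_idealD[OF L(1)]
  have noeth: "?noeth Z" if "left_ideal Z R" "Z \<subset> L" for Z
    using min that by blast
  have hollow: "A <+>\<^bsub>R\<^esub> B \<noteq> L" if "left_ideal A R" "left_ideal B R" "A \<subset> L" "B \<subset> L" for A B
    using acc_on_set_add[OF that(1) noeth that(2) noeth] that L(2) by metis
  have "acc_on {I. left_ideal I R \<and> I \<subseteq> {\<zero>}}"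
  proof -
    have "I = {\<zero>}" if "left_ideal I R" "I \<subseteq> {\<zero>}" for I using that left_idealD(3) by blast
    then show ?thesis unfolding acc_on_def mem_Collect_eq by metis
  qed
  then have L0: "L \<noteq> {\<zero>}" using L(2) by metis
  \<comment> \<open>If \<open>L\<close> were cyclic, its non-generators would form a proper, hence
    Noetherian, left subideal. A chain in \<open>L\<close> either reaches \<open>L\<close> or
    contains no generator and stays in that subideal.\<close>
  have not_cyclic: "?p v \<noteq> L" if "v \<in> L" for v
  proof
    assume v: "?p v = L"
    let ?D = "{y \<in> L. ?p y \<noteq> L}"
    have "left_ideal ?D R" using hollow by (intro left_ideal_hollow_radical[OF L(1) L0])
    moreover have "?D \<subset> L" using v that by blast
    ultimately have D: "?noeth ?D" by (rule noeth)
    have "?noeth L"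
      unfolding acc_on_def
    proof (intro allI impI)
      fix I :: "nat \<Rightarrow> _"
      assume "\<forall>n. I n \<in> {I. left_ideal I R \<and> I \<subseteq> L} \<and> I n \<subseteq> I (Suc n)"
      then have I: "\<And>n. left_ideal (I n) R" "\<And>n. I n \<subseteq> L" and mono: "\<And>n. I n \<subseteq> I (Suc n)"
        by auto
      show "\<exists>N. \<forall>n\<ge>N. I n = I N"
      proof (cases "\<exists>N. I N = L")
        case True
        then obtain N where "I N = L" ..
        then have "I n = I N" if "n \<ge> N" for n
          using lift_Suc_mono_le[of I, OF mono that] I(2) by auto
        then show ?thesis by blast
      next
        case False
        have "I n \<subseteq> ?D" for n
          using left_multiples_subset[OF I(1)] I(2) False by (fastforce dest: subsetD)
        then show ?thesis using acc_onD[OF D, of I] I(1) mono by auto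
      qed
    qed
    then show False using L(2) by blast
  qed
  have prodL: "B \<cdot> L \<subseteq> L" "left_ideal (B \<cdot> L) R" if "left_ideal B R" for B
  proof -
    show "B \<cdot> L \<subseteq> L" using left_idealD(2)[OF that] Lc by (intro ideal_prod_least[OF L(1)]) auto
    show "left_ideal (B \<cdot> L) R" using Lc(1,3) by (intro left_ideal_ideal_prod[OF that]) auto
  qed
  have "L \<subseteq> carrier R \<cdot> L"
  proof
    fix x assume "x \<in> L"
    then have "\<one> \<otimes> x \<in> carrier R \<cdot> L" by (intro ideal_prod.prod) auto
    then show "x \<in> carrier R \<cdot> L" using \<open>x \<in> L\<close> Lc(2) by simp
  qed
  then have "carrier R \<cdot> L = L" using prodL(1)[OF left_ideal_carrier] by blast
  with left_ideal_carrier have "left_ideal (carrier R) R \<and> carrier R \<cdot> L = L" (is "?P (carrier R)")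
    by blast
  then have "\<exists>M\<in>Collect ?P. \<forall>C\<in>Collect ?P. C \<subseteq> M \<longrightarrow> C = M"
    by (intro dcc_on_minimal[OF dcc]) auto
  then obtain A where "?P A" and minP: "\<And>B. ?P B \<Longrightarrow> B \<subseteq> A \<Longrightarrow> B = A" by auto
  then have A: "left_ideal A R" "A \<cdot> L = L" by auto
  have minA: "B = A" if "left_ideal B R" "B \<cdot> L = L" "B \<subseteq> A" for B
    using minP that by blast
  note Ac = left_idealD[OF A(1)]
  \<comment> \<open>If \<open>A = B + C\<close>, then \<open>L = A L\<close> is
    \<open>B L + C L\<close>, and minimality of \<open>A\<close> makes both summands proper in
    \<open>L\<close>.\<close>
  have hollowA: "B <+>\<^bsub>R\<^esub> C \<noteq> A" if BC: "left_ideal B R" "left_ideal C R" "B \<subset> A" "C \<subset> A" for B C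
  proof
    assume sum: "B <+>\<^bsub>R\<^esub> C = A"
    have "A \<cdot> L \<subseteq> (B \<cdot> L) <+>\<^bsub>R\<^esub> (C \<cdot> L)"
    proof (rule ideal_prod_least[OF left_ideal_set_add])
      fix a l assume "a \<in> A" "l \<in> L"
      then obtain b c where "b \<in> B" "c \<in> C" "a = b \<oplus> c" using sum by (auto simp: mem_set_add)
      moreover from this have "a \<otimes> l = b \<otimes> l \<oplus> c \<otimes> l"
        using BC \<open>l \<in> L\<close> Lc(2) by (metis l_distr left_idealD(2))
      ultimately show "a \<otimes> l \<in> (B \<cdot> L) <+>\<^bsub>R\<^esub> (C \<cdot> L)"
        unfolding mem_set_add using \<open>l \<in> L\<close> by (blast intro: ideal_prod.prod)
    qed (use prodL BC in auto)
    moreover have "B \<cdot> L \<subset> L" "C \<cdot> L \<subset> L" using minA prodL BC by blast+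
    ultimately show False
      using hollow[of "B \<cdot> L" "C \<cdot> L"] prodL BC A(2) set_add_least[OF L(1), of "B \<cdot> L" "C \<cdot> L"] by auto
  qed
  \<comment> \<open>\<open>(A A) L = A (A L) = L\<close>, so minimality of \<open>A\<close> makes it
    idempotent.\<close>
  have AA: "A \<cdot> A = A"
  proof (rule minA)
    show "left_ideal (A \<cdot> A) R" using left_ideal_ideal_prod[OF A(1)] Ac by blast
    show "A \<cdot> A \<subseteq> A" using Ac by (intro ideal_prod_least[OF A(1)]) auto
    show "(A \<cdot> A) \<cdot> L = L"
    proof (rule antisym)
      show "(A \<cdot> A) \<cdot> L \<subseteq> L" using \<open>left_ideal (A \<cdot> A) R\<close> prodL by blast
      have "A \<cdot> L \<subseteq> (A \<cdot> A) \<cdot> L"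
      proof (rule ideal_prod_least)
        show AAL: "left_ideal (A \<cdot> A \<cdot> L) R" using \<open>left_ideal (A \<cdot> A) R\<close> prodL by blast
        fix a l assume a: "a \<in> A" and "l \<in> L"
        then have "l \<in> A \<cdot> L" using A(2) by simp
        then show "a \<otimes> l \<in> A \<cdot> A \<cdot> L"
        proof induct
          case (prod b m)
          then have "a \<otimes> (b \<otimes> m) = (a \<otimes> b) \<otimes> m" using a Ac(2) Lc(2) by (simp add: m_assoc)
          then show ?case using prod a by (metis ideal_prod.prod)
        next
          case (sum x y)
          then have "x \<in> carrier R" "y \<in> carrier R" using A(2) Lc(2) by auto
          then show ?case using sum a Ac(2) left_idealD(4)[OF AAL] by (simp add: r_distr)
        qed
      qed
      then show "L \<subseteq> (A \<cdot> A) \<cdot> L" using A(2) by simp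
    qed
  qed
  have A0: "A \<noteq> {\<zero>}"
  proof
    assume "A = {\<zero>}"
    then have "A \<cdot> L \<subseteq> {\<zero>}" using Lc(2) by (intro ideal_prod_least[OF left_ideal_zero]) auto
    then show False using A(2) L0 Lc(3) by auto
  qed
  \<comment> \<open>As \<open>A A = A\<close>, an element killed by all products \<open>a b\<close>
    is killed by \<open>A\<close>.\<close>
  have ann: "z = \<zero>" if "\<And>a b. a \<in> A \<Longrightarrow> b \<in> A \<Longrightarrow> a \<otimes> b \<otimes> x = \<zero>" "x \<in> carrier R" "z \<in> left_multiples R A x" for x z
  proof -
    have "left_ideal {y \<in> carrier R. y \<otimes> x \<in> {\<zero>}} R"
      using left_ideal_colon[OF left_ideal_zero] that(2) by simp
    then have "A \<cdot> A \<subseteq> {y \<in> carrier R. y \<otimes> x \<in> {\<zero>}}"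
      by (rule ideal_prod_least) (use that(1) Ac(2) in auto)
    then show ?thesis using that(3) AA by (auto simp: left_multiples_def)
  qed
  have "\<exists>a\<in>A. \<exists>b\<in>A. a \<otimes> b \<noteq> \<zero>"
  proof (rule ccontr)
    assume "\<not> ?thesis"
    then have "z = \<zero>" if "z \<in> A" for z
      using ann[of \<one> z] that Ac(2) by (force simp: left_multiples_def)
    then show False using A0 Ac(3) by blast
  qed
  with A(1) have "left_ideal A R \<and> A \<subseteq> A \<and> (\<exists>a\<in>A. \<exists>b\<in>A. a \<otimes> b \<noteq> \<zero>)"
    by blast
  \<comment> \<open>As in Brauer's lemma: if \<open>B\<close> is minimal inside \<open>A\<close>
    with \<open>A B\<close> nonzero, and \<open>b\<close> in \<open>B\<close> has \<open>A b\<close>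
    nonzero, then \<open>A b = B\<close>, so some \<open>a\<close> in \<open>A\<close> satisfies
    \<open>a b = b\<close>.\<close>
  moreover define P where "P B \<longleftrightarrow> left_ideal B R \<and> B \<subseteq> A \<and> (\<exists>a\<in>A. \<exists>b\<in>B. a \<otimes> b \<noteq> \<zero>)" for B
  ultimately have "P A" by simp
  then have "\<exists>M\<in>Collect P. \<forall>C\<in>Collect P. C \<subseteq> M \<longrightarrow> C = M"
    by (intro dcc_on_minimal[OF dcc]) (auto simp: P_def)
  then obtain B where "P B" and minB: "\<And>C. P C \<Longrightarrow> C \<subseteq> B \<Longrightarrow> C = B" by auto
  then have B: "left_ideal B R" "B \<subseteq> A" "\<exists>a\<in>A. \<exists>b\<in>B. a \<otimes> b \<noteq> \<zero>" by (auto simp: P_def)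
  then obtain a0 b where b: "b \<in> B" "a0 \<in> A" "a0 \<otimes> b \<noteq> \<zero>" by blast
  have bc: "b \<in> carrier R" using b B Ac by blast
  have "left_multiples R A b = B"
  proof (rule minB, unfold P_def, intro conjI)
    show "left_ideal (left_multiples R A b) R" using left_ideal_left_multiples[OF A(1) bc] .
    show sub: "left_multiples R A b \<subseteq> B" using left_multiples_subset[OF B(1) b(1)] Ac(1) by blast
    then show "left_multiples R A b \<subseteq> A" using B(2) by blast
    show "\<exists>a\<in>A. \<exists>c\<in>left_multiples R A b. a \<otimes> c \<noteq> \<zero>"
    proof (rule ccontr)
      assume "\<not> ?thesis"
      then have "a \<otimes> a' \<otimes> b = \<zero>" if "a \<in> A" "a' \<in> A" for a a'
        using that Ac(2) bc by (auto simp: left_multiples_def m_assoc)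
      then show False using ann[of b "a0 \<otimes> b"] b bc by (auto simp: left_multiples_def)
    qed
  qed
  then obtain a where a: "a \<in> A" "b = a \<otimes> b" using b(1) by (auto simp: left_multiples_def)
  have ac: "a \<in> carrier R" using a Ac by blast
  \<comment> \<open>\<open>x = x a + (x - x a)\<close> shows \<open>A = A a + ?K\<close>, where
    \<open>?K\<close> annihilates \<open>b\<close>. Since \<open>a b = b\<close> is nonzero,
    \<open>?K\<close> is proper, and hollowness of \<open>A\<close> leaves only
    \<open>A a = A\<close>.\<close>
  have Aa: "left_multiples R A a = A"
  proof (rule ccontr)
    assume "left_multiples R A a \<noteq> A"
    then have 1: "left_multiples R A a \<subset> A"
      using left_multiples_subset[OF A(1) a(1)] Ac(1) by blast
    let ?K = "A \<inter> {x \<in> carrier R. x \<otimes> b \<in> {\<zero>}}"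
    have K: "left_ideal ?K R"
      using left_ideal_Int[OF A(1) left_ideal_colon[OF left_ideal_zero bc]] .
    have "a \<otimes> b \<noteq> \<zero>"
    proof
      assume "a \<otimes> b = \<zero>"
      then have "b = \<zero>" using a(2) by simp
      then show False using b(3) Ac(2) b(2) by simp
    qed
    then have 2: "?K \<subset> A" using a(1) by blast
    have "A \<subseteq> left_multiples R A a <+>\<^bsub>R\<^esub> ?K"
    proof
      fix x assume x: "x \<in> A"
      have xc: "x \<in> carrier R" using x Ac(2) by simp
      have "(x \<ominus> x \<otimes> a) \<otimes> b = x \<otimes> b \<ominus> x \<otimes> (a \<otimes> b)" using xc ac bc by algebra
      also have "\<dots> = \<zero>" using xc bc unfolding a(2)[symmetric] by algebra
      finally have "x \<ominus> x \<otimes> a \<in> ?K"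
        using x a(1) ac xc left_ideal_minus[OF A(1)] Ac(5) by auto
      moreover have "x = x \<otimes> a \<oplus> (x \<ominus> x \<otimes> a)" using xc ac by algebra
      ultimately show "x \<in> left_multiples R A a <+>\<^bsub>R\<^esub> ?K"
        unfolding mem_set_add left_multiples_def using x by blast
    qed
    moreover have "left_multiples R A a <+>\<^bsub>R\<^esub> ?K \<subseteq> A" using 1 2 by (intro set_add_least[OF A(1)]) auto
    ultimately show False
      using hollowA[OF left_ideal_left_multiples[OF A(1) ac] K 1 2] by blast
  qed
  \<comment> \<open>The greatest proper left subideal of \<open>A\<close>: as \<open>a\<close>
    generates \<open>A\<close>, \<open>D\<close> is proper, and \<open>D L\<close> differs from
    \<open>L\<close> by minimality of \<open>A\<close>.\<close>
  define D where "D = {y \<in> A. ?p y \<noteq> A}"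
  have D: "left_ideal D R"
    unfolding D_def using hollowA by (intro left_ideal_hollow_radical[OF A(1) A0])
  have "A \<subseteq> ?p a"
  proof -
    have "left_multiples R A a \<subseteq> ?p a" using Ac(1) unfolding left_multiples_def by blast
    then show ?thesis using Aa by simp
  qed
  then have pa: "?p a = A" using left_multiples_subset[OF A(1) a(1)] by blast
  then have "D \<subset> A" using a(1) unfolding D_def by blast
  then have DL: "D \<cdot> L \<noteq> L" "D \<cdot> L \<subseteq> L" "left_ideal (D \<cdot> L) R" using minA D prodL by blast+
  \<comment> \<open>Modulo \<open>D L\<close>, \<open>A z\<close> is zero or simple: if
    \<open>x z\<close> is outside \<open>D L\<close>, then \<open>x\<close> is outside
    \<open>D\<close>, so \<open>x\<close> generates \<open>A\<close> and \<open>x z\<close>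
    generates \<open>A z\<close>.\<close>
  have simple: "left_multiples R A z \<subseteq> ?p w" if zw: "z \<in> L" "w \<in> left_multiples R A z" "w \<notin> D \<cdot> L" for z w
  proof
    obtain x where x: "x \<in> A" "w = x \<otimes> z" using zw(2) by (auto simp: left_multiples_def)
    then have "x \<notin> D" using zw ideal_prod.prod by metis
    then have px: "?p x = A" using x unfolding D_def by blast
    fix u assume "u \<in> left_multiples R A z"
    then obtain y where "y \<in> A" "u = y \<otimes> z" by (auto simp: left_multiples_def)
    moreover then obtain r where "r \<in> carrier R" "y = r \<otimes> x" using px by (auto simp: left_multiples_def)
    ultimately have "u = r \<otimes> w" "r \<in> carrier R" using x zw Lc(2) Ac(2) by (auto simp: m_assoc)
    then show "u \<in> ?p w" by (auto simp: left_multiples_def)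
  qed
  \<comment> \<open>\<open>A = R a\<close>, so the elements \<open>a z\<close> generate
    \<open>L = A L\<close>.\<close>
  have gen: "L \<subseteq> Z" if Z: "left_ideal Z R" "\<And>z. z \<in> L \<Longrightarrow> a \<otimes> z \<in> Z" for Z
  proof -
    have "A \<cdot> L \<subseteq> Z"
    proof (rule ideal_prod_least[OF Z(1)])
      fix y z assume "y \<in> A" "z \<in> L"
      then obtain q where "q \<in> carrier R" "y = q \<otimes> a" using pa by (auto simp: left_multiples_def)
      then show "y \<otimes> z \<in> Z"
        using Z(2)[OF \<open>z \<in> L\<close>] left_idealD(5)[OF Z(1)] ac Lc(2)[OF \<open>z \<in> L\<close>] by (simp add: m_assoc)
    qed
    then show ?thesis using A(2) by simp
  qed
  obtain x where x: "x \<in> L" "a \<otimes> x \<notin> D \<cdot> L" using gen[OF DL(3)] DL(1,2) by blast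
  define v where "v = a \<otimes> x"
  have v: "v \<in> L" "v \<in> carrier R" "v \<notin> D \<cdot> L" using x ac Lc unfolding v_def by auto
  \<comment> \<open>No ascending chain condition is available in \<open>L\<close>, so Zorn's lemma
    supplies a left subideal \<open>K\<close> above \<open>D L\<close> that is maximal among those
    missing \<open>v\<close>.\<close>
  let ?F = "{K. left_ideal K R \<and> D \<cdot> L \<subseteq> K \<and> K \<subseteq> L \<and> v \<notin> K}"
  have "\<exists>K\<in>?F. \<forall>Z\<in>?F. K \<subseteq> Z \<longrightarrow> Z = K"
  proof (rule subset_Zorn_nonempty)
    show "?F \<noteq> {}" using DL v by blast
    fix \<C> assume C: "\<C> \<noteq> {}" "subset.chain ?F \<C>"
    then have CF: "\<And>K. K \<in> \<C> \<Longrightarrow> K \<in> ?F" and tot: "\<And>K K'. K \<in> \<C> \<Longrightarrow> K' \<in> \<C> \<Longrightarrow> K \<subseteq> K' \<or> K' \<subseteq> K"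
      by (auto simp: subset_chain_def)
    have "left_ideal (\<Union>\<C>) R"
    proof (rule left_idealI)
      show "\<Union>\<C> \<subseteq> carrier R" using CF Lc(1) by blast
      show "\<zero> \<in> \<Union>\<C>" using CF C(1) left_idealD(3) by blast
      show "y \<oplus> z \<in> \<Union>\<C>" if yz: "y \<in> \<Union>\<C>" "z \<in> \<Union>\<C>" for y z
      proof -
        obtain K K' where K: "K \<in> \<C>" "y \<in> K" "K' \<in> \<C>" "z \<in> K'" using yz by blast
        obtain M where "M \<in> \<C>" "y \<in> M" "z \<in> M" using tot[OF K(1,3)] K by blast
        then show ?thesis using CF[of M] left_idealD(4)[of M] by blast
      qed
      show "r \<otimes> y \<in> \<Union>\<C>" if "r \<in> carrier R" "y \<in> \<Union>\<C>" for r y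
        using that CF left_idealD(5) by blast
    qed
    then show "\<Union>\<C> \<in> ?F" using CF C(1) by blast
  qed
  then obtain K where KF: "K \<in> ?F" and max: "\<And>Z. Z \<in> ?F \<Longrightarrow> K \<subseteq> Z \<Longrightarrow> Z = K" by (elim bexE) simp
  then have K: "left_ideal K R" "D \<cdot> L \<subseteq> K" "K \<subseteq> L" "v \<notin> K" by simp_all
  have maxK: "Z = K" if "left_ideal Z R" "D \<cdot> L \<subseteq> Z" "Z \<subseteq> L" "v \<notin> Z" "K \<subseteq> Z" for Z
    using that by (intro max) auto
  note Kv = left_ideal_set_add[OF K(1) lp[OF v(2)]] set_add_upper[OF K(1) lp[OF v(2)]]
  \<comment> \<open>If \<open>a z\<close> is outside \<open>K + R v\<close>, maximality puts
    \<open>v\<close> into \<open>K + A z\<close>, say \<open>v = k + w\<close>. Then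
    \<open>w\<close> is outside \<open>K\<close>, so \<open>A z\<close> lies in \<open>R w\<close>,
    inside \<open>K + R v\<close>. Once \<open>L = K + R v\<close> is known, hollowness gives
    \<open>R v = L\<close>.\<close>
  have "L \<subseteq> K <+>\<^bsub>R\<^esub> ?p v"
  proof (rule gen[OF Kv(1)], rule ccontr)
    fix z assume z: "z \<in> L" and out: "a \<otimes> z \<notin> K <+>\<^bsub>R\<^esub> ?p v"
    let ?Az = "left_multiples R A z"
    have Az: "left_ideal ?Az R" using left_ideal_left_multiples[OF A(1) Lc(2)[OF z]] .
    have az: "a \<otimes> z \<in> ?Az" using a(1) by (auto simp: left_multiples_def)
    note KA = left_ideal_set_add[OF K(1) Az] set_add_upper[OF K(1) Az]
    have "?Az \<subseteq> L" using left_multiples_subset[OF L(1) z] Ac(1) by blast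
    then have "K <+>\<^bsub>R\<^esub> ?Az \<subseteq> L" using K(3) set_add_least[OF L(1)] by blast
    moreover have "K <+>\<^bsub>R\<^esub> ?Az \<noteq> K" using az KA(3) out Kv(2) by blast
    ultimately have "v \<in> K <+>\<^bsub>R\<^esub> ?Az" using maxK[OF KA(1)] KA(2) K(2) by blast
    then obtain k w where kw: "k \<in> K" "w \<in> ?Az" "v = k \<oplus> w" by (auto simp: mem_set_add)
    have c: "k \<in> carrier R" "w \<in> carrier R" using kw left_idealD(2) K(1) Az by blast+
    have "w \<notin> K" using kw K(1,4) left_idealD(4) by blast
    then have "?Az \<subseteq> ?p w" using simple[OF z kw(2)] K(2) by blast
    also have "?p w \<subseteq> K <+>\<^bsub>R\<^esub> ?p v"
    proof (rule left_multiples_subset[OF Kv(1)])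
      have "k \<in> K <+>\<^bsub>R\<^esub> ?p v" "v \<in> K <+>\<^bsub>R\<^esub> ?p v" using Kv(2,3) kw(1) self_in_left_multiples[OF v(2)] by blast+
      then show "w \<in> K <+>\<^bsub>R\<^esub> ?p v" using left_ideal_cancel[OF Kv(1)] kw(3) c by metis
    qed auto
    finally show False using az out by blast
  qed
  moreover have "?p v \<subseteq> L" using left_multiples_subset[OF L(1) v(1)] by blast
  ultimately have "K <+>\<^bsub>R\<^esub> ?p v = L" using set_add_least[OF L(1) K(3)] by blast
  then have "?p v = L" using hollow[OF K(1) lp[OF v(2)]] K(3,4) v(1) \<open>?p v \<subseteq> L\<close> by blast
  then show False using not_cyclic[OF v(1)] by blast
qed

end

section \<open>Semiprime left Goldie rings\<close>

text \<open>Testing the cyclic left ideals \<open>R x\<close> is equivalent to the usual condition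
  that \<open>I\<close> meet every nonzero left ideal nontrivially.\<close>

definition essential_left_ideal :: "'a set \<Rightarrow> ('a, 'm) ring_scheme \<Rightarrow> bool" where
  "essential_left_ideal I R \<longleftrightarrow> left_ideal I R \<and>
     (\<forall>x \<in> carrier R - {\<zero>\<^bsub>R\<^esub>}. \<exists>r \<in> carrier R. r \<otimes>\<^bsub>R\<^esub> x \<in> I - {\<zero>\<^bsub>R\<^esub>})"

lemma regular_elementsD:
  assumes "c \<in> regular_elements R"
  shows "c \<in> carrier R" "\<And>r. r \<in> carrier R \<Longrightarrow> c \<otimes>\<^bsub>R\<^esub> r = \<zero>\<^bsub>R\<^esub> \<Longrightarrow> r = \<zero>\<^bsub>R\<^esub>"
    "\<And>r. r \<in> carrier R \<Longrightarrow> r \<otimes>\<^bsub>R\<^esub> c = \<zero>\<^bsub>R\<^esub> \<Longrightarrow> r = \<zero>\<^bsub>R\<^esub>"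
  using assms unfolding regular_elements_def by blast+

context ring
begin

lemma finsum_in_left_ideal:
  assumes I: "left_ideal I R" and "finite A" and "\<And>n. n \<in> A \<Longrightarrow> x n \<in> I"
  shows "finsum R x A \<in> I"
  using assms(2,3)
proof (induct A)
  case empty
  then show ?case using left_idealD(3)[OF I] by simp
next
  case (insert n A)
  then have "x \<in> A \<rightarrow> carrier R" "x n \<in> carrier R" using left_idealD(2)[OF I] by auto
  then show ?case using insert left_idealD(4)[OF I] by (simp add: finsum_insert)
qed

lemma mem_left_annihilator [simp]:
  "x \<in> left_annihilator R {a} \<longleftrightarrow> x \<in> carrier R \<and> x \<otimes> a = \<zero>"
  by (simp add: left_annihilator_def)

lemma left_ideal_left_annihilator: "a \<in> carrier R \<Longrightarrow> left_ideal (left_annihilator R {a}) R"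
  using left_ideal_colon[OF left_ideal_zero, of a] by (simp add: left_annihilator_def)

text \<open>If \<open>x a = 0\<close>, then \<open>x\<close> itself is in the colon left ideal;
  otherwise a multiplier that works for \<open>x a\<close> in \<open>I\<close> works for
  \<open>x\<close>.\<close>

lemma essential_colon:
  assumes I: "essential_left_ideal I R" and a: "a \<in> carrier R"
  shows "essential_left_ideal {x \<in> carrier R. x \<otimes> a \<in> I} R"
  unfolding essential_left_ideal_def
proof (intro conjI ballI)
  have LI: "left_ideal I R" using I by (simp add: essential_left_ideal_def)
  show "left_ideal {x \<in> carrier R. x \<otimes> a \<in> I} R" by (rule left_ideal_colon[OF LI a])
  fix x assume x: "x \<in> carrier R - {\<zero>}"
  show "\<exists>r\<in>carrier R. r \<otimes> x \<in> {x \<in> carrier R. x \<otimes> a \<in> I} - {\<zero>}"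
  proof (cases "x \<otimes> a = \<zero>")
    case True
    then show ?thesis using x left_idealD(3)[OF LI] by (intro bexI[of _ \<one>]) auto
  next
    case False
    then obtain r where "r \<in> carrier R" "r \<otimes> (x \<otimes> a) \<in> I - {\<zero>}"
      using I x a unfolding essential_left_ideal_def by blast
    then show ?thesis using x a by (intro bexI[of _ r]) (auto simp: m_assoc[symmetric])
  qed
qed

text \<open>
  Choosing in each \<open>T n\<close> a nonzero left ideal that meets \<open>T (Suc n)\<close> trivially would give an infinite
  direct sum.
\<close>

lemma descending_left_ideals_essential_step:
  assumes nodirect: "\<not> (\<exists>I :: nat \<Rightarrow> 'a set.
      (\<forall>n. left_ideal (I n) R \<and> I n \<noteq> {\<zero>}) \<and> direct_family R I)"
    and T: "\<And>n. left_ideal (T n) R" "\<And>n :: nat. T (Suc n) \<subseteq> T n"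
  shows "\<exists>n. \<forall>x\<in>T n. (\<forall>r\<in>carrier R. r \<otimes> x \<in> T (Suc n) \<longrightarrow> r \<otimes> x = \<zero>) \<longrightarrow> x = \<zero>"
proof (rule ccontr)
  assume "\<not> ?thesis"
  then have "\<forall>n. \<exists>x. x \<in> T n \<and> x \<noteq> \<zero> \<and> (\<forall>r\<in>carrier R. r \<otimes> x \<in> T (Suc n) \<longrightarrow> r \<otimes> x = \<zero>)"
    by blast
  then obtain x where x: "\<And>n. x n \<in> T n" "\<And>n. x n \<noteq> \<zero>"
    and sep: "\<And>n r. r \<in> carrier R \<Longrightarrow> r \<otimes> x n \<in> T (Suc n) \<Longrightarrow> r \<otimes> x n = \<zero>"
    by metis
  let ?I = "\<lambda>n. left_multiples R (carrier R) (x n)"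
  have xc: "x n \<in> carrier R" for n using left_idealD(2)[OF T(1) x(1)] .
  have I: "left_ideal (?I n) R" "?I n \<subseteq> T n" for n
    using left_ideal_left_multiples[OF left_ideal_carrier xc] left_multiples_subset[OF T(1) x(1)] by auto
  have I0: "?I n \<noteq> {\<zero>}" for n using self_in_left_multiples[OF xc] x(2) by blast
  have le: "T n \<subseteq> T m" if "m \<le> n" for m n using lift_Suc_antimono_le[of T, OF T(2) that] .
  have "direct_family R ?I"
    unfolding direct_family_def
  proof (intro allI impI, rule ccontr)
    fix A y assume A: "finite A \<and> (\<forall>n\<in>A. y n \<in> ?I n) \<and> finsum R y A = \<zero>" and ne: "\<not> (\<forall>n\<in>A. y n = \<zero>)"
    define B where "B = {n \<in> A. y n \<noteq> \<zero>}"
    have B: "finite B" "B \<noteq> {}" using A ne unfolding B_def by auto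
    have yc: "y n \<in> carrier R" if "n \<in> A" for n using A I(1) left_idealD(2) that by blast
    have "finsum R y B = finsum R y A"
      using A yc unfolding B_def by (intro add.finprod_mono_neutral_cong_left) auto
    then have sum0: "finsum R y B = \<zero>" using A by simp
    \<comment> \<open>With \<open>m\<close> least, all other terms lie in \<open>T (Suc m)\<close>,
      so the relation puts \<open>y m\<close> there too, against the choice of
      \<open>x m\<close>.\<close>
    define m where "m = Min B"
    have m: "m \<in> B" unfolding m_def using B by (rule Min_in)
    have rest: "y n \<in> T (Suc m)" if "n \<in> B - {m}" for n
    proof -
      have "n \<ge> m" using B(1) that unfolding m_def by simp
      then have "T n \<subseteq> T (Suc m)" using that by (intro le) auto
      then show ?thesis using that A I(2) unfolding B_def by blast
    qed
    have tail: "finsum R y (B - {m}) \<in> T (Suc m)"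
      using B(1) rest by (intro finsum_in_left_ideal[OF T(1)]) auto
    have "y m \<oplus> finsum R y (B - {m}) = finsum R y (insert m (B - {m}))"
      using B m yc by (subst finsum_insert) (auto simp: B_def)
    also have "insert m (B - {m}) = B" using m by blast
    finally have "finsum R y (B - {m}) \<oplus> y m = \<zero>"
      using sum0 m yc tail left_idealD(2)[OF T(1)] by (subst a_comm) (auto simp: B_def)
    then have "finsum R y (B - {m}) \<oplus> y m \<in> T (Suc m)" using left_idealD(3)[OF T(1)] by simp
    moreover have "y m \<in> carrier R" using m yc by (simp add: B_def)
    ultimately have "y m \<in> T (Suc m)"
      using left_ideal_cancel[OF T(1)] tail left_idealD(2)[OF T(1) tail] by blast
    moreover obtain r where "r \<in> carrier R" "y m = r \<otimes> x m"
      using A m by (auto simp: B_def left_multiples_def)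
    ultimately have "y m = \<zero>" using sep by simp
    then show False using m by (simp add: B_def)
  qed
  then have "\<exists>I :: nat \<Rightarrow> 'a set. (\<forall>n. left_ideal (I n) R \<and> I n \<noteq> {\<zero>}) \<and> direct_family R I"
    using I(1) I0 by (intro exI[of _ ?I]) simp
  then show False using nodirect by (rule_tac notE)
qed

text \<open>Moves nilpotency between \<open>r a\<close> and \<open>a r\<close>, which connects nil
  left ideals with nil right ideals.\<close>

lemma nat_pow_mult_shift:
  assumes "a \<in> carrier R" "r \<in> carrier R"
  shows "(a \<otimes> r) [^] Suc n = a \<otimes> (r \<otimes> a) [^] n \<otimes> r"
proof (induct n)
  case 0
  then show ?case using assms by simp
next
  case (Suc n)
  have "(a \<otimes> r) [^] Suc (Suc n) = (a \<otimes> (r \<otimes> a) [^] n \<otimes> r) \<otimes> (a \<otimes> r)"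
    using Suc by simp
  also have "\<dots> = a \<otimes> ((r \<otimes> a) [^] n \<otimes> (r \<otimes> a)) \<otimes> r"
    using assms nat_pow_closed[of "r \<otimes> a" n] by (simp add: m_assoc)
  finally show ?case by simp
qed

end

section \<open>Goldie's theorem for semiprime rings\<close>

locale semiprime_left_goldie = ring +
  assumes goldie: "left_goldie R"
    and semiprime: "a \<in> carrier R \<Longrightarrow> (\<And>r. r \<in> carrier R \<Longrightarrow> a \<otimes> r \<otimes> a = \<zero>) \<Longrightarrow> a = \<zero>"
begin

lemma acc_left_annihilator: "acc_on {left_annihilator R Y | Y. Y \<subseteq> carrier R}"
  and no_infinite_direct_sum:
    "\<not> (\<exists>I :: nat \<Rightarrow> 'a set. (\<forall>n. left_ideal (I n) R \<and> I n \<noteq> {\<zero>}) \<and> direct_family R I)"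
  using goldie unfolding left_goldie_def by blast+

lemma left_annihilator_pow_stable:
  assumes b: "b \<in> carrier R"
  shows "\<exists>N::nat. \<forall>n\<ge>N. left_annihilator R {b [^] n} = left_annihilator R {b [^] N}"
proof (rule acc_onD[OF acc_left_annihilator])
  show "left_annihilator R {b [^] n} \<in> {left_annihilator R Y | Y. Y \<subseteq> carrier R}" for n :: nat
    using b by blast
  show "left_annihilator R {b [^] n} \<subseteq> left_annihilator R {b [^] Suc n}" for n :: nat
    using b by (auto simp: m_assoc[symmetric])
qed

text \<open>Take a nonzero right multiple \<open>b\<close> of \<open>a\<close> with maximal left
  annihilator. Nilpotency of each \<open>b r\<close> then forces \<open>b r b = 0\<close>, so
  \<open>b\<close> vanishes by semiprimeness. This is Utumi's proof of Levitzki's theorem on nil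
  one-sided ideals.\<close>

lemma right_multiples_nil_imp_zero:
  assumes a: "a \<in> carrier R" and nil: "\<And>r. r \<in> carrier R \<Longrightarrow> \<exists>n::nat. (a \<otimes> r) [^] n = \<zero>"
  shows "a = \<zero>"
proof (rule ccontr)
  assume "a \<noteq> \<zero>"
  define B where "B = {b. (\<exists>r\<in>carrier R. b = a \<otimes> r) \<and> b \<noteq> \<zero>}"
  let ?l = "\<lambda>b. left_annihilator R {b}"
  have Bc: "B \<subseteq> carrier R" using a by (auto simp: B_def)
  have "a \<in> B" using a \<open>a \<noteq> \<zero>\<close> r_one[OF a] unfolding B_def by (auto intro!: bexI[of _ \<one>])
  then have "\<exists>M\<in>?l ` B. \<forall>Y\<in>?l ` B. M \<subseteq> Y \<longrightarrow> Y = M"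
    using Bc by (intro acc_on_maximal[OF acc_left_annihilator]) blast+
  then obtain b where b: "b \<in> B" and max: "\<And>c. c \<in> B \<Longrightarrow> ?l b \<subseteq> ?l c \<Longrightarrow> ?l c = ?l b"
    by auto
  obtain r0 where r0: "r0 \<in> carrier R" "b = a \<otimes> r0" using b by (auto simp: B_def)
  have bc: "b \<in> carrier R" using b Bc by blast
  have "b \<otimes> r \<otimes> b = \<zero>" if r: "r \<in> carrier R" for r
  proof -
    have "\<exists>n::nat. (b \<otimes> r) [^] n = \<zero>"
      using nil[of "r0 \<otimes> r"] a r r0 by (simp add: m_assoc)
    then obtain k where k: "(b \<otimes> r) [^] k = \<zero>" and least: "\<And>m::nat. m < k \<Longrightarrow> (b \<otimes> r) [^] m \<noteq> \<zero>"
      using exists_least_iff[of "\<lambda>n::nat. (b \<otimes> r) [^] n = \<zero>"] by blast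
    consider "k = 0" | "k = 1" | m where "k = Suc (Suc m)"
      by (metis One_nat_def nat.exhaust)
    then show ?thesis
    proof cases
      case 1
      then have "\<one> = \<zero>" using k by simp
      then show ?thesis using bc r by (metis l_null m_closed l_one)
    next
      case 2
      then show ?thesis using k bc r by simp
    next
      case 3
      \<comment> \<open>Here \<open>c\<close> is the last nonzero power of \<open>b r\<close>. Its
        left annihilator contains that of \<open>b\<close>, hence equals it by maximality; and
        \<open>b r\<close> kills \<open>c\<close>, so it kills \<open>b\<close>.\<close>
      define c where "c = (b \<otimes> r) [^] Suc m"
      have cb: "c = b \<otimes> (r \<otimes> b) [^] m \<otimes> r" unfolding c_def using bc r by (rule nat_pow_mult_shift)
      then have "c = a \<otimes> (r0 \<otimes> (r \<otimes> b) [^] m \<otimes> r)"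
        using a r0 r bc by (simp add: m_assoc)
      moreover have "c \<noteq> \<zero>" using least[of "Suc m"] 3 unfolding c_def by simp
      ultimately have "c \<in> B" using a r0 r bc unfolding B_def by (auto intro!: bexI)
      moreover have "?l b \<subseteq> ?l c"
      proof
        fix x assume "x \<in> ?l b"
        then have x: "x \<in> carrier R" "x \<otimes> b = \<zero>" by auto
        have "x \<otimes> c = (x \<otimes> b) \<otimes> ((r \<otimes> b) [^] m \<otimes> r)" unfolding cb using x(1) bc r by (simp add: m_assoc)
        then show "x \<in> ?l c" using x bc r by simp
      qed
      ultimately have "?l c = ?l b" using max by blast
      moreover have "(b \<otimes> r) \<otimes> c = \<zero>"
        using k 3 bc r nat_pow_Suc2[of "b \<otimes> r" "Suc m"] unfolding c_def by simp
      ultimately show ?thesis using bc r by (metis m_closed mem_left_annihilator)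
    qed
  qed
  then have "b = \<zero>" using semiprime[OF bc] by blast
  then show False using b by (simp add: B_def)
qed

lemma left_multiples_nil_imp_zero:
  assumes a: "a \<in> carrier R" and nil: "\<And>r. r \<in> carrier R \<Longrightarrow> \<exists>n::nat. (r \<otimes> a) [^] n = \<zero>"
  shows "a = \<zero>"
proof (rule right_multiples_nil_imp_zero[OF a])
  fix r assume r: "r \<in> carrier R"
  then obtain n :: nat where "(r \<otimes> a) [^] n = \<zero>" using nil by blast
  then have "(a \<otimes> r) [^] Suc n = \<zero>" unfolding nat_pow_mult_shift[OF a r] using a r by simp
  then show "\<exists>n::nat. (a \<otimes> r) [^] n = \<zero>" by blast
qed

text \<open>Each \<open>b = r a\<close> also has an essential left annihilator, and it is nilpotent:
  once the annihilators of its powers are stable, a nonzero \<open>b^N\<close> would have a nonzero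
  multiple \<open>s b^N\<close> killed by \<open>b\<close>, so \<open>s\<close> would kill
  \<open>b^(N+1)\<close> and hence \<open>b^N\<close>.\<close>

lemma singular_imp_zero:
  assumes a: "a \<in> carrier R" and ess: "essential_left_ideal (left_annihilator R {a}) R"
  shows "a = \<zero>"
proof (rule left_multiples_nil_imp_zero[OF a])
  fix r assume r: "r \<in> carrier R"
  define b where "b = r \<otimes> a"
  have b: "b \<in> carrier R" using r a by (simp add: b_def)
  have "left_annihilator R {b} = {x \<in> carrier R. x \<otimes> r \<in> left_annihilator R {a}}"
    using a r by (auto simp: b_def m_assoc)
  then have essb: "essential_left_ideal (left_annihilator R {b}) R"
    using essential_colon[OF ess r] by simp
  obtain N :: nat where N: "\<forall>n\<ge>N. left_annihilator R {b [^] n} = left_annihilator R {b [^] N}"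
    using left_annihilator_pow_stable[OF b] by blast
  have "b [^] N = \<zero>"
  proof (rule ccontr)
    assume "b [^] N \<noteq> \<zero>"
    then obtain s where s: "s \<in> carrier R" "s \<otimes> b [^] N \<in> left_annihilator R {b}" "s \<otimes> b [^] N \<noteq> \<zero>"
      using essb nat_pow_closed[OF b, of N] unfolding essential_left_ideal_def by blast
    then have "s \<in> left_annihilator R {b [^] Suc N}" using b by (simp add: m_assoc)
    then have "s \<in> left_annihilator R {b [^] N}" using N by (metis le_SucI order_refl)
    then show False using s(3) by simp
  qed
  then show "\<exists>n::nat. (r \<otimes> a) [^] n = \<zero>" unfolding b_def by blast
qed

text \<open>Some left multiple \<open>b\<close> of a nonzero element of \<open>T\<close> is not
  nilpotent. Beyond the point where the annihilators of its powers are stable, a power and its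
  square have the same annihilator. The exponent \<open>Suc N\<close> is positive so that the power
  stays in \<open>T\<close>.\<close>

lemma exists_left_annihilator_square:
  assumes T: "left_ideal T R" "T \<noteq> {\<zero>}"
  shows "\<exists>a\<in>T. a \<noteq> \<zero> \<and> left_annihilator R {a \<otimes> a} = left_annihilator R {a}"
proof -
  obtain x where x: "x \<in> T" "x \<noteq> \<zero>" using T left_idealD(3) by blast
  then obtain r where r: "r \<in> carrier R" "\<And>n::nat. (r \<otimes> x) [^] n \<noteq> \<zero>"
    using left_multiples_nil_imp_zero[of x] left_idealD(2)[OF T(1)] by blast
  define b where "b = r \<otimes> x"
  have b: "b \<in> T" "b \<in> carrier R" using r x left_idealD[OF T(1)] by (auto simp: b_def)
  obtain N :: nat where N: "\<forall>n\<ge>N. left_annihilator R {b [^] n} = left_annihilator R {b [^] N}"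
    using left_annihilator_pow_stable[OF b(2)] by blast
  have "b [^] Suc N \<otimes> b [^] Suc N = b [^] (Suc N + Suc N)" using b(2) by (rule nat_pow_mult)
  then have "left_annihilator R {b [^] Suc N \<otimes> b [^] Suc N} = left_annihilator R {b [^] Suc N}"
    using N by (metis le_SucI le_add1 order_refl trans_le_add1)
  moreover have "b [^] Suc N \<in> T" using b left_idealD(5)[OF T(1)] by simp
  moreover have "b [^] Suc N \<noteq> \<zero>" using r(2) by (simp only: b_def) blast
  ultimately show ?thesis by blast
qed

text \<open>In the chain of the \<open>R c^n\<close>, some \<open>R c^(n+1)\<close> is essential in
  \<open>R c^n\<close>. Cancelling \<open>c^n\<close> on the right, possible since \<open>c\<close>
  has zero left annihilator, turns this into \<open>R c\<close> being essential in
  \<open>R\<close>.\<close>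

lemma left_multiples_essential:
  assumes c: "c \<in> carrier R" "left_annihilator R {c} = {\<zero>}"
  shows "essential_left_ideal (left_multiples R (carrier R) c) R"
  unfolding essential_left_ideal_def
proof (intro conjI ballI)
  let ?T = "\<lambda>n::nat. left_multiples R (carrier R) (c [^] n)"
  have cancel: "x = y" if "x \<otimes> c [^] n = y \<otimes> c [^] n" "x \<in> carrier R" "y \<in> carrier R" for x y and n :: nat
    using that
  proof (induct n arbitrary: x y)
    case (Suc n)
    have "(x \<otimes> c [^] n) \<otimes> c = (y \<otimes> c [^] n) \<otimes> c" using Suc(2-4) c(1) by (simp add: m_assoc)
    then have "(x \<otimes> c [^] n \<ominus> y \<otimes> c [^] n) \<otimes> c = \<zero>"
      using c(1) Suc(3,4) by (simp add: a_minus_def l_distr l_minus r_neg)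
    then have "x \<otimes> c [^] n \<ominus> y \<otimes> c [^] n \<in> left_annihilator R {c}" using c(1) Suc(3,4) by simp
    then have "x \<otimes> c [^] n = y \<otimes> c [^] n" using c Suc(3,4) by simp
    then show ?case using Suc by blast
  qed simp
  show "left_ideal (left_multiples R (carrier R) c) R"
    using left_ideal_left_multiples[OF left_ideal_carrier c(1)] .
  have T: "left_ideal (?T n) R" for n using left_ideal_left_multiples[OF left_ideal_carrier] c(1) by simp
  have "c [^] Suc n \<in> ?T n" for n
    using c(1) nat_pow_Suc2[OF c(1), of n] unfolding left_multiples_def by (intro image_eqI[of _ _ c]) auto
  then have "?T (Suc n) \<subseteq> ?T n" for n by (intro left_multiples_subset[OF T]) auto
  from descending_left_ideals_essential_step[of ?T, OF no_infinite_direct_sum T this]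
  obtain n where n: "\<And>y. y \<in> ?T n \<Longrightarrow> (\<And>r. r \<in> carrier R \<Longrightarrow> r \<otimes> y \<in> ?T (Suc n) \<Longrightarrow> r \<otimes> y = \<zero>) \<Longrightarrow> y = \<zero>"
    by (elim exE) metis
  fix x assume x: "x \<in> carrier R - {\<zero>}"
  have "x \<otimes> c [^] n \<noteq> \<zero>"
  proof
    assume "x \<otimes> c [^] n = \<zero>"
    then have "x \<otimes> c [^] n = \<zero> \<otimes> c [^] n" using c(1) by simp
    then show False using cancel[of x n \<zero>] x by auto
  qed
  moreover have "x \<otimes> c [^] n \<in> ?T n" using x by (auto simp: left_multiples_def)
  ultimately obtain r where r: "r \<in> carrier R" "r \<otimes> (x \<otimes> c [^] n) \<in> ?T (Suc n)" "r \<otimes> (x \<otimes> c [^] n) \<noteq> \<zero>"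
    using n by blast
  then obtain y where y: "y \<in> carrier R" "r \<otimes> (x \<otimes> c [^] n) = y \<otimes> c [^] Suc n"
    by (auto simp: left_multiples_def)
  then have "(r \<otimes> x) \<otimes> c [^] n = (y \<otimes> c) \<otimes> c [^] n"
    using r(1) x c(1) nat_pow_Suc2[OF c(1), of n] by (simp add: m_assoc)
  from cancel[OF this] have "r \<otimes> x = y \<otimes> c" using r(1) x c(1) y(1) by simp
  moreover have "r \<otimes> x \<noteq> \<zero>"
  proof
    assume "r \<otimes> x = \<zero>"
    then have "(r \<otimes> x) \<otimes> c [^] n = \<zero>" using c(1) by simp
    then show False using r(1,3) x c(1) by (simp add: m_assoc)
  qed
  ultimately show "\<exists>r\<in>carrier R. r \<otimes> x \<in> left_multiples R (carrier R) c - {\<zero>}"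
    using r(1) y(1) by (auto simp: left_multiples_def)
qed

text \<open>If \<open>c r = 0\<close>, the essential left ideal \<open>R c\<close> annihilates
  \<open>r\<close>, so \<open>r\<close> vanishes by \<open>singular_imp_zero\<close>.\<close>

lemma regular_if_left_annihilator_zero:
  assumes c: "c \<in> carrier R" "left_annihilator R {c} = {\<zero>}"
  shows "c \<in> regular_elements R"
proof -
  have "r = \<zero>" if r: "r \<in> carrier R" "c \<otimes> r = \<zero>" for r
  proof (rule singular_imp_zero[OF r(1)])
    have "left_multiples R (carrier R) c \<subseteq> left_annihilator R {r}"
      using r c(1) by (auto simp: left_multiples_def m_assoc)
    then show "essential_left_ideal (left_annihilator R {r}) R"
      using left_multiples_essential[OF c] left_ideal_left_annihilator[OF r(1)]
      unfolding essential_left_ideal_def by blast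
  qed
  moreover have "r = \<zero>" if "r \<in> carrier R" "r \<otimes> c = \<zero>" for r
    using c(2) that by (metis mem_left_annihilator singletonD)
  ultimately show ?thesis using c(1) unfolding regular_elements_def by blast
qed

text \<open>
  As long as \<open>I\<close> meets the left annihilator of \<open>c \<in> I\<close> nontrivially, adding to \<open>c\<close> a suitable element of
  the intersection shrinks the annihilator; the condition on squares makes the annihilator of the sum
  the intersection of the annihilators of the summands.
\<close>

theorem essential_contains_regular:
  assumes I: "essential_left_ideal I R"
  shows "\<exists>c\<in>I. c \<in> regular_elements R"
proof (rule ccontr)
  assume contra: "\<not> ?thesis"
  let ?l = "\<lambda>a. left_annihilator R {a}"
  have LI: "left_ideal I R" using I by (simp add: essential_left_ideal_def)
  let ?P = "\<lambda>c. c \<in> I \<and> ?l (c \<otimes> c) = ?l c"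
  \<comment> \<open>\<open>?Q c d\<close> records a non-essential drop from
    \<open>I \<inter> ?l c\<close> to \<open>I \<inter> ?l d\<close>: the left multiples of
    \<open>a\<close> meet the smaller set only in zero.\<close>
  let ?Q = "\<lambda>c d. ?l d \<subseteq> ?l c \<and> (\<exists>a\<in>I \<inter> ?l c. a \<noteq> \<zero> \<and> (\<forall>r\<in>carrier R. r \<otimes> a \<in> ?l d \<longrightarrow> r \<otimes> a = \<zero>))"
  have step: "\<exists>d. ?P d \<and> ?Q c d" if P: "?P c" for c
  proof -
    have c: "c \<in> I" "c \<in> carrier R" using P left_idealD(2)[OF LI] by auto
    have lc: "left_ideal (?l c) R" using left_ideal_left_annihilator[OF c(2)] .
    have "?l c \<noteq> {\<zero>}" using contra regular_if_left_annihilator_zero[OF c(2)] c(1) by blast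
    then obtain x where x: "x \<in> ?l c" "x \<noteq> \<zero>" using left_idealD(3)[OF lc] by blast
    have "x \<in> carrier R - {\<zero>}" using x by simp
    then obtain r where r: "r \<in> carrier R" "r \<otimes> x \<in> I - {\<zero>}"
      using I unfolding essential_left_ideal_def by blast
    then have "r \<otimes> x \<in> I \<inter> ?l c" "r \<otimes> x \<noteq> \<zero>" using left_idealD(5)[OF lc r(1) x(1)] by blast+
    then have "I \<inter> ?l c \<noteq> {\<zero>}" by blast
    then obtain a where a: "a \<in> I" "a \<in> ?l c" "a \<noteq> \<zero>" "?l (a \<otimes> a) = ?l a"
      using exists_left_annihilator_square[OF left_ideal_Int[OF LI lc]] by blast
    have ac: "a \<in> carrier R" "a \<otimes> c = \<zero>" using a(2) by auto
    have sqc: "x \<otimes> c = \<zero>" if "x \<otimes> c \<otimes> c = \<zero>" "x \<in> carrier R" for x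
      using P that c(2) by (metis m_assoc mem_left_annihilator)
    have sqa: "x \<otimes> a = \<zero>" if "x \<otimes> a \<otimes> a = \<zero>" "x \<in> carrier R" for x
      using a(4) that ac(1) by (metis m_assoc mem_left_annihilator)
    define d where "d = c \<oplus> a"
    have d: "d \<in> I" "d \<in> carrier R" using c a ac left_idealD(4)[OF LI] by (auto simp: d_def)
    \<comment> \<open>Multiplying \<open>x c + x a = 0\<close> on the right by \<open>c\<close> and
      using \<open>a c = 0\<close> leaves \<open>x c c = 0\<close>; the condition on squares then
      gives \<open>x c = 0\<close>, and with it \<open>x a = 0\<close>.\<close>
    have ld: "x \<otimes> c = \<zero> \<and> x \<otimes> a = \<zero>" if xd: "x \<otimes> d = \<zero>" "x \<in> carrier R" for x
    proof -
      have sum: "x \<otimes> c \<oplus> x \<otimes> a = \<zero>" using xd c(2) ac by (simp add: d_def r_distr)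
      then have "(x \<otimes> c \<oplus> x \<otimes> a) \<otimes> c = \<zero>" using c(2) by simp
      then have "x \<otimes> c \<otimes> c \<oplus> x \<otimes> (a \<otimes> c) = \<zero>" using xd(2) c(2) ac(1) by (simp add: l_distr m_assoc)
      then have "x \<otimes> c = \<zero>" using xd(2) c(2) ac by (intro sqc[OF _ xd(2)]) simp
      then show ?thesis using sum xd(2) ac(1) by simp
    qed
    \<comment> \<open>\<open>ld\<close> applies to \<open>y = x d\<close>. Expanding
      \<open>y c\<close> with \<open>a c = 0\<close> gives \<open>x c c = 0\<close>, hence
      \<open>x c = 0\<close> and \<open>y = x a\<close>; then \<open>y a = 0\<close> and the square
      condition for \<open>a\<close> give \<open>y = 0\<close>.\<close>
    have "x \<in> ?l d" if "x \<in> ?l (d \<otimes> d)" for x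
    proof -
      have x: "x \<in> carrier R" "x \<otimes> d \<otimes> d = \<zero>" using that d(2) by (auto simp: m_assoc)
      define y where "y = x \<otimes> d"
      have y: "y \<in> carrier R" "y \<otimes> c = \<zero>" "y \<otimes> a = \<zero>"
        using ld[of y] x d(2) by (auto simp: y_def)
      have "y \<otimes> c = x \<otimes> c \<otimes> c \<oplus> x \<otimes> (a \<otimes> c)"
        using x c(2) ac(1) by (simp add: y_def d_def r_distr l_distr m_assoc)
      then have "x \<otimes> c \<otimes> c = \<zero>" using y(2) ac x c(2) by simp
      then have xc: "x \<otimes> c = \<zero>" using sqc x(1) by blast
      then have yx: "y = x \<otimes> a" using x(1) c(2) ac(1) by (simp add: y_def d_def r_distr)
      then have "x \<otimes> a = \<zero>" using sqa y(3) x(1) by blast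
      then show ?thesis using yx x(1) by (simp add: y_def)
    qed
    moreover have "x \<in> ?l (d \<otimes> d)" if "x \<in> ?l d" for x
    proof -
      have "x \<otimes> (d \<otimes> d) = (x \<otimes> d) \<otimes> d" using that d(2) by (subst m_assoc) auto
      then show ?thesis using that d(2) by simp
    qed
    ultimately have "?l (d \<otimes> d) = ?l d" by blast
    moreover have "?l d \<subseteq> ?l c" using ld by auto
    moreover have "\<forall>r\<in>carrier R. r \<otimes> a \<in> ?l d \<longrightarrow> r \<otimes> a = \<zero>"
      using ld sqa ac(1) by auto
    moreover have "a \<in> I \<inter> ?l c" using a by blast
    ultimately show ?thesis using d(1) a(3) by (intro exI[of _ d] conjI bexI[of _ a])
  qed
  have "\<exists>c :: nat \<Rightarrow> 'a. \<forall>n. ?P (c n) \<and> ?Q (c n) (c (Suc n))"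
  proof (rule dependent_nat_choice)
    \<comment> \<open>The construction starts at zero, whose annihilator is the whole ring.\<close>
    show "\<exists>c. ?P c" using left_idealD(3)[OF LI] by (intro exI[of _ \<zero>]) auto
  qed (rule step)
  then obtain c :: "nat \<Rightarrow> 'a" where c: "\<And>n. ?P (c n)" "\<And>n. ?Q (c n) (c (Suc n))" by blast
  have cc: "c n \<in> carrier R" for n using c(1) left_idealD(2)[OF LI] by blast
  have "\<exists>n. \<forall>x\<in>I \<inter> ?l (c n). (\<forall>r\<in>carrier R. r \<otimes> x \<in> I \<inter> ?l (c (Suc n)) \<longrightarrow> r \<otimes> x = \<zero>) \<longrightarrow> x = \<zero>"
  proof (rule descending_left_ideals_essential_step[OF no_infinite_direct_sum])
    show "left_ideal (I \<inter> ?l (c n)) R" for n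
      using left_ideal_Int[OF LI left_ideal_left_annihilator[OF cc]] .
    show "I \<inter> ?l (c (Suc n)) \<subseteq> I \<inter> ?l (c n)" for n using c(2)[of n] by blast
  qed
  then show False using c(2) by blast
qed

text \<open>\<open>R c\<close> is essential, hence so is the left ideal of all \<open>x\<close> with
  \<open>x r\<close> in \<open>R c\<close>; any regular element of it serves as
  \<open>c'\<close>.\<close>

lemma goldie_left_Ore:
  assumes c: "c \<in> regular_elements R" and r: "r \<in> carrier R"
  shows "\<exists>c'\<in>regular_elements R. \<exists>r'\<in>carrier R. c' \<otimes> r = r' \<otimes> c"
proof -
  have cc: "c \<in> carrier R" using regular_elementsD(1)[OF c] .
  have lc: "left_annihilator R {c} = {\<zero>}"
  proof (rule antisym; rule subsetI)
    fix x assume "x \<in> left_annihilator R {c}"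
    then show "x \<in> {\<zero>}" using regular_elementsD(3)[OF c] by simp
  qed (use cc in simp)
  obtain c' where "c' \<in> regular_elements R" "c' \<otimes> r \<in> left_multiples R (carrier R) c"
    using essential_contains_regular[OF essential_colon[OF left_multiples_essential[OF cc lc] r]] by blast
  then show ?thesis by (auto simp: left_multiples_def)
qed

text \<open>At a step where \<open>I (Suc n)\<close> is essential in \<open>I n\<close>, each
  \<open>x\<close> in \<open>I n\<close> has an essential colon left ideal into
  \<open>I (Suc n)\<close>. A regular element of it carries \<open>x\<close> into
  \<open>I (Suc n)\<close>, and closedness returns \<open>x\<close> itself.\<close>

lemma goldie_dcc_closed:
  "dcc_on {I. left_ideal I R \<and> closed_under R (regular_elements R) I}"
proof (rule dcc_onI)
  fix I :: "nat \<Rightarrow> _"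
  assume "\<And>n. I n \<in> {I. left_ideal I R \<and> closed_under R (regular_elements R) I}"
    and mono: "\<And>n. I (Suc n) \<subseteq> I n"
  then have I: "\<And>n. left_ideal (I n) R" "\<And>n. closed_under R (regular_elements R) (I n)" by auto
  obtain n where n: "\<And>x. x \<in> I n \<Longrightarrow> (\<And>r. r \<in> carrier R \<Longrightarrow> r \<otimes> x \<in> I (Suc n) \<Longrightarrow> r \<otimes> x = \<zero>) \<Longrightarrow> x = \<zero>"
    using descending_left_ideals_essential_step[of I, OF no_infinite_direct_sum I(1) mono] by blast
  have "I n \<subseteq> I (Suc n)"
  proof
    fix x assume x: "x \<in> I n"
    have xc: "x \<in> carrier R" using left_idealD(2)[OF I(1) x] .
    let ?E = "{y \<in> carrier R. y \<otimes> x \<in> I (Suc n)}"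
    have E: "left_ideal ?E R" using left_ideal_colon[OF I(1) xc] .
    have "essential_left_ideal ?E R"
      unfolding essential_left_ideal_def
    proof (intro conjI ballI)
      fix y assume y: "y \<in> carrier R - {\<zero>}"
      show "\<exists>r\<in>carrier R. r \<otimes> y \<in> ?E - {\<zero>}"
      proof (cases "y \<otimes> x = \<zero>")
        case True
        then show ?thesis using y left_idealD(3)[OF I(1)] by (intro bexI[of _ \<one>]) auto
      next
        case False
        moreover have "y \<otimes> x \<in> I n" using left_idealD(5)[OF I(1) _ x] y by blast
        ultimately obtain r where r: "r \<in> carrier R" "r \<otimes> (y \<otimes> x) \<in> I (Suc n)" "r \<otimes> (y \<otimes> x) \<noteq> \<zero>"
          using n by blast
        then show ?thesis using y xc by (intro bexI[of _ r]) (auto simp: m_assoc[symmetric])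
      qed
    qed (fact E)
    then obtain c where "c \<in> regular_elements R" "c \<otimes> x \<in> I (Suc n)"
      using essential_contains_regular by blast
    then show "x \<in> I (Suc n)" using I(2) xc unfolding closed_under_def by blast
  qed
  then show "\<exists>n. I (Suc n) = I n" using mono by blast
qed

end

section \<open>Localization at a left Ore set\<close>

locale left_ore_set = ring +
  fixes S :: "'a set"
  assumes S_regular: "S \<subseteq> regular_elements R"
    and one_S: "\<one> \<in> S"
    and mult_S: "s \<in> S \<Longrightarrow> t \<in> S \<Longrightarrow> s \<otimes> t \<in> S"
    and left_Ore: "s \<in> S \<Longrightarrow> r \<in> carrier R \<Longrightarrow> \<exists>s'\<in>S. \<exists>r'\<in>carrier R. s' \<otimes> r = r' \<otimes> s"
begin

text \<open>
  The fraction \<open>q = s\<^sup>-\<^sup>1r\<close> is encoded as the graph \<open>{(x, y). xq = y}\<close> of right multiplication by \<open>q\<close>,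
  restricted to \<open>R\<close>. Two fractions agree as soon as their graphs share a point over an element of \<open>S\<close>,
  which reduces the ring axioms to exhibiting such a point.
\<close>

definition fraction :: "'a \<Rightarrow> 'a \<Rightarrow> ('a \<times> 'a) set" where
  "fraction s r = {(x, y). x \<in> carrier R \<and> y \<in> carrier R \<and>
     (\<exists>c\<in>S. \<exists>d\<in>carrier R. c \<otimes> x = d \<otimes> s \<and> c \<otimes> y = d \<otimes> r)}"

definition fractions :: "('a \<times> 'a) set set" where
  "fractions = {fraction s r | s r. s \<in> S \<and> r \<in> carrier R}"

text \<open>The choice is harmless because one point over \<open>S\<close> determines a fraction
  (\<open>fractions_eqI\<close>); \<open>frac_addI\<close> extends the rule to every common
  point.\<close>

definition frac_add :: "('a \<times> 'a) set \<Rightarrow> ('a \<times> 'a) set \<Rightarrow> ('a \<times> 'a) set" where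
  "frac_add G H = (SOME K. K \<in> fractions \<and>
     (\<exists>s\<in>S. \<exists>a b. (s, a) \<in> G \<and> (s, b) \<in> H \<and> (s, a \<oplus> b) \<in> K))"

text \<open>Right multiplications compose in reading order, so the product applies \<open>G\<close>
  first and \<open>H\<close> second.\<close>

definition frac_mult :: "('a \<times> 'a) set \<Rightarrow> ('a \<times> 'a) set \<Rightarrow> ('a \<times> 'a) set" where
  "frac_mult G H = (SOME K. K \<in> fractions \<and>
     (\<exists>s\<in>S. \<exists>a b. (s, a) \<in> G \<and> (a, b) \<in> H \<and> (s, b) \<in> K))"

definition frac_ring :: "('a \<times> 'a) set ring" where
  "frac_ring = \<lparr>carrier = fractions, monoid.mult = frac_mult, monoid.one = fraction \<one> \<one>,
     ring.zero = fraction \<one> \<zero>, ring.add = frac_add\<rparr>"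

lemma S_carrier [simp]: "s \<in> S \<Longrightarrow> s \<in> carrier R"
  using regular_elementsD(1)[OF subsetD[OF S_regular]] .

lemma S_cancel_left:
  assumes "s \<in> S" "x \<in> carrier R" "y \<in> carrier R" "s \<otimes> x = s \<otimes> y"
  shows "x = y"
proof -
  have "s \<otimes> (x \<ominus> y) = \<zero>" using assms by (simp add: a_minus_def r_distr r_minus r_neg)
  then have "x \<ominus> y = \<zero>" using regular_elementsD(2) S_regular assms by (metis minus_closed subsetD)
  then show ?thesis using assms by simp
qed

lemma S_cancel_right:
  assumes "s \<in> S" "x \<in> carrier R" "y \<in> carrier R" "x \<otimes> s = y \<otimes> s"
  shows "x = y"
proof -
  have "(x \<ominus> y) \<otimes> s = \<zero>" using assms by (simp add: a_minus_def l_distr l_minus r_neg)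
  then have "x \<ominus> y = \<zero>" using regular_elementsD(3) S_regular assms by (metis minus_closed subsetD)
  then show ?thesis using assms by simp
qed

lemma fraction_self: "s \<in> S \<Longrightarrow> r \<in> carrier R \<Longrightarrow> (s, r) \<in> fraction s r"
  using one_S by (auto simp: fraction_def intro!: bexI[of _ \<one>])

text \<open>The definition of \<open>fraction\<close> asks for one pair \<open>(c, d)\<close> with
  \<open>c\<close> in \<open>S\<close>; this covers every pair with \<open>c x = d s\<close>. The
  Ore condition brings \<open>c\<close> and the given \<open>c0\<close> to a common left multiple,
  after which \<open>s\<close> and \<open>e\<close> are cancelled.\<close>

lemma fraction_transfer:
  assumes sr: "s \<in> S" "r \<in> carrier R" and xy: "(x, y) \<in> fraction s r"
    and cd: "c \<in> carrier R" "d \<in> carrier R" "c \<otimes> x = d \<otimes> s"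
  shows "c \<otimes> y = d \<otimes> r"
proof -
  obtain c0 d0 where 0: "x \<in> carrier R" "y \<in> carrier R" "c0 \<in> S" "d0 \<in> carrier R"
      "c0 \<otimes> x = d0 \<otimes> s" "c0 \<otimes> y = d0 \<otimes> r"
    using xy by (auto simp: fraction_def)
  obtain e e' where e: "e \<in> S" "e' \<in> carrier R" "e \<otimes> c = e' \<otimes> c0" using left_Ore[OF 0(3) cd(1)] by blast
  have "(e \<otimes> d) \<otimes> s = (e \<otimes> c) \<otimes> x" using e(1) cd 0(1) sr by (simp add: m_assoc)
  also have "\<dots> = (e' \<otimes> d0) \<otimes> s" using e 0 sr by (simp add: m_assoc)
  finally have ed: "e \<otimes> d = e' \<otimes> d0" using S_cancel_right[OF sr(1)] e 0 cd by simp
  have "e \<otimes> (c \<otimes> y) = (e' \<otimes> c0) \<otimes> y" using e cd 0 by (simp add: m_assoc[symmetric])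
  also have "\<dots> = (e' \<otimes> d0) \<otimes> r" using e 0 sr by (simp add: m_assoc)
  also have "\<dots> = e \<otimes> (d \<otimes> r)" unfolding ed[symmetric] using e(1) cd sr by (simp add: m_assoc)
  finally show ?thesis using S_cancel_left[OF e(1)] cd 0 sr by simp
qed

lemma fractions_carrier:
  "G \<in> fractions \<Longrightarrow> (x, y) \<in> G \<Longrightarrow> x \<in> carrier R \<and> y \<in> carrier R"
  by (auto simp: fractions_def fraction_def)

text \<open>With \<open>fractions_sum\<close>, \<open>fractions_single_valued\<close> and
  \<open>fractions_domain_S\<close>, this shows that a fraction is the graph of a left linear map
  from a left ideal meeting \<open>S\<close> into \<open>R\<close>. The Ore relation
  \<open>c' a = a' c\<close> converts the witness for \<open>(x, y)\<close> into one for its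
  multiple.\<close>

lemma fractions_scale:
  assumes G: "G \<in> fractions" and xy: "(x, y) \<in> G" and a: "a \<in> carrier R"
  shows "(a \<otimes> x, a \<otimes> y) \<in> G"
proof -
  obtain s r where sr: "s \<in> S" "r \<in> carrier R" "G = fraction s r" using G by (auto simp: fractions_def)
  then obtain c d where c: "x \<in> carrier R" "y \<in> carrier R" "c \<in> S" "d \<in> carrier R"
      "c \<otimes> x = d \<otimes> s" "c \<otimes> y = d \<otimes> r"
    using xy by (auto simp: fraction_def)
  obtain c' a' where c': "c' \<in> S" "a' \<in> carrier R" "c' \<otimes> a = a' \<otimes> c" using left_Ore[OF c(3) a] by blast
  have "c' \<otimes> (a \<otimes> z) = (a' \<otimes> d) \<otimes> w"
    if "c \<otimes> z = d \<otimes> w" "z \<in> carrier R" "w \<in> carrier R" for z w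
  proof -
    have "c' \<otimes> (a \<otimes> z) = (a' \<otimes> c) \<otimes> z" using that(2) c' a by (simp add: m_assoc[symmetric])
    also have "\<dots> = (a' \<otimes> d) \<otimes> w" using that c c' by (simp add: m_assoc)
    finally show ?thesis .
  qed
  then have "c' \<otimes> (a \<otimes> x) = (a' \<otimes> d) \<otimes> s" "c' \<otimes> (a \<otimes> y) = (a' \<otimes> d) \<otimes> r" using c sr by auto
  moreover have "a' \<otimes> d \<in> carrier R" using c c' by simp
  ultimately show ?thesis unfolding sr(3) fraction_def using c'(1) a c(1,2) by blast
qed

text \<open>Saturation under \<open>S\<close> makes the domain as large as possible, so that maps
  agreeing at one element of \<open>S\<close> have equal graphs.\<close>

lemma fractions_unscale:
  assumes G: "G \<in> fractions" and s: "s \<in> S" and xy: "x \<in> carrier R" "y \<in> carrier R" "(s \<otimes> x, s \<otimes> y) \<in> G"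
  shows "(x, y) \<in> G"
proof -
  obtain t r where t: "t \<in> S" "r \<in> carrier R" "G = fraction t r" using G by (auto simp: fractions_def)
  then obtain c d where c: "c \<in> S" "d \<in> carrier R" "c \<otimes> (s \<otimes> x) = d \<otimes> t" "c \<otimes> (s \<otimes> y) = d \<otimes> r"
    using xy by (auto simp: fraction_def)
  then have "(c \<otimes> s) \<otimes> x = d \<otimes> t" "(c \<otimes> s) \<otimes> y = d \<otimes> r" using s xy by (simp_all add: m_assoc)
  then show ?thesis unfolding t(3) fraction_def using mult_S[OF c(1) s] c(2) xy by blast
qed

lemma fractions_sum:
  assumes G: "G \<in> fractions" and xy: "(x, y) \<in> G" "(x', y') \<in> G"
  shows "(x \<oplus> x', y \<oplus> y') \<in> G"
proof -
  obtain s r where sr: "s \<in> S" "r \<in> carrier R" "G = fraction s r" using G by (auto simp: fractions_def)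
  obtain c d where c: "x \<in> carrier R" "y \<in> carrier R" "c \<in> S" "d \<in> carrier R"
      "c \<otimes> x = d \<otimes> s" "c \<otimes> y = d \<otimes> r"
    using xy(1) sr by (auto simp: fraction_def)
  obtain c' d' where c': "x' \<in> carrier R" "y' \<in> carrier R" "c' \<in> S" "d' \<in> carrier R"
      "c' \<otimes> x' = d' \<otimes> s" "c' \<otimes> y' = d' \<otimes> r"
    using xy(2) sr by (auto simp: fraction_def)
  obtain e e' where e: "e \<in> S" "e' \<in> carrier R" "e \<otimes> c' = e' \<otimes> c" using left_Ore[OF c(3), of c'] c'(3) by auto
  have *: "(e \<otimes> c') \<otimes> (z \<oplus> z') = (e' \<otimes> d \<oplus> e \<otimes> d') \<otimes> w"
    if "c \<otimes> z = d \<otimes> w" "c' \<otimes> z' = d' \<otimes> w" "z \<in> carrier R" "z' \<in> carrier R" "w \<in> carrier R" for z z' w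
  proof -
    have "(e \<otimes> c') \<otimes> (z \<oplus> z') = (e' \<otimes> c) \<otimes> z \<oplus> (e \<otimes> c') \<otimes> z'"
      using that(3,4) e c(3) c'(3) by (simp add: r_distr)
    also have "\<dots> = e' \<otimes> (d \<otimes> w) \<oplus> e \<otimes> (d' \<otimes> w)" using that e(1,2) c(3) c'(3) by (simp add: m_assoc)
    also have "\<dots> = (e' \<otimes> d \<oplus> e \<otimes> d') \<otimes> w" using that(5) e(1,2) c(4) c'(4) by (simp add: m_assoc l_distr)
    finally show ?thesis .
  qed
  have "(e \<otimes> c') \<otimes> (x \<oplus> x') = (e' \<otimes> d \<oplus> e \<otimes> d') \<otimes> s" "(e \<otimes> c') \<otimes> (y \<oplus> y') = (e' \<otimes> d \<oplus> e \<otimes> d') \<otimes> r"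
    using * c c' sr by auto
  moreover have "e \<otimes> c' \<in> S" "e' \<otimes> d \<oplus> e \<otimes> d' \<in> carrier R" using mult_S[OF e(1) c'(3)] e(1,2) c(4) c'(4) by auto
  ultimately show ?thesis unfolding sr(3) fraction_def using c c' by blast
qed

lemma fractions_single_valued:
  assumes G: "G \<in> fractions" and xy: "(x, y) \<in> G" "(x, y') \<in> G"
  shows "y = y'"
proof -
  obtain s r where sr: "s \<in> S" "r \<in> carrier R" "G = fraction s r" using G by (auto simp: fractions_def)
  then obtain c d where c: "c \<in> S" "d \<in> carrier R" "c \<otimes> x = d \<otimes> s" "c \<otimes> y' = d \<otimes> r"
    using xy by (auto simp: fraction_def)
  then have "c \<otimes> y = c \<otimes> y'" using fraction_transfer[OF sr(1,2), of x y c d] xy sr by simp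
  then show ?thesis using S_cancel_left c(1) fractions_carrier[OF G] xy by blast
qed

lemma fractions_domain:
  assumes G: "G \<in> fractions" and x: "x \<in> carrier R"
  shows "\<exists>c\<in>S. \<exists>y. (c \<otimes> x, y) \<in> G"
proof -
  obtain s r where sr: "s \<in> S" "r \<in> carrier R" "G = fraction s r" using G by (auto simp: fractions_def)
  obtain c d where c: "c \<in> S" "d \<in> carrier R" "c \<otimes> x = d \<otimes> s" using left_Ore[OF sr(1) x] by blast
  then have "(c \<otimes> x, d \<otimes> r) \<in> G" using fractions_scale[OF G _ c(2)] fraction_self sr by simp
  then show ?thesis using c(1) by blast
qed

lemma fractions_domain_S: "G \<in> fractions \<Longrightarrow> \<exists>s\<in>S. \<exists>y. (s, y) \<in> G"
  using fraction_self by (force simp: fractions_def)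

text \<open>Given \<open>c x = d s\<close>, the value over \<open>c x\<close> is \<open>d a\<close>
  for both graphs; \<open>fractions_unscale\<close> then removes the factor
  \<open>c\<close>.\<close>

lemma fractions_eqI:
  assumes G: "G \<in> fractions" and H: "H \<in> fractions" and s: "s \<in> S" "(s, a) \<in> G" "(s, a) \<in> H"
  shows "G = H"
proof -
  have sub: "G \<subseteq> H" if G: "G \<in> fractions" "(s, a) \<in> G" and H: "H \<in> fractions" "(s, a) \<in> H" for G H
  proof
    fix p assume "p \<in> G"
    then obtain x y where p: "p = (x, y)" "(x, y) \<in> G" by (cases p) auto
    have xy: "x \<in> carrier R" "y \<in> carrier R" using fractions_carrier[OF G(1) p(2)] by auto
    obtain c d where c: "c \<in> S" "d \<in> carrier R" "c \<otimes> x = d \<otimes> s" using left_Ore[OF s(1) xy(1)] by blast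
    have "(c \<otimes> x, c \<otimes> y) \<in> G" "(c \<otimes> x, d \<otimes> a) \<in> G"
      using fractions_scale[OF G(1) p(2), of c] fractions_scale[OF G c(2)] c by auto
    then have "c \<otimes> y = d \<otimes> a" using fractions_single_valued[OF G(1)] by blast
    then have "(c \<otimes> x, c \<otimes> y) \<in> H" using fractions_scale[OF H] c by auto
    then show "p \<in> H" using fractions_unscale[OF H(1) c(1) xy] p by simp
  qed
  then show ?thesis using assms by blast
qed

lemma fraction_in_fractions [simp]: "s \<in> S \<Longrightarrow> r \<in> carrier R \<Longrightarrow> fraction s r \<in> fractions"
  by (auto simp: fractions_def)

lemma fractions_common_domain:
  assumes G: "G \<in> fractions" and H: "H \<in> fractions"
  shows "\<exists>s\<in>S. \<exists>a b. (s, a) \<in> G \<and> (s, b) \<in> H"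
proof -
  obtain s a where s: "s \<in> S" "(s, a) \<in> G" using fractions_domain_S[OF G] by blast
  obtain c b where c: "c \<in> S" "(c \<otimes> s, b) \<in> H" using fractions_domain[OF H, of s] s by auto
  have "(c \<otimes> s, c \<otimes> a) \<in> G" using fractions_scale[OF G s(2)] c by simp
  then show ?thesis using c mult_S[OF c(1) s(1)] by blast
qed

lemma fractions_composable:
  assumes G: "G \<in> fractions" and H: "H \<in> fractions"
  shows "\<exists>s\<in>S. \<exists>a b. (s, a) \<in> G \<and> (a, b) \<in> H"
proof -
  obtain s a where s: "s \<in> S" "(s, a) \<in> G" using fractions_domain_S[OF G] by blast
  obtain c b where c: "c \<in> S" "(c \<otimes> a, b) \<in> H"
    using fractions_domain[OF H, of a] fractions_carrier[OF G s(2)] by auto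
  have "(c \<otimes> s, c \<otimes> a) \<in> G" using fractions_scale[OF G s(2)] c by simp
  then show ?thesis using c mult_S[OF c(1) s(1)] by blast
qed

lemma frac_add_spec:
  assumes G: "G \<in> fractions" and H: "H \<in> fractions"
  shows "frac_add G H \<in> fractions \<and>
    (\<exists>s\<in>S. \<exists>a b. (s, a) \<in> G \<and> (s, b) \<in> H \<and> (s, a \<oplus> b) \<in> frac_add G H)"
  unfolding frac_add_def
proof (rule someI_ex)
  obtain s a b where s: "s \<in> S" "(s, a) \<in> G" "(s, b) \<in> H" using fractions_common_domain[OF G H] by blast
  then have "a \<oplus> b \<in> carrier R" using fractions_carrier G H by blast
  then show "\<exists>K. K \<in> fractions \<and> (\<exists>s\<in>S. \<exists>a b. (s, a) \<in> G \<and> (s, b) \<in> H \<and> (s, a \<oplus> b) \<in> K)"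
    using s fraction_self[of s "a \<oplus> b"] by (intro exI[of _ "fraction s (a \<oplus> b)"]) auto
qed

lemma frac_mult_spec:
  assumes G: "G \<in> fractions" and H: "H \<in> fractions"
  shows "frac_mult G H \<in> fractions \<and>
    (\<exists>s\<in>S. \<exists>a b. (s, a) \<in> G \<and> (a, b) \<in> H \<and> (s, b) \<in> frac_mult G H)"
  unfolding frac_mult_def
proof (rule someI_ex)
  obtain s a b where s: "s \<in> S" "(s, a) \<in> G" "(a, b) \<in> H" using fractions_composable[OF G H] by blast
  then have "b \<in> carrier R" using fractions_carrier H by blast
  then show "\<exists>K. K \<in> fractions \<and> (\<exists>s\<in>S. \<exists>a b. (s, a) \<in> G \<and> (a, b) \<in> H \<and> (s, b) \<in> K)"
    using s fraction_self[of s b] by (intro exI[of _ "fraction s b"]) auto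
qed

lemmas frac_add_closed [simp] = frac_add_spec[THEN conjunct1]
lemmas frac_mult_closed [simp] = frac_mult_spec[THEN conjunct1]

text \<open>\<open>frac_add_spec\<close> provides a single point over \<open>S\<close>. The Ore
  relation \<open>c x = d s\<close> transports its value to \<open>c x\<close>, and unscaling brings
  it to \<open>x\<close>; \<open>frac_multI\<close> follows the same pattern.\<close>

lemma frac_addI:
  assumes G: "G \<in> fractions" and H: "H \<in> fractions" and xab: "(x, a) \<in> G" "(x, b) \<in> H"
  shows "(x, a \<oplus> b) \<in> frac_add G H"
proof -
  let ?K = "frac_add G H"
  obtain s a0 b0 where s: "s \<in> S" "(s, a0) \<in> G" "(s, b0) \<in> H" "(s, a0 \<oplus> b0) \<in> ?K"
    using frac_add_spec[OF G H] by blast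
  have carr: "x \<in> carrier R" "a \<in> carrier R" "b \<in> carrier R" "a0 \<in> carrier R" "b0 \<in> carrier R"
    using fractions_carrier G H xab s by blast+
  obtain c d where c: "c \<in> S" "d \<in> carrier R" "c \<otimes> x = d \<otimes> s" using left_Ore[OF s(1) carr(1)] by blast
  have "(c \<otimes> x, c \<otimes> a) \<in> G" "(c \<otimes> x, d \<otimes> a0) \<in> G"
    using fractions_scale[OF G xab(1), of c] fractions_scale[OF G s(2) c(2)] c by auto
  then have 1: "c \<otimes> a = d \<otimes> a0" using fractions_single_valued[OF G] by blast
  have "(c \<otimes> x, c \<otimes> b) \<in> H" "(c \<otimes> x, d \<otimes> b0) \<in> H"
    using fractions_scale[OF H xab(2), of c] fractions_scale[OF H s(3) c(2)] c by auto
  then have 2: "c \<otimes> b = d \<otimes> b0" using fractions_single_valued[OF H] by blast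
  have "c \<otimes> (a \<oplus> b) = d \<otimes> (a0 \<oplus> b0)" using 1 2 c(1,2) carr by (simp add: r_distr)
  then have "(c \<otimes> x, c \<otimes> (a \<oplus> b)) \<in> ?K"
    using fractions_scale[OF frac_add_closed[OF G H] s(4) c(2)] c(3) by simp
  then show ?thesis using fractions_unscale[OF frac_add_closed[OF G H] c(1)] carr by simp
qed

lemma frac_multI:
  assumes G: "G \<in> fractions" and H: "H \<in> fractions" and xab: "(x, a) \<in> G" "(a, b) \<in> H"
  shows "(x, b) \<in> frac_mult G H"
proof -
  let ?K = "frac_mult G H"
  obtain s a0 b0 where s: "s \<in> S" "(s, a0) \<in> G" "(a0, b0) \<in> H" "(s, b0) \<in> ?K"
    using frac_mult_spec[OF G H] by blast
  have carr: "x \<in> carrier R" "a \<in> carrier R" "b \<in> carrier R" "a0 \<in> carrier R" "b0 \<in> carrier R"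
    using fractions_carrier G H xab s by blast+
  obtain c d where c: "c \<in> S" "d \<in> carrier R" "c \<otimes> x = d \<otimes> s" using left_Ore[OF s(1) carr(1)] by blast
  have "(c \<otimes> x, c \<otimes> a) \<in> G" "(c \<otimes> x, d \<otimes> a0) \<in> G"
    using fractions_scale[OF G xab(1), of c] fractions_scale[OF G s(2) c(2)] c by auto
  then have "c \<otimes> a = d \<otimes> a0" using fractions_single_valued[OF G] by blast
  then have "(c \<otimes> a, c \<otimes> b) \<in> H" "(c \<otimes> a, d \<otimes> b0) \<in> H"
    using fractions_scale[OF H xab(2), of c] fractions_scale[OF H s(3) c(2)] c by auto
  then have "c \<otimes> b = d \<otimes> b0" using fractions_single_valued[OF H] by blast
  then have "(c \<otimes> x, c \<otimes> b) \<in> ?K"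
    using fractions_scale[OF frac_mult_closed[OF G H] s(4) c(2)] c(3) by simp
  then show ?thesis using fractions_unscale[OF frac_mult_closed[OF G H] c(1)] carr by simp
qed

lemma fraction_oneI:
  assumes "x \<in> carrier R" "r \<in> carrier R"
  shows "(x, x \<otimes> r) \<in> fraction \<one> r"
  using fractions_scale[OF fraction_in_fractions[OF one_S assms(2)] fraction_self[OF one_S assms(2)] assms(1)]
    assms by simp

lemma one_fractionI: "x \<in> carrier R \<Longrightarrow> (x, x) \<in> fraction \<one> \<one>"
  using fraction_oneI[of x \<one>] by simp

lemma zero_fractionI: "x \<in> carrier R \<Longrightarrow> (x, \<zero>) \<in> fraction \<one> \<zero>"
  using fraction_oneI[of x \<zero>] by simp

lemma frac_ring_simps [simp]:
  "carrier frac_ring = fractions" "monoid.mult frac_ring = frac_mult" "monoid.one frac_ring = fraction \<one> \<one>"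
  "ring.zero frac_ring = fraction \<one> \<zero>" "ring.add frac_ring = frac_add"
  by (simp_all add: frac_ring_def)

text \<open>Each axiom is an equality of fractions and is tested at one point over \<open>S\<close>
  where all maps involved are defined; such a point is found by enlarging the multiplier one map at
  a time.\<close>

lemma ring_frac_ring: "ring frac_ring"
proof (rule ringI)
  note [simp] = one_S
  note I = frac_addI frac_multI
  show "abelian_group frac_ring"
  proof (rule abelian_groupI, unfold frac_ring_simps)
    fix G H K assume G: "G \<in> fractions" and H: "H \<in> fractions" and K: "K \<in> fractions"
    obtain s a b where s: "s \<in> S" "(s, a) \<in> G" "(s, b) \<in> H" using fractions_common_domain[OF G H] by blast
    obtain c k where c: "c \<in> S" "(c \<otimes> s, k) \<in> K" using fractions_domain[OF K, of s] s by auto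
    have G': "(c \<otimes> s, c \<otimes> a) \<in> G" and H': "(c \<otimes> s, c \<otimes> b) \<in> H"
      using fractions_scale G H s c by auto
    have carr: "c \<otimes> a \<in> carrier R" "c \<otimes> b \<in> carrier R" "k \<in> carrier R"
      using fractions_carrier G H K G' H' c by blast+
    have "(c \<otimes> s, (c \<otimes> a \<oplus> c \<otimes> b) \<oplus> k) \<in> frac_add (frac_add G H) K"
      using G H K G' H' c(2) by (intro I) auto
    moreover have "(c \<otimes> s, c \<otimes> a \<oplus> (c \<otimes> b \<oplus> k)) \<in> frac_add G (frac_add H K)"
      using G H K G' H' c(2) by (intro I) auto
    ultimately show "frac_add (frac_add G H) K = frac_add G (frac_add H K)"
      using G H K mult_S[OF c(1) s(1)] carr by (intro fractions_eqI) (auto simp: a_assoc)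
  next
    fix G H assume G: "G \<in> fractions" and H: "H \<in> fractions"
    obtain s a b where s: "s \<in> S" "(s, a) \<in> G" "(s, b) \<in> H" using fractions_common_domain[OF G H] by blast
    then have "a \<in> carrier R" "b \<in> carrier R" using fractions_carrier G H by blast+
    then have "(s, a \<oplus> b) \<in> frac_add H G" using frac_addI[OF H G s(3,2)] by (simp add: a_comm)
    then show "frac_add G H = frac_add H G"
      using frac_addI[OF G H s(2,3)] G H s(1) by (intro fractions_eqI) auto
  next
    fix G assume G: "G \<in> fractions"
    obtain s a where s: "s \<in> S" "(s, a) \<in> G" using fractions_domain_S[OF G] by blast
    have a: "a \<in> carrier R" using fractions_carrier G s by blast
    have "(s, \<zero> \<oplus> a) \<in> frac_add (fraction \<one> \<zero>) G" using G s zero_fractionI by (intro I) auto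
    then show "frac_add (fraction \<one> \<zero>) G = G" using s a G by (intro fractions_eqI) auto
    have "(s, \<ominus> a \<oplus> a) \<in> frac_add (fraction s (\<ominus> a)) G" using G s a fraction_self by (intro I) auto
    then have "frac_add (fraction s (\<ominus> a)) G = fraction \<one> \<zero>"
      using s a G zero_fractionI by (intro fractions_eqI) (auto simp: l_neg)
    then show "\<exists>H\<in>fractions. frac_add H G = fraction \<one> \<zero>" using s a by (intro bexI[of _ "fraction s (\<ominus> a)"]) auto
  qed auto
  show "Group.monoid frac_ring"
  proof (rule monoidI, unfold frac_ring_simps)
    fix G H K assume G: "G \<in> fractions" and H: "H \<in> fractions" and K: "K \<in> fractions"
    obtain s a b where s: "s \<in> S" "(s, a) \<in> G" "(a, b) \<in> H" using fractions_composable[OF G H] by blast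
    obtain c k where c: "c \<in> S" "(c \<otimes> b, k) \<in> K"
      using fractions_domain[OF K, of b] fractions_carrier[OF H s(3)] by auto
    have G': "(c \<otimes> s, c \<otimes> a) \<in> G" and H': "(c \<otimes> a, c \<otimes> b) \<in> H"
      using fractions_scale G H s c by auto
    have "(c \<otimes> s, k) \<in> frac_mult (frac_mult G H) K" "(c \<otimes> s, k) \<in> frac_mult G (frac_mult H K)"
      using frac_multI G H K G' H' c(2) frac_mult_closed by meson+
    then show "frac_mult (frac_mult G H) K = frac_mult G (frac_mult H K)"
      using G H K mult_S[OF c(1) s(1)] by (intro fractions_eqI) auto
  next
    fix G assume G: "G \<in> fractions"
    obtain s a where s: "s \<in> S" "(s, a) \<in> G" using fractions_domain_S[OF G] by blast
    have a: "a \<in> carrier R" using fractions_carrier G s by blast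
    have *: "(s, a) \<in> frac_mult (fraction \<one> \<one>) G" "(s, a) \<in> frac_mult G (fraction \<one> \<one>)"
      using frac_multI[of "fraction \<one> \<one>" G s s a] frac_multI[of G "fraction \<one> \<one>" s a a] one_fractionI G s a by auto
    show "frac_mult (fraction \<one> \<one>) G = G" "frac_mult G (fraction \<one> \<one>) = G"
      using fractions_eqI[OF _ G s(1) *(1) s(2)] fractions_eqI[OF _ G s(1) *(2) s(2)] G by simp_all
  qed auto
  fix G H K assume "G \<in> carrier frac_ring" "H \<in> carrier frac_ring" "K \<in> carrier frac_ring"
  then have G: "G \<in> fractions" and H: "H \<in> fractions" and K: "K \<in> fractions" by auto
  obtain s a b where s: "s \<in> S" "(s, a) \<in> G" "(s, b) \<in> H" using fractions_common_domain[OF G H] by blast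
  have ab: "a \<in> carrier R" "b \<in> carrier R" using fractions_carrier G H s by blast+
  \<comment> \<open>The images of the point under both \<open>G\<close> and \<open>H\<close> must
    enter the domain of \<open>K\<close>: \<open>c\<close> achieves this for \<open>a\<close>, then
    \<open>d\<close> for \<open>c b\<close>, and scaling by \<open>d\<close> preserves the
    former.\<close>
  obtain c a' where c: "c \<in> S" "(c \<otimes> a, a') \<in> K" using fractions_domain[OF K ab(1)] by blast
  obtain d b' where d: "d \<in> S" "(d \<otimes> (c \<otimes> b), b') \<in> K" using fractions_domain[OF K, of "c \<otimes> b"] ab c by auto
  let ?x = "d \<otimes> (c \<otimes> s)"
  have x: "?x \<in> S" using mult_S c d s by simp
  have G': "(?x, d \<otimes> (c \<otimes> a)) \<in> G" and H': "(?x, d \<otimes> (c \<otimes> b)) \<in> H" and K': "(d \<otimes> (c \<otimes> a), d \<otimes> a') \<in> K"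
    using fractions_scale G H K s c d by auto
  have "(?x, d \<otimes> a' \<oplus> b') \<in> frac_mult (frac_add G H) K"
    using frac_multI[OF frac_add_closed[OF G H] K frac_addI[OF G H G' H'] fractions_sum[OF K K' d(2)]] .
  moreover have "(?x, d \<otimes> a' \<oplus> b') \<in> frac_add (frac_mult G K) (frac_mult H K)"
    using frac_addI[OF _ _ frac_multI[OF G K G' K'] frac_multI[OF H K H' d(2)]] G H K by simp
  ultimately show "(G \<oplus>\<^bsub>frac_ring\<^esub> H) \<otimes>\<^bsub>frac_ring\<^esub> K = G \<otimes>\<^bsub>frac_ring\<^esub> K \<oplus>\<^bsub>frac_ring\<^esub> H \<otimes>\<^bsub>frac_ring\<^esub> K"
    using fractions_eqI[OF _ _ x] G H K by simp
next
  fix G H K assume "G \<in> carrier frac_ring" "H \<in> carrier frac_ring" "K \<in> carrier frac_ring"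
  then have G: "G \<in> fractions" and H: "H \<in> fractions" and K: "K \<in> fractions" by auto
  obtain s y a where s: "s \<in> S" "(s, y) \<in> K" "(y, a) \<in> G" using fractions_composable[OF K G] by blast
  obtain c b where c: "c \<in> S" "(c \<otimes> y, b) \<in> H"
    using fractions_domain[OF H, of y] fractions_carrier[OF K s(2)] by auto
  have x: "c \<otimes> s \<in> S" using mult_S c s by simp
  have K': "(c \<otimes> s, c \<otimes> y) \<in> K" and G': "(c \<otimes> y, c \<otimes> a) \<in> G"
    using fractions_scale G K s c by auto
  have "(c \<otimes> s, c \<otimes> a \<oplus> b) \<in> frac_mult K (frac_add G H)"
    using frac_multI[OF K frac_add_closed[OF G H] K' frac_addI[OF G H G' c(2)]] .
  moreover have "(c \<otimes> s, c \<otimes> a \<oplus> b) \<in> frac_add (frac_mult K G) (frac_mult K H)"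
    using frac_addI[OF _ _ frac_multI[OF K G K' G'] frac_multI[OF K H K' c(2)]] G H K by simp
  ultimately show "K \<otimes>\<^bsub>frac_ring\<^esub> (G \<oplus>\<^bsub>frac_ring\<^esub> H) = K \<otimes>\<^bsub>frac_ring\<^esub> G \<oplus>\<^bsub>frac_ring\<^esub> K \<otimes>\<^bsub>frac_ring\<^esub> H"
    using fractions_eqI[OF _ _ x] G H K by simp
qed

end

text \<open>Covers both uses: \<open>S\<close> the set of regular elements with a given quotient
  ring, and \<open>S = \<C>'\<close> with the constructed ring of fractions.\<close>

locale left_localization = R: ring R + Q: ring Q
  for R :: "('a, 'm) ring_scheme" and Q :: "('b, 'n) ring_scheme" +
  fixes S :: "'a set" and f :: "'a \<Rightarrow> 'b"
  assumes S_carrier: "S \<subseteq> carrier R" and one_S: "\<one>\<^bsub>R\<^esub> \<in> S"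
    and mult_S: "s \<in> S \<Longrightarrow> t \<in> S \<Longrightarrow> s \<otimes>\<^bsub>R\<^esub> t \<in> S"
    and hom: "f \<in> ring_hom R Q" and inj: "inj_on f (carrier R)"
    and unit: "s \<in> S \<Longrightarrow> f s \<in> Units Q"
    and frac: "q \<in> carrier Q \<Longrightarrow> \<exists>s\<in>S. \<exists>r\<in>carrier R. q = inv\<^bsub>Q\<^esub> (f s) \<otimes>\<^bsub>Q\<^esub> f r"

context left_ore_set
begin

lemma left_localization_frac_ring: "left_localization R frac_ring S (fraction \<one>)"
proof -
  interpret Q: ring frac_ring by (rule ring_frac_ring)
  note [simp] = one_S
  \<comment> \<open>The points \<open>(\<one>, s)\<close> and \<open>(s, \<one>)\<close> compose in
    either order, so \<open>fraction s \<one>\<close> inverts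
    \<open>fraction \<one> s\<close>.\<close>
  have inv: "fraction \<one> s \<in> Units frac_ring \<and> inv\<^bsub>frac_ring\<^esub> (fraction \<one> s) = fraction s \<one>" if s: "s \<in> S" for s
  proof -
    have 1: "(\<one>, s) \<in> fraction \<one> s" "(s, \<one>) \<in> fraction s \<one>" using fraction_self s by auto
    have "frac_mult (fraction \<one> s) (fraction s \<one>) = fraction \<one> \<one>"
      using frac_multI[OF _ _ 1] one_fractionI[of \<one>] s by (intro fractions_eqI[OF _ _ one_S]) auto
    moreover have "frac_mult (fraction s \<one>) (fraction \<one> s) = fraction \<one> \<one>"
      using frac_multI[OF _ _ 1(2,1)] one_fractionI[of s] s by (intro fractions_eqI[OF _ _ s]) auto
    ultimately show ?thesis using s Q.inv_unique'[of "fraction \<one> s" "fraction s \<one>"]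
      by (auto simp: Units_def intro!: bexI[of _ "fraction s \<one>"])
  qed
  show ?thesis
  proof unfold_locales
    show "S \<subseteq> carrier R" by auto
    show "fraction \<one> \<in> ring_hom R frac_ring"
    proof (rule ring_hom_memI)
      fix x y assume xy: "x \<in> carrier R" "y \<in> carrier R"
      have "(\<one>, x \<oplus> y) \<in> frac_add (fraction \<one> x) (fraction \<one> y)"
        using xy fraction_self by (intro frac_addI) auto
      then show "fraction \<one> (x \<oplus> y) = fraction \<one> x \<oplus>\<^bsub>frac_ring\<^esub> fraction \<one> y"
        using xy fractions_eqI[OF _ _ one_S fraction_self[of \<one> "x \<oplus> y"]] by simp
      have "(\<one>, x \<otimes> y) \<in> frac_mult (fraction \<one> x) (fraction \<one> y)"
        using xy fraction_self[of \<one> x] fraction_oneI[OF xy] by (intro frac_multI) auto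
      then show "fraction \<one> (x \<otimes> y) = fraction \<one> x \<otimes>\<^bsub>frac_ring\<^esub> fraction \<one> y"
        using xy fractions_eqI[OF _ _ one_S fraction_self[of \<one> "x \<otimes> y"]] by simp
    qed auto
    show "inj_on (fraction \<one>) (carrier R)"
      using fraction_self[OF one_S] fractions_single_valued[OF fraction_in_fractions[OF one_S]]
      by (intro inj_onI) metis
    show "fraction \<one> s \<in> Units frac_ring" if "s \<in> S" for s using inv that by blast
    fix q assume "q \<in> carrier frac_ring"
    then obtain s r where q: "q = fraction s r" "s \<in> S" "r \<in> carrier R" by (auto simp: fractions_def)
    have "(s, r) \<in> frac_mult (fraction s \<one>) (fraction \<one> r)"
      using q fraction_self by (intro frac_multI) auto
    then have "q = frac_mult (fraction s \<one>) (fraction \<one> r)"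
      using q fraction_self by (intro fractions_eqI[OF _ _ q(2)]) auto
    then show "\<exists>s\<in>S. \<exists>r\<in>carrier R. q = inv\<^bsub>frac_ring\<^esub> (fraction \<one> s) \<otimes>\<^bsub>frac_ring\<^esub> fraction \<one> r"
      using q inv by auto
  qed (auto intro: mult_S)
qed

end

section \<open>Left ideals of a localization\<close>

context left_localization
begin

sublocale f: ring_hom_ring R Q f
  using ring_hom_ringI2[OF R.ring_axioms Q.ring_axioms hom] .

text \<open>This is the left ideal \<open>S\<^sup>-\<^sup>1I\<close> of \<open>Q\<close>, written
  without inverses.\<close>

definition ext :: "'a set \<Rightarrow> 'b set" where
  "ext I = {q \<in> carrier Q. \<exists>s\<in>S. \<exists>i\<in>I. f s \<otimes>\<^bsub>Q\<^esub> q = f i}"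

definition contr :: "'b set \<Rightarrow> 'a set" where
  "contr K = {r \<in> carrier R. f r \<in> K}"

lemma S_in_carrier: "s \<in> S \<Longrightarrow> s \<in> carrier R"
  using S_carrier by blast

lemma f_eqD: "f x = f y \<Longrightarrow> x \<in> carrier R \<Longrightarrow> y \<in> carrier R \<Longrightarrow> x = y"
  using inj by (rule inj_onD)

lemma unit_cancel:
  "s \<in> S \<Longrightarrow> p \<in> carrier Q \<Longrightarrow> q \<in> carrier Q \<Longrightarrow> f s \<otimes>\<^bsub>Q\<^esub> p = f s \<otimes>\<^bsub>Q\<^esub> q \<Longrightarrow> p = q"
  using unit by simp

lemma numerator:
  assumes q: "q \<in> carrier Q"
  shows "\<exists>s\<in>S. \<exists>r\<in>carrier R. f s \<otimes>\<^bsub>Q\<^esub> q = f r"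
proof -
  obtain s r where s: "s \<in> S" "r \<in> carrier R" "q = inv\<^bsub>Q\<^esub> (f s) \<otimes>\<^bsub>Q\<^esub> f r" using frac[OF q] by blast
  then have "f s \<otimes>\<^bsub>Q\<^esub> q = (f s \<otimes>\<^bsub>Q\<^esub> inv\<^bsub>Q\<^esub> (f s)) \<otimes>\<^bsub>Q\<^esub> f r"
    using unit[OF s(1)] by (simp add: Q.m_assoc S_in_carrier del: Q.Units_r_inv)
  also have "\<dots> = f r" using s(2) unit[OF s(1)] by simp
  finally show ?thesis using s by blast
qed

text \<open>Writing \<open>f r\<close> times the inverse of \<open>f s\<close> as a left fraction
  \<open>s'^-1 r'\<close> and clearing both denominators gives the relation, which injectivity pulls
  back to \<open>R\<close>.\<close>

lemma Ore:
  assumes s: "s \<in> S" and r: "r \<in> carrier R"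
  shows "\<exists>s'\<in>S. \<exists>r'\<in>carrier R. s' \<otimes>\<^bsub>R\<^esub> r = r' \<otimes>\<^bsub>R\<^esub> s"
proof -
  note u = unit[OF s] Q.Units_inv_closed[OF unit[OF s]]
  obtain s' r' where s': "s' \<in> S" "r' \<in> carrier R"
      and eq: "f s' \<otimes>\<^bsub>Q\<^esub> (f r \<otimes>\<^bsub>Q\<^esub> inv\<^bsub>Q\<^esub> (f s)) = f r'"
    using numerator[of "f r \<otimes>\<^bsub>Q\<^esub> inv\<^bsub>Q\<^esub> (f s)"] r u by auto
  have "f r' \<otimes>\<^bsub>Q\<^esub> f s = f s' \<otimes>\<^bsub>Q\<^esub> f r \<otimes>\<^bsub>Q\<^esub> (inv\<^bsub>Q\<^esub> (f s) \<otimes>\<^bsub>Q\<^esub> f s)"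
    unfolding eq[symmetric] using s s' r u by (simp add: Q.m_assoc S_in_carrier)
  also have "\<dots> = f s' \<otimes>\<^bsub>Q\<^esub> f r" using s' r u by (simp add: S_in_carrier)
  finally have "s' \<otimes>\<^bsub>R\<^esub> r = r' \<otimes>\<^bsub>R\<^esub> s" using s s' r by (intro f_eqD) (auto simp: S_in_carrier)
  then show ?thesis using s' by blast
qed

lemma left_ideal_contr: "left_ideal K Q \<Longrightarrow> left_ideal (contr K) R"
  unfolding contr_def using left_ideal_vimage[OF R.ring_axioms Q.ring_axioms hom] .

lemma left_ideal_unit_cancel:
  assumes K: "left_ideal K Q" and s: "s \<in> S" and q: "q \<in> carrier Q" "f s \<otimes>\<^bsub>Q\<^esub> q \<in> K"
  shows "q \<in> K"
proof -
  have "inv\<^bsub>Q\<^esub> (f s) \<otimes>\<^bsub>Q\<^esub> (f s \<otimes>\<^bsub>Q\<^esub> q) \<in> K" using Q.left_idealD(5)[OF K] q unit[OF s] by simp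
  moreover have "inv\<^bsub>Q\<^esub> (f s) \<otimes>\<^bsub>Q\<^esub> (f s \<otimes>\<^bsub>Q\<^esub> q) = q"
    using q unit[OF s] s by (simp add: Q.m_assoc[symmetric] S_in_carrier)
  ultimately show ?thesis by simp
qed

lemma closed_contr: "left_ideal K Q \<Longrightarrow> closed_under R S (contr K)"
  using left_ideal_unit_cancel by (auto simp: closed_under_def contr_def S_in_carrier)

text \<open>Every \<open>q\<close> in a left ideal of \<open>Q\<close> is a unit multiple of its
  numerator, which lies in the same left ideal; so the contraction determines the left
  ideal.\<close>

lemma contr_subset_iff:
  assumes K: "left_ideal K Q" and L: "left_ideal L Q"
  shows "contr K \<subseteq> contr L \<longleftrightarrow> K \<subseteq> L"
proof
  assume sub: "contr K \<subseteq> contr L"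
  show "K \<subseteq> L"
  proof
    fix q assume q: "q \<in> K"
    have qc: "q \<in> carrier Q" using Q.left_idealD(2)[OF K q] .
    obtain s r where s: "s \<in> S" "r \<in> carrier R" "f s \<otimes>\<^bsub>Q\<^esub> q = f r" using numerator[OF qc] by blast
    have "f s \<otimes>\<^bsub>Q\<^esub> q \<in> K" using Q.left_idealD(5)[OF K _ q] s(1) by (simp add: S_in_carrier)
    then have "r \<in> contr L" using sub s by (auto simp: contr_def)
    then show "q \<in> L" using left_ideal_unit_cancel[OF L s(1) qc] s(3) by (simp add: contr_def)
  qed
qed (auto simp: contr_def)

lemma contr_eq_iff: "left_ideal K Q \<Longrightarrow> left_ideal L Q \<Longrightarrow> contr K = contr L \<longleftrightarrow> K = L"
  using contr_subset_iff by (metis order_antisym order_refl)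

text \<open>The Ore condition supplies a common denominator \<open>c t = r s\<close> for sums, and
  moves the numerator \<open>r\<close> of the multiplier past the denominator \<open>s\<close> for
  multiples.\<close>

lemma left_ideal_ext:
  assumes I: "left_ideal I R"
  shows "left_ideal (ext I) Q"
proof (rule Q.left_idealI)
  note [simp] = R.left_idealD(2)[OF I] S_in_carrier
  show "ext I \<subseteq> carrier Q" by (auto simp: ext_def)
  show "\<zero>\<^bsub>Q\<^esub> \<in> ext I" using one_S R.left_idealD(3)[OF I] by (force simp: ext_def)
  fix p q assume "p \<in> ext I" "q \<in> ext I"
  then obtain s i t j where p: "p \<in> carrier Q" "s \<in> S" "i \<in> I" "f s \<otimes>\<^bsub>Q\<^esub> p = f i"
    and q: "q \<in> carrier Q" "t \<in> S" "j \<in> I" "f t \<otimes>\<^bsub>Q\<^esub> q = f j" by (auto simp: ext_def)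
  obtain c r where c: "c \<in> S" "r \<in> carrier R" "c \<otimes>\<^bsub>R\<^esub> t = r \<otimes>\<^bsub>R\<^esub> s"
    using Ore[OF p(2), of t] q by auto
  have "f (c \<otimes>\<^bsub>R\<^esub> t) \<otimes>\<^bsub>Q\<^esub> p = f r \<otimes>\<^bsub>Q\<^esub> (f s \<otimes>\<^bsub>Q\<^esub> p)"
    unfolding c(3) using c(1,2) p(1,2) by (simp add: Q.m_assoc)
  also have "\<dots> = f (r \<otimes>\<^bsub>R\<^esub> i)" using p c(2) by simp
  finally have 1: "f (c \<otimes>\<^bsub>R\<^esub> t) \<otimes>\<^bsub>Q\<^esub> p = f (r \<otimes>\<^bsub>R\<^esub> i)" .
  have "f (c \<otimes>\<^bsub>R\<^esub> t) \<otimes>\<^bsub>Q\<^esub> q = f c \<otimes>\<^bsub>Q\<^esub> (f t \<otimes>\<^bsub>Q\<^esub> q)"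
    using c(1) q(1,2) by (simp add: Q.m_assoc)
  also have "\<dots> = f (c \<otimes>\<^bsub>R\<^esub> j)" using q c(1) by simp
  finally have "f (c \<otimes>\<^bsub>R\<^esub> t) \<otimes>\<^bsub>Q\<^esub> (p \<oplus>\<^bsub>Q\<^esub> q) = f (r \<otimes>\<^bsub>R\<^esub> i \<oplus>\<^bsub>R\<^esub> c \<otimes>\<^bsub>R\<^esub> j)"
    using 1 p q c by (simp add: Q.r_distr)
  moreover have "r \<otimes>\<^bsub>R\<^esub> i \<oplus>\<^bsub>R\<^esub> c \<otimes>\<^bsub>R\<^esub> j \<in> I" using R.left_idealD(4,5)[OF I] c p q by simp
  ultimately show "p \<oplus>\<^bsub>Q\<^esub> q \<in> ext I" using mult_S[OF c(1) q(2)] p q unfolding ext_def by blast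
next
  note [simp] = R.left_idealD(2)[OF I] S_in_carrier
  fix p q assume p: "p \<in> carrier Q" and "q \<in> ext I"
  then obtain s i where q: "q \<in> carrier Q" "s \<in> S" "i \<in> I" "f s \<otimes>\<^bsub>Q\<^esub> q = f i" by (auto simp: ext_def)
  obtain t r where t: "t \<in> S" "r \<in> carrier R" "f t \<otimes>\<^bsub>Q\<^esub> p = f r" using numerator[OF p] by blast
  obtain c r' where c: "c \<in> S" "r' \<in> carrier R" "c \<otimes>\<^bsub>R\<^esub> r = r' \<otimes>\<^bsub>R\<^esub> s" using Ore[OF q(2) t(2)] by blast
  have "f (c \<otimes>\<^bsub>R\<^esub> t) \<otimes>\<^bsub>Q\<^esub> (p \<otimes>\<^bsub>Q\<^esub> q) = f c \<otimes>\<^bsub>Q\<^esub> (f t \<otimes>\<^bsub>Q\<^esub> p) \<otimes>\<^bsub>Q\<^esub> q"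
    using p q(1) c(1) t(1) by (simp add: Q.m_assoc)
  also have "\<dots> = f (c \<otimes>\<^bsub>R\<^esub> r) \<otimes>\<^bsub>Q\<^esub> q" using t c(1) by simp
  also have "\<dots> = f r' \<otimes>\<^bsub>Q\<^esub> (f s \<otimes>\<^bsub>Q\<^esub> q)" unfolding c(3) using c(2) q(1,2) by (simp add: Q.m_assoc)
  also have "\<dots> = f (r' \<otimes>\<^bsub>R\<^esub> i)" using q c(2) by simp
  finally show "p \<otimes>\<^bsub>Q\<^esub> q \<in> ext I"
    using mult_S[OF c(1) t(1)] R.left_idealD(5)[OF I c(2) q(3)] p q(1) unfolding ext_def by blast
qed

lemma ext_mem: "I \<subseteq> carrier R \<Longrightarrow> i \<in> I \<Longrightarrow> f i \<in> ext I"
  using one_S by (force simp: ext_def)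

lemma contr_ext:
  assumes I: "left_ideal I R" and cl: "closed_under R S I"
  shows "contr (ext I) = I"
proof
  show "contr (ext I) \<subseteq> I"
  proof
    fix r assume "r \<in> contr (ext I)"
    then obtain s i where s: "r \<in> carrier R" "s \<in> S" "i \<in> I" "f s \<otimes>\<^bsub>Q\<^esub> f r = f i"
      by (auto simp: contr_def ext_def)
    then have "f (s \<otimes>\<^bsub>R\<^esub> r) = f i" by (simp add: S_in_carrier)
    then have "s \<otimes>\<^bsub>R\<^esub> r = i"
      by (rule f_eqD) (use s R.left_idealD(2)[OF I] in \<open>auto simp: S_in_carrier\<close>)
    then show "r \<in> I" using cl s unfolding closed_under_def by blast
  qed
  show "I \<subseteq> contr (ext I)" using ext_mem R.left_idealD(1)[OF I] by (auto simp: contr_def)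
qed

text \<open>\<open>ext\<close> and \<open>contr\<close> are monotone and mutually inverse between
  the \<open>S\<close>-closed left ideals of \<open>R\<close> and the left ideals of
  \<open>Q\<close>.\<close>

lemma acc_on_left_ideals_iff:
  "acc_on {K. left_ideal K Q} \<longleftrightarrow> acc_on {I. left_ideal I R \<and> closed_under R S I}"
proof
  assume acc: "acc_on {K. left_ideal K Q}"
  show "acc_on {I. left_ideal I R \<and> closed_under R S I}"
    unfolding acc_on_def
  proof (intro allI impI)
    fix I :: "nat \<Rightarrow> _"
    assume "\<forall>n. I n \<in> {I. left_ideal I R \<and> closed_under R S I} \<and> I n \<subseteq> I (Suc n)"
    then have I: "\<And>n. left_ideal (I n) R" "\<And>n. closed_under R S (I n)" and "\<And>n. I n \<subseteq> I (Suc n)" by auto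
    then have "\<exists>N. \<forall>n\<ge>N. ext (I n) = ext (I N)"
      using left_ideal_ext[OF I(1)] unfolding ext_def by (intro acc_onD[OF acc]) blast+
    then show "\<exists>N. \<forall>n\<ge>N. I n = I N" using contr_ext[OF I] by metis
  qed
next
  assume acc: "acc_on {I. left_ideal I R \<and> closed_under R S I}"
  show "acc_on {K. left_ideal K Q}"
    unfolding acc_on_def
  proof (intro allI impI)
    fix K :: "nat \<Rightarrow> _"
    assume "\<forall>n. K n \<in> {K. left_ideal K Q} \<and> K n \<subseteq> K (Suc n)"
    then have K: "\<And>n. left_ideal (K n) Q" and "\<And>n. K n \<subseteq> K (Suc n)" by auto
    then have "\<exists>N. \<forall>n\<ge>N. contr (K n) = contr (K N)"
      using left_ideal_contr[OF K] closed_contr[OF K] unfolding contr_def by (intro acc_onD[OF acc]) blast+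
    then show "\<exists>N. \<forall>n\<ge>N. K n = K N" using contr_eq_iff[OF K K] by simp
  qed
qed

lemma dcc_on_left_ideals_above:
  assumes dcc: "dcc_on {I. left_ideal I R \<and> closed_under R S I \<and> N \<subseteq> I}" and N: "N \<subseteq> carrier R"
  shows "dcc_on {K. left_ideal K Q \<and> ext N \<subseteq> K}"
  unfolding dcc_on_def
proof (intro allI impI)
  fix K :: "nat \<Rightarrow> _"
  assume "\<forall>n. K n \<in> {K. left_ideal K Q \<and> ext N \<subseteq> K} \<and> K (Suc n) \<subseteq> K n"
  then have K: "\<And>n. left_ideal (K n) Q" "\<And>n. ext N \<subseteq> K n" and mono: "\<And>n. K (Suc n) \<subseteq> K n" by auto
  have "N \<subseteq> contr (K n)" for n using ext_mem[OF N] N K(2) unfolding contr_def by blast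
  then have "\<exists>M. \<forall>n\<ge>M. contr (K n) = contr (K M)"
    using left_ideal_contr[OF K(1)] closed_contr[OF K(1)] mono
    unfolding contr_def by (intro dcc_onD[OF dcc]) blast+
  then show "\<exists>M. \<forall>n\<ge>M. K n = K M" using contr_eq_iff[OF K(1) K(1)] by simp
qed

text \<open>For right multiplication by \<open>(f s)\<^sup>-\<^sup>1\<close>, consider the chain of the \<open>(ext A)(f s)\<^sup>-\<^sup>n\<close>.\<close>

lemma ideal_ext:
  assumes acc: "acc_on {K. left_ideal K Q}" and A: "ideal A R"
  shows "ideal (ext A) Q"
proof -
  interpret A: ideal A R by fact
  have LA: "left_ideal A R" using R.left_ideal_of_ideal[OF A] .
  have L: "left_ideal (ext A) Q" using left_ideal_ext[OF LA] .
  have right: "q \<otimes>\<^bsub>Q\<^esub> f r \<in> ext A" if q: "q \<in> ext A" and r: "r \<in> carrier R" for q r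
  proof -
    obtain s i where s: "q \<in> carrier Q" "s \<in> S" "i \<in> A" "f s \<otimes>\<^bsub>Q\<^esub> q = f i" using q by (auto simp: ext_def)
    have "f s \<otimes>\<^bsub>Q\<^esub> (q \<otimes>\<^bsub>Q\<^esub> f r) = (f s \<otimes>\<^bsub>Q\<^esub> q) \<otimes>\<^bsub>Q\<^esub> f r"
      using s(1,2) r by (simp add: Q.m_assoc S_in_carrier)
    also have "\<dots> = f (i \<otimes>\<^bsub>R\<^esub> r)" using s r by simp
    finally have "f s \<otimes>\<^bsub>Q\<^esub> (q \<otimes>\<^bsub>Q\<^esub> f r) = f (i \<otimes>\<^bsub>R\<^esub> r)" .
    moreover have "q \<otimes>\<^bsub>Q\<^esub> f r \<in> carrier Q" using s(1) r by simp
    ultimately show ?thesis using A.I_r_closed[OF s(3) r] s(2) unfolding ext_def by blast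
  qed
  have right_inv: "q \<otimes>\<^bsub>Q\<^esub> inv\<^bsub>Q\<^esub> (f s) \<in> ext A" if q: "q \<in> ext A" and s: "s \<in> S" for q s
  proof -
    let ?u = "f s" let ?v = "inv\<^bsub>Q\<^esub> (f s)"
    have u: "?u \<in> carrier Q" "?v \<in> carrier Q" "?u \<in> Units Q" using unit[OF s] s by (auto simp: S_in_carrier)
    have qc: "q \<in> carrier Q" using q by (simp add: ext_def)
    let ?K = "\<lambda>n::nat. {p \<in> carrier Q. p \<otimes>\<^bsub>Q\<^esub> ?u [^]\<^bsub>Q\<^esub> n \<in> ext A}"
    have "\<exists>N. \<forall>n\<ge>N. ?K n = ?K N"
    proof (rule acc_onD[OF acc])
      show "?K n \<in> {K. left_ideal K Q}" for n
        using Q.left_ideal_colon[OF L, of "?u [^]\<^bsub>Q\<^esub> n"] u by simp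
      show "?K n \<subseteq> ?K (Suc n)" for n
        using right[of _ s] s u(1) by (auto simp: Q.m_assoc[symmetric] S_in_carrier)
    qed
    then obtain n where n: "?K (Suc n) = ?K n" by (meson le_SucI order_refl)
    \<comment> \<open>\<open>p\<close> is \<open>q ?u^-(n+1)\<close>. It lies in
      \<open>?K (Suc n)\<close>, which equals \<open>?K n\<close>, so
      \<open>p ?u^n = q ?u^-1\<close> is in \<open>ext A\<close>.\<close>
    define p where "p = q \<otimes>\<^bsub>Q\<^esub> ?v [^]\<^bsub>Q\<^esub> Suc n"
    have pc: "p \<in> carrier Q" using qc u unfolding p_def by simp
    have vu: "?v [^]\<^bsub>Q\<^esub> k \<otimes>\<^bsub>Q\<^esub> ?u [^]\<^bsub>Q\<^esub> k = \<one>\<^bsub>Q\<^esub>" for k :: nat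
    proof (induct k)
      case (Suc k)
      have "?v [^]\<^bsub>Q\<^esub> Suc k \<otimes>\<^bsub>Q\<^esub> ?u [^]\<^bsub>Q\<^esub> Suc k = ?v [^]\<^bsub>Q\<^esub> k \<otimes>\<^bsub>Q\<^esub> (?v \<otimes>\<^bsub>Q\<^esub> ?u) \<otimes>\<^bsub>Q\<^esub> ?u [^]\<^bsub>Q\<^esub> k"
        using u(1,2) Q.nat_pow_Suc2[OF u(1), of k] by (simp add: Q.m_assoc)
      then show ?case using u Suc by simp
    qed simp
    have "p \<otimes>\<^bsub>Q\<^esub> ?u [^]\<^bsub>Q\<^esub> Suc n = q"
      unfolding p_def using vu[of "Suc n"] qc u by (simp add: Q.m_assoc del: Q.nat_pow_Suc)
    then have "p \<in> ?K (Suc n)" using pc q by simp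
    then have "p \<otimes>\<^bsub>Q\<^esub> ?u [^]\<^bsub>Q\<^esub> n \<in> ext A" unfolding n by simp
    moreover have "p \<otimes>\<^bsub>Q\<^esub> ?u [^]\<^bsub>Q\<^esub> n = q \<otimes>\<^bsub>Q\<^esub> ?v \<otimes>\<^bsub>Q\<^esub> (?v [^]\<^bsub>Q\<^esub> n \<otimes>\<^bsub>Q\<^esub> ?u [^]\<^bsub>Q\<^esub> n)"
      unfolding p_def using qc u Q.nat_pow_Suc2[OF u(2), of n] by (simp add: Q.m_assoc del: Q.nat_pow_Suc)
    ultimately show ?thesis using vu[of n] qc u by simp
  qed
  show ?thesis
  proof (rule idealI[OF Q.ring_axioms])
    show "subgroup (ext A) (add_monoid Q)" using L by (simp add: left_ideal_def additive_subgroup_def)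
    show "x \<otimes>\<^bsub>Q\<^esub> a \<in> ext A" if "a \<in> ext A" "x \<in> carrier Q" for a x using Q.left_idealD(5)[OF L] that by blast
    show "a \<otimes>\<^bsub>Q\<^esub> x \<in> ext A" if ax: "a \<in> ext A" "x \<in> carrier Q" for a x
    proof -
      obtain s r where s: "s \<in> S" "r \<in> carrier R" "x = inv\<^bsub>Q\<^esub> (f s) \<otimes>\<^bsub>Q\<^esub> f r" using frac[OF ax(2)] by blast
      then have "a \<otimes>\<^bsub>Q\<^esub> x = (a \<otimes>\<^bsub>Q\<^esub> inv\<^bsub>Q\<^esub> (f s)) \<otimes>\<^bsub>Q\<^esub> f r"
        using Q.left_idealD(2)[OF L ax(1)] unit[OF s(1)] by (simp add: Q.m_assoc)
      then show ?thesis using right[OF right_inv[OF ax(1) s(1)] s(2)] by simp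
    qed
  qed
qed

end

section \<open>Left Artinian rings\<close>

context ring
begin

text \<open>As \<open>J x\<close> lies in \<open>A\<close>, the module \<open>(A + R x)/A\<close> is
  a quotient of \<open>R/J\<close>. The colon left ideals \<open>?C n\<close> contain
  \<open>J\<close> and record the image of \<open>I n\<close> there; together with the traces on
  \<open>A\<close> they determine the chain.\<close>

lemma dcc_on_set_add_multiples:
  assumes dccA: "dcc_on {I. left_ideal I R \<and> I \<subseteq> A}" and A: "left_ideal A R"
    and dccJ: "dcc_on {I. left_ideal I R \<and> J \<subseteq> I}"
    and x: "x \<in> carrier R" and Jx: "\<And>j. j \<in> J \<Longrightarrow> j \<otimes> x \<in> A" and J: "J \<subseteq> carrier R"
  shows "dcc_on {I. left_ideal I R \<and> I \<subseteq> A <+>\<^bsub>R\<^esub> left_multiples R (carrier R) x}"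
  unfolding dcc_on_def
proof (intro allI impI)
  let ?p = "left_multiples R (carrier R) x"
  fix I :: "nat \<Rightarrow> _"
  assume "\<forall>n. I n \<in> {I. left_ideal I R \<and> I \<subseteq> A <+>\<^bsub>R\<^esub> ?p} \<and> I (Suc n) \<subseteq> I n"
  then have I: "\<And>n. left_ideal (I n) R" "\<And>n. I n \<subseteq> A <+>\<^bsub>R\<^esub> ?p" and mono: "\<And>n. I (Suc n) \<subseteq> I n"
    by auto
  have le: "I n \<subseteq> I m" if "m \<le> n" for m n using mono that by (rule lift_Suc_antimono_le)
  note IA = left_ideal_set_add[OF I(1) A] set_add_upper[OF I(1) A]
  obtain N1 where N1: "\<forall>n\<ge>N1. I n \<inter> A = I N1 \<inter> A"
    using dcc_onD[OF dccA, of "\<lambda>n. I n \<inter> A"] left_ideal_Int[OF I(1) A] mono by fastforce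
  let ?C = "\<lambda>n. {q \<in> carrier R. q \<otimes> x \<in> I n <+>\<^bsub>R\<^esub> A}"
  have "\<exists>N2. \<forall>n\<ge>N2. ?C n = ?C N2"
  proof (rule dcc_onD[OF dccJ])
    fix n
    have "J \<subseteq> ?C n" using Jx J IA(3) by blast
    then show "?C n \<in> {I. left_ideal I R \<and> J \<subseteq> I}" using left_ideal_colon[OF IA(1) x] by blast
    show "?C (Suc n) \<subseteq> ?C n" using set_add_mono_left[OF mono] by blast
  qed
  then obtain N2 where N2: "\<forall>n\<ge>N2. ?C n = ?C N2" by blast
  define N where "N = max N1 N2"
  have "I n = I N" if n: "n \<ge> N" for n
  proof (rule left_ideal_modular_eq[OF I(1) I(1) A le[OF n], symmetric])
    show "I N \<inter> A \<subseteq> I n" using N1 n unfolding N_def by (metis inf.cobounded1 max.bounded_iff order_refl)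
    show "I N \<subseteq> I n <+>\<^bsub>R\<^esub> A"
    proof
      fix y assume y: "y \<in> I N"
      then obtain a q where aq: "a \<in> A" "q \<in> carrier R" "y = a \<oplus> q \<otimes> x"
        using I(2) unfolding subset_iff mem_set_add left_multiples_def by blast
      have ac: "a \<in> carrier R" using left_idealD(2)[OF A aq(1)] .
      have "y \<in> I N <+>\<^bsub>R\<^esub> A" "a \<in> I N <+>\<^bsub>R\<^esub> A" using y aq(1) IA(2,3) by blast+
      then have "q \<otimes> x \<in> I N <+>\<^bsub>R\<^esub> A" using left_ideal_cancel[OF IA(1)] aq ac x by simp
      then have "q \<in> ?C N" using aq(2) by simp
      also have "?C N = ?C n" using N2[rule_format, of n] N2[rule_format, of N] n unfolding N_def by simp
      finally have "q \<otimes> x \<in> I n <+>\<^bsub>R\<^esub> A" by simp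
      moreover have "a \<in> I n <+>\<^bsub>R\<^esub> A" using aq(1) IA(3) by blast
      ultimately show "y \<in> I n <+>\<^bsub>R\<^esub> A" using left_idealD(4)[OF IA(1)] aq(3) by blast
    qed
  qed
  then show "\<exists>N. \<forall>n\<ge>N. I n = I N" by blast
qed

text \<open>Among the left ideals whose subideals satisfy the descending chain condition, take a
  maximal \<open>A\<close>. If it were proper, \<open>socle\<close> would give \<open>x\<close>
  outside \<open>A\<close> with \<open>J x\<close> in \<open>A\<close>, and \<open>A + R x\<close>
  would be larger of the same kind. For nilpotent radicals, \<open>socle\<close> comes from the last
  power not contained in \<open>I\<close>.\<close>

theorem left_noetherian_imp_artinian:
  assumes acc: "acc_on {I. left_ideal I R}"
    and J: "J \<subseteq> carrier R" and dccJ: "dcc_on {I. left_ideal I R \<and> J \<subseteq> I}"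
    and socle: "\<And>I. left_ideal I R \<Longrightarrow> I \<noteq> carrier R \<Longrightarrow> \<exists>x\<in>carrier R - I. \<forall>j\<in>J. j \<otimes> x \<in> I"
  shows "dcc_on {I. left_ideal I R}"
proof -
  let ?F = "{A. left_ideal A R \<and> dcc_on {I. left_ideal I R \<and> I \<subseteq> A}}"
  have "dcc_on {I. left_ideal I R \<and> I \<subseteq> {\<zero>}}"
  proof -
    have "I = {\<zero>}" if "left_ideal I R" "I \<subseteq> {\<zero>}" for I using that left_idealD(3) by blast
    then show ?thesis unfolding dcc_on_def mem_Collect_eq by metis
  qed
  then have "?F \<noteq> {}" using left_ideal_zero by blast
  then have "\<exists>A\<in>?F. \<forall>B\<in>?F. A \<subseteq> B \<longrightarrow> B = A" by (intro acc_on_maximal[OF acc]) auto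
  then obtain A where AF: "A \<in> ?F" and max: "\<And>B. B \<in> ?F \<Longrightarrow> A \<subseteq> B \<Longrightarrow> B = A" by (elim bexE) simp
  then have A: "left_ideal A R" "dcc_on {I. left_ideal I R \<and> I \<subseteq> A}" by simp_all
  have "A = carrier R"
  proof (rule ccontr)
    assume "A \<noteq> carrier R"
    then obtain x where x: "x \<in> carrier R" "x \<notin> A" "\<And>j. j \<in> J \<Longrightarrow> j \<otimes> x \<in> A"
      using socle[OF A(1)] by blast
    let ?p = "left_multiples R (carrier R) x"
    have p: "left_ideal ?p R" using left_ideal_left_multiples[OF left_ideal_carrier x(1)] .
    have "A <+>\<^bsub>R\<^esub> ?p \<in> ?F"
      using dcc_on_set_add_multiples[OF A(2,1) dccJ x(1,3) J] left_ideal_set_add[OF A(1) p] by simp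
    then have "A <+>\<^bsub>R\<^esub> ?p = A" using max set_add_upper(1)[OF A(1) p] by blast
    then show False using set_add_upper(2)[OF A(1) p] self_in_left_multiples[OF x(1)] x(2) by blast
  qed
  moreover have "{I. left_ideal I R} = {I. left_ideal I R \<and> I \<subseteq> carrier R}"
    using left_idealD(1) by blast
  ultimately show ?thesis using A(2) by simp
qed

text \<open>Stability of the chain \<open>R c^n + J\<close> yields
  \<open>c^n = x c^(n+1) + j\<close>, so \<open>(\<one> - x c) c^n\<close> lies in \<open>J\<close>;
  \<open>cancel\<close> is then applied \<open>n\<close> times.\<close>

lemma left_artinian_left_inverse_mod:
  assumes dcc: "dcc_on {I. left_ideal I R}" and J: "left_ideal J R"
    and c: "c \<in> carrier R" and cancel: "\<And>y. y \<in> carrier R \<Longrightarrow> y \<otimes> c \<in> J \<Longrightarrow> y \<in> J"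
    and Jc: "\<And>j. j \<in> J \<Longrightarrow> j \<otimes> c \<in> J"
  shows "\<exists>x\<in>carrier R. \<one> \<ominus> x \<otimes> c \<in> J"
proof -
  let ?T = "\<lambda>n::nat. left_multiples R (carrier R) (c [^] n)"
  have T: "left_ideal (?T n) R" for n using left_ideal_left_multiples[OF left_ideal_carrier] c by simp
  have "c [^] Suc n \<in> ?T n" for n
    using c nat_pow_Suc2[OF c, of n] unfolding left_multiples_def by (intro image_eqI[of _ _ c]) auto
  then have "?T (Suc n) \<subseteq> ?T n" for n by (intro left_multiples_subset[OF T]) auto
  then have "?T (Suc n) <+>\<^bsub>R\<^esub> J \<subseteq> ?T n <+>\<^bsub>R\<^esub> J" for n by (rule set_add_mono_left)
  then have "\<exists>N. \<forall>n\<ge>N. ?T n <+>\<^bsub>R\<^esub> J = ?T N <+>\<^bsub>R\<^esub> J"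
    using left_ideal_set_add[OF T J] by (intro dcc_onD[OF dcc]) auto
  then obtain n where n: "?T (Suc n) <+>\<^bsub>R\<^esub> J = ?T n <+>\<^bsub>R\<^esub> J" by (meson le_SucI order_refl)
  have "c [^] n \<in> ?T n" using c by (intro self_in_left_multiples) simp
  then have "c [^] n \<in> ?T (Suc n) <+>\<^bsub>R\<^esub> J" unfolding n using set_add_upper(1)[OF T J] by blast
  then obtain x j where x: "x \<in> carrier R" "j \<in> J" "c [^] n = x \<otimes> c [^] Suc n \<oplus> j"
    unfolding mem_set_add left_multiples_def by blast
  have jc: "j \<in> carrier R" using left_idealD(2)[OF J x(2)] .
  have c1: "c [^] n \<in> carrier R" "c [^] Suc n = c \<otimes> c [^] n" using c nat_pow_Suc2[OF c, of n] by auto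
  have "(\<one> \<ominus> x \<otimes> c) \<otimes> c [^] n = c [^] n \<ominus> x \<otimes> c [^] Suc n"
    unfolding c1(2) using c1(1) c x(1) by algebra
  also have "\<dots> = (x \<otimes> c [^] Suc n \<oplus> j) \<ominus> x \<otimes> c [^] Suc n" by (simp only: x(3)[symmetric])
  also have "\<dots> = j" unfolding c1(2) using c1(1) c x(1) jc by algebra
  finally have *: "(\<one> \<ominus> x \<otimes> c) \<otimes> c [^] n \<in> J" using x(2) by simp
  have "y \<in> J" if "y \<otimes> c [^] k \<in> J" "y \<in> carrier R" for y and k :: nat
    using that
  proof (induct k arbitrary: y)
    case (Suc k)
    have "(y \<otimes> c [^] k) \<otimes> c \<in> J" using Suc(2,3) c by (simp add: m_assoc)
    then have "y \<otimes> c [^] k \<in> J" using cancel Suc(3) c by simp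
    then show ?case using Suc by blast
  qed simp
  from this[OF *] have "\<one> \<ominus> x \<otimes> c \<in> J" using x(1) c by simp
  then show ?thesis using x(1) by blast
qed

text \<open>Taking \<open>J\<close> zero gives \<open>x c = \<one>\<close>; then
  \<open>(c x - \<one>) c = 0\<close>, and cancellation makes the inverse two-sided.\<close>

lemma left_artinian_unit:
  assumes dcc: "dcc_on {I. left_ideal I R}" and c: "c \<in> carrier R"
    and cancel: "\<And>y. y \<in> carrier R \<Longrightarrow> y \<otimes> c = \<zero> \<Longrightarrow> y = \<zero>"
  shows "c \<in> Units R"
proof -
  have "\<exists>x\<in>carrier R. \<one> \<ominus> x \<otimes> c \<in> {\<zero>}"
    by (rule left_artinian_left_inverse_mod[OF dcc left_ideal_zero c]) (use cancel c in auto)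
  then obtain x where x: "x \<in> carrier R" "\<one> \<ominus> x \<otimes> c = \<zero>" by auto
  then have xc: "x \<otimes> c = \<one>" using c by (metis m_closed one_closed r_right_minus_eq)
  have "(c \<otimes> x \<ominus> \<one>) \<otimes> c = c \<otimes> (x \<otimes> c) \<ominus> c" using x c by algebra
  also have "\<dots> = \<zero>" unfolding xc using c by (simp add: a_minus_def r_neg)
  finally have "c \<otimes> x \<ominus> \<one> = \<zero>" using cancel x c by simp
  then have "c \<otimes> x = \<one>" using x c by simp
  then show ?thesis using xc x c unfolding Units_def by blast
qed

text \<open>\<open>y = y x c\<close> makes \<open>x\<close> right-cancellable, hence a unit, and
  \<open>c\<close> is its inverse.\<close>

lemma left_artinian_left_inverse_unit:
  assumes dcc: "dcc_on {I. left_ideal I R}" and "c \<in> carrier R" "x \<in> carrier R" "x \<otimes> c = \<one>"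
  shows "c \<in> Units R"
proof -
  have "y = \<zero>" if "y \<in> carrier R" "y \<otimes> x = \<zero>" for y
  proof -
    have "y = y \<otimes> x \<otimes> c" using that(1) assms by (simp add: m_assoc)
    then show ?thesis using that(2) assms by simp
  qed
  then have x: "x \<in> Units R" using left_artinian_unit[OF dcc] assms by blast
  then have "c = inv x" using assms by (metis Units_inv_closed Units_l_inv l_one m_assoc r_one Units_r_inv)
  then show ?thesis using x by simp
qed

end

section \<open>The prime radical\<close>

context ring
begin

lemma idealI_left:
  assumes "left_ideal I R" "\<And>x r. x \<in> I \<Longrightarrow> r \<in> carrier R \<Longrightarrow> x \<otimes> r \<in> I"
  shows "ideal I R"
  using assms left_idealD(5)[OF assms(1)]
  by (intro idealI[OF ring_axioms]) (auto simp: left_ideal_def additive_subgroup_def)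

lemma prime_idealD:
  assumes "prime_ideal P R"
  shows "ideal P R" "P \<noteq> carrier R"
    "\<And>A B. ideal A R \<Longrightarrow> ideal B R \<Longrightarrow> A \<cdot> B \<subseteq> P \<Longrightarrow> A \<subseteq> P \<or> B \<subseteq> P"
  using assms unfolding prime_ideal_def by blast+

lemma ideal_prime_radical: "ideal (prime_radical R) R"
proof (rule idealI_left)
  have P: "left_ideal P R" if "prime_ideal P R" for P
    using left_ideal_of_ideal[OF prime_idealD(1)[OF that]] .
  show "left_ideal (prime_radical R) R"
    using left_idealD(3-5)[OF P] unfolding prime_radical_def by (intro left_idealI) auto
  show "x \<otimes> r \<in> prime_radical R" if "x \<in> prime_radical R" "r \<in> carrier R" for x r
    using that ideal.I_r_closed[OF prime_idealD(1)] unfolding prime_radical_def by auto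
qed

lemma prime_radical_least: "prime_ideal P R \<Longrightarrow> prime_radical R \<subseteq> P"
  unfolding prime_radical_def by blast

lemma ideal_ideal_power: "ideal I R \<Longrightarrow> ideal (ideal_power R I k) R"
  by (induct k) (auto intro: ideal_prod_is_ideal oneideal)

lemma ideal_power_subset_prime:
  assumes I: "ideal I R" and P: "prime_ideal P R" and "ideal_power R I k \<subseteq> P"
  shows "I \<subseteq> P"
  using assms(3)
proof (induct k)
  case 0
  have "P \<subseteq> carrier R" using left_idealD(1)[OF left_ideal_of_ideal[OF prime_idealD(1)[OF P]]] .
  then show ?case using 0 prime_idealD(2)[OF P] by auto
next
  case (Suc k)
  then show ?case using prime_idealD(3)[OF P I ideal_ideal_power[OF I]] by auto
qed

lemma nilpotent_subset_prime_radical: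
  assumes "nilpotent_ideal I R"
  shows "I \<subseteq> prime_radical R"
proof -
  obtain k where I: "ideal I R" "ideal_power R I k = {\<zero>}"
    using assms by (auto simp: nilpotent_ideal_def)
  have "I \<subseteq> P" if P: "prime_ideal P R" for P
    using ideal_power_subset_prime[OF I(1) P, of k] I(2)
      left_idealD(3)[OF left_ideal_of_ideal[OF prime_idealD(1)[OF P]]] by simp
  then show ?thesis
    using left_idealD(1)[OF left_ideal_of_ideal[OF I(1)]] unfolding prime_radical_def by blast
qed

lemma foldr_mult_closed: "set xs \<subseteq> carrier R \<Longrightarrow> foldr (\<otimes>) xs \<one> \<in> carrier R"
  by (induct xs) auto

lemma foldr_mult_append:
  "set xs \<subseteq> carrier R \<Longrightarrow> set ys \<subseteq> carrier R \<Longrightarrow>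
     foldr (\<otimes>) (xs @ ys) \<one> = foldr (\<otimes>) xs \<one> \<otimes> foldr (\<otimes>) ys \<one>"
  by (induct xs) (auto simp: m_assoc foldr_mult_closed simp del: foldr_append)

lemma nilpotent_idealI:
  assumes I: "ideal I R" and prod: "\<And>xs. set xs \<subseteq> I \<Longrightarrow> length xs = k \<Longrightarrow> foldr (\<otimes>) xs \<one> = \<zero>"
  shows "nilpotent_ideal I R"
proof -
  have Ic: "I \<subseteq> carrier R" using left_idealD(1)[OF left_ideal_of_ideal[OF I]] .
  have pc: "y \<in> carrier R" if "y \<in> ideal_power R I m" for y m
    using left_idealD(2)[OF left_ideal_of_ideal[OF ideal_ideal_power[OF I]] that] .
  \<comment> \<open>\<open>ideal_power\<close> is nested to the right. The induction moves its
    outermost factor to the end of \<open>xs\<close>, keeping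
    \<open>length xs + m = k\<close>.\<close>
  have "foldr (\<otimes>) xs \<one> \<otimes> y = \<zero>"
    if "y \<in> ideal_power R I m" "set xs \<subseteq> I" "length xs + m = k" for xs y m
    using that
  proof (induct m arbitrary: xs y)
    case 0
    then show ?case using prod[of xs] by simp
  next
    case (Suc m)
    have xs: "foldr (\<otimes>) xs \<one> \<in> carrier R" using foldr_mult_closed Suc(3) Ic by auto
    from Suc(2) have "y \<in> I \<cdot> ideal_power R I m" by simp
    then show ?case
    proof induct
      case (prod i j)
      then have c: "i \<in> carrier R" "j \<in> carrier R" using Ic pc by auto
      have "foldr (\<otimes>) xs \<one> \<otimes> (i \<otimes> j) = foldr (\<otimes>) (xs @ [i]) \<one> \<otimes> j"
        using foldr_mult_append[of xs "[i]"] Suc(3) Ic c xs by (auto simp: m_assoc)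
      also have "\<dots> = \<zero>" using Suc(1)[of j "xs @ [i]"] Suc(3,4) prod by simp
      finally show ?case .
    next
      case (sum y z)
      then have "y \<in> carrier R" "z \<in> carrier R" using pc[of _ "Suc m"] by auto
      then show ?case using sum xs by (simp add: r_distr)
    qed
  qed
  from this[of _ k "[]"] have "\<one> \<otimes> y = \<zero>" if "y \<in> ideal_power R I k" for y
    using that by simp
  then have "y = \<zero>" if "y \<in> ideal_power R I k" for y
    using l_one[OF pc[OF that]] that by metis
  moreover have "\<zero> \<in> ideal_power R I k"
    using left_idealD(3)[OF left_ideal_of_ideal[OF ideal_ideal_power[OF I]]] .
  ultimately show ?thesis using I unfolding nilpotent_ideal_def by blast
qed

text \<open>By Noetherian induction, every ideal contains a product of finitely many primes.\<close>

lemma noetherian_prime_radical_products: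
  assumes acc: "acc_on {I. left_ideal I R}"
  shows "\<exists>k. \<forall>xs. set xs \<subseteq> prime_radical R \<and> length xs = k \<longrightarrow> foldr (\<otimes>) xs \<one> = \<zero>"
proof -
  let ?N = "prime_radical R"
  \<comment> \<open>\<open>P I\<close> says that some power of \<open>?N\<close> lies in
    \<open>I\<close>, phrased by products of elements.\<close>
  define P where "P I \<longleftrightarrow> (\<exists>k. \<forall>xs. set xs \<subseteq> ?N \<and> length xs = k \<longrightarrow> foldr (\<otimes>) xs \<one> \<in> I)" for I
  have N: "?N \<subseteq> carrier R" by (auto simp: prime_radical_def)
  have "P {\<zero>}"
  proof (rule ccontr)
    assume "\<not> P {\<zero>}"
    then have "{I. ideal I R \<and> \<not> P I} \<noteq> {}" using zeroideal by blast
    then have "\<exists>M\<in>{I. ideal I R \<and> \<not> P I}. \<forall>Z\<in>{I. ideal I R \<and> \<not> P I}. M \<subseteq> Z \<longrightarrow> Z = M"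
      using left_ideal_of_ideal by (intro acc_on_maximal[OF acc]) auto
    then obtain I where I: "ideal I R" "\<not> P I" and max: "\<And>Z. ideal Z R \<Longrightarrow> \<not> P Z \<Longrightarrow> I \<subseteq> Z \<Longrightarrow> Z = I"
      by auto
    note LI = left_ideal_of_ideal[OF I(1)]
    have "prime_ideal I R"
      unfolding prime_ideal_def
    proof (intro conjI allI impI I(1))
      show "I \<noteq> carrier R"
      proof
        assume "I = carrier R"
        then have "P I" unfolding P_def using foldr_mult_closed N by blast
        then show False using I(2) by blast
      qed
      fix A B assume AB: "ideal A R \<and> ideal B R \<and> A \<cdot> B \<subseteq> I"
      show "A \<subseteq> I \<or> B \<subseteq> I"
      proof (rule ccontr)
        assume not: "\<not> (A \<subseteq> I \<or> B \<subseteq> I)"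
        \<comment> \<open>\<open>I\<close> is maximal among the ideals violating \<open>P\<close>,
          so every strictly larger ideal satisfies it.\<close>
        have grow: "P (I <+>\<^bsub>R\<^esub> C)" if C: "ideal C R" "\<not> C \<subseteq> I" for C
          using max[OF add_ideals[OF I(1) C(1)]] set_add_upper[OF LI left_ideal_of_ideal[OF C(1)]] C(2)
          by blast
        obtain k where k: "\<And>xs. set xs \<subseteq> ?N \<Longrightarrow> length xs = k \<Longrightarrow> foldr (\<otimes>) xs \<one> \<in> I <+>\<^bsub>R\<^esub> A"
          using grow[of A] AB not unfolding P_def by blast
        obtain l where l: "\<And>xs. set xs \<subseteq> ?N \<Longrightarrow> length xs = l \<Longrightarrow> foldr (\<otimes>) xs \<one> \<in> I <+>\<^bsub>R\<^esub> B"
          using grow[of B] AB not unfolding P_def by blast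
        have "foldr (\<otimes>) xs \<one> \<in> I" if xs: "set xs \<subseteq> ?N" "length xs = k + l" for xs
        proof -
          have s: "set (take k xs) \<subseteq> ?N" "set (drop k xs) \<subseteq> ?N"
            using xs(1) set_take_subset[of k xs] set_drop_subset[of k xs] by auto
          obtain i a where a: "i \<in> I" "a \<in> A" "foldr (\<otimes>) (take k xs) \<one> = i \<oplus> a"
            using k[OF s(1)] xs(2) by (auto simp: mem_set_add)
          obtain j b where b: "j \<in> I" "b \<in> B" "foldr (\<otimes>) (drop k xs) \<one> = j \<oplus> b"
            using l[OF s(2)] xs(2) by (auto simp: mem_set_add)
          have c: "i \<in> carrier R" "a \<in> carrier R" "j \<in> carrier R" "b \<in> carrier R"
            using ideal.Icarr[OF I(1)] ideal.Icarr[of A R a] ideal.Icarr[of B R b] AB a b by auto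
          have "foldr (\<otimes>) xs \<one> = (i \<oplus> a) \<otimes> (j \<oplus> b)"
            using foldr_mult_append[of "take k xs" "drop k xs"] s N a(3) b(3) by auto
          \<comment> \<open>Modulo \<open>I\<close> only \<open>a b\<close> survives, and it lies in
            the product of \<open>A\<close> and \<open>B\<close>, inside \<open>I\<close>. So
            \<open>k + l\<close> factors suffice for \<open>I\<close>.\<close>
          also have "\<dots> = (i \<otimes> (j \<oplus> b) \<oplus> a \<otimes> j) \<oplus> a \<otimes> b" using c by algebra
          also have "\<dots> \<in> I"
          proof (intro left_idealD(4)[OF LI])
            show "i \<otimes> (j \<oplus> b) \<in> I" using ideal.I_r_closed[OF I(1) a(1)] c by simp
            show "a \<otimes> j \<in> I" using left_idealD(5)[OF LI c(2) b(1)] .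
            show "a \<otimes> b \<in> I" using AB ideal_prod.prod[OF a(2) b(2), of R] by blast
          qed
          finally show ?thesis .
        qed
        then have "P I" unfolding P_def by blast
        then show False using I(2) by blast
      qed
    qed
    \<comment> \<open>A prime contains the radical, so \<open>P I\<close> holds with exponent 1, the
      final contradiction.\<close>
    then have sub: "?N \<subseteq> I" by (rule prime_radical_least)
    have "foldr (\<otimes>) xs \<one> \<in> I" if "set xs \<subseteq> ?N \<and> length xs = 1" for xs
      using that sub r_one[OF subsetD[OF N]] by (cases xs) auto
    then have "P I" unfolding P_def by blast
    then show False using I(2) by blast
  qed
  then show ?thesis unfolding P_def by simp
qed

text \<open>For a prime \<open>P\<close>, minimality of the principal ideal \<open>Idl {a}\<close>
  is used twice to pass from elements to ideals: \<open>?B\<close> frees the left factor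
  \<open>a\<close>, then \<open>?C\<close> the right one. Hence the square of \<open>Idl {a}\<close>
  lies in \<open>P\<close>, and primeness applies.\<close>

lemma prime_radical_semiprime:
  assumes a: "a \<in> carrier R" and aRa: "\<And>r. r \<in> carrier R \<Longrightarrow> a \<otimes> r \<otimes> a \<in> prime_radical R"
  shows "a \<in> prime_radical R"
proof -
  have "a \<in> P" if P: "prime_ideal P R" for P
  proof -
    have iP: "ideal P R" using prime_idealD(1)[OF P] .
    interpret P: ideal P R by fact
    let ?A = "Idl {a}"
    have A: "ideal ?A R" "a \<in> ?A" using genideal_ideal[of "{a}"] genideal_self[of "{a}"] a by auto
    have Ac: "y \<in> carrier R" if "y \<in> ?A" for y using ideal.Icarr[OF A(1) that] .
    have least: "?A \<subseteq> B" if "ideal B R" "a \<in> B" for B using genideal_minimal[OF that(1)] that(2) by simp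
    have 1: "?A \<subseteq> {y \<in> carrier R. \<forall>r\<in>carrier R. y \<otimes> r \<otimes> a \<in> P}" (is "_ \<subseteq> ?B")
    proof (rule least)
      show "a \<in> ?B" using a aRa prime_radical_least[OF P] by auto
      show "ideal ?B R"
      proof (rule idealI_left[OF left_idealI])
        show "\<zero> \<in> ?B" using a by auto
        show "x \<oplus> y \<in> ?B" if "x \<in> ?B" "y \<in> ?B" for x y
          using that a by (auto simp: l_distr)
        show "r \<otimes> x \<in> ?B" if "r \<in> carrier R" "x \<in> ?B" for r x
          using that a P.I_l_closed by (auto simp: m_assoc)
        show "x \<otimes> r \<in> ?B" if xr: "x \<in> ?B" "r \<in> carrier R" for x r
        proof -
          have "x \<otimes> r \<otimes> s \<otimes> a \<in> P" if "s \<in> carrier R" for s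
          proof -
            have "x \<otimes> r \<otimes> s \<otimes> a = x \<otimes> (r \<otimes> s) \<otimes> a" using that xr a by (simp add: m_assoc)
            then show ?thesis using that xr by simp
          qed
          then show ?thesis using xr by simp
        qed
      qed auto
    qed
    have 2: "?A \<subseteq> {z \<in> carrier R. \<forall>y\<in>?A. \<forall>r\<in>carrier R. y \<otimes> r \<otimes> z \<in> P}" (is "_ \<subseteq> ?C")
    proof (rule least)
      show "a \<in> ?C" using a 1 by blast
      show "ideal ?C R"
      proof (rule idealI_left[OF left_idealI])
        show "\<zero> \<in> ?C" using Ac by auto
        show "x \<oplus> y \<in> ?C" if "x \<in> ?C" "y \<in> ?C" for x y
          using that Ac by (auto simp: r_distr)
        show "r \<otimes> x \<in> ?C" if rx: "r \<in> carrier R" "x \<in> ?C" for r x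
        proof -
          have "y \<otimes> s \<otimes> (r \<otimes> x) \<in> P" if "y \<in> ?A" "s \<in> carrier R" for y s
          proof -
            have "y \<otimes> s \<otimes> (r \<otimes> x) = y \<otimes> (s \<otimes> r) \<otimes> x" using that rx Ac by (simp add: m_assoc)
            then show ?thesis using that rx by simp
          qed
          then show ?thesis using rx by simp
        qed
        show "x \<otimes> r \<in> ?C" if rx: "x \<in> ?C" "r \<in> carrier R" for x r
        proof -
          have "y \<otimes> s \<otimes> (x \<otimes> r) \<in> P" if "y \<in> ?A" "s \<in> carrier R" for y s
          proof -
            have "y \<otimes> s \<otimes> (x \<otimes> r) = (y \<otimes> s \<otimes> x) \<otimes> r" using that rx Ac by (simp add: m_assoc)
            then show ?thesis using that rx P.I_r_closed by simp
          qed
          then show ?thesis using rx by simp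
        qed
      qed auto
    qed
    have "?A \<cdot> ?A \<subseteq> P"
    proof (rule ideal_prod_least[OF left_ideal_of_ideal[OF iP]])
      fix y z assume yz: "y \<in> ?A" "z \<in> ?A"
      then have "y \<otimes> \<one> \<otimes> z \<in> P" using 2 by blast
      then show "y \<otimes> z \<in> P" using Ac[OF yz(1)] by simp
    qed
    then show ?thesis using prime_idealD(3)[OF P A(1,1)] A(2) by blast
  qed
  then show ?thesis using a unfolding prime_radical_def by blast
qed

end

section \<open>Passing between a ring and its factor ring\<close>

context ideal
begin

lemma coset_eq_zero_iff: "x \<in> carrier R \<Longrightarrow> I +> x = \<zero>\<^bsub>R Quot I\<^esub> \<longleftrightarrow> x \<in> I"
  using rcos_const_imp_mem a_rcos_zero[OF ideal_axioms] by (auto simp: FactRing_def)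

lemma Quot_cases: "y \<in> carrier (R Quot I) \<Longrightarrow> (\<And>x. x \<in> carrier R \<Longrightarrow> y = I +> x \<Longrightarrow> thesis) \<Longrightarrow> thesis"
  by (auto simp: FactRing_simps)

lemma coset_regular_iff:
  assumes c: "c \<in> carrier R"
  shows "I +> c \<in> regular_elements (R Quot I) \<longleftrightarrow>
    (\<forall>r\<in>carrier R. (c \<otimes> r \<in> I \<longrightarrow> r \<in> I) \<and> (r \<otimes> c \<in> I \<longrightarrow> r \<in> I))"
proof -
  interpret q: ring_hom_ring R "R Quot I" "(+>) I" by (rule rcos_ring_hom_ring)
  have m: "(I +> x) \<otimes>\<^bsub>R Quot I\<^esub> (I +> y) = \<zero>\<^bsub>R Quot I\<^esub> \<longleftrightarrow> x \<otimes> y \<in> I"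
    if "x \<in> carrier R" "y \<in> carrier R" for x y
    using coset_eq_zero_iff[of "x \<otimes> y"] that by simp
  show ?thesis (is "?L \<longleftrightarrow> ?R")
  proof
    assume L: ?L
    show ?R
    proof (intro ballI conjI impI)
      fix r assume r: "r \<in> carrier R"
      show "r \<in> I" if "c \<otimes> r \<in> I"
        using regular_elementsD(2)[OF L q.hom_closed[OF r]] m[OF c r] that coset_eq_zero_iff[OF r] by blast
      show "r \<in> I" if "r \<otimes> c \<in> I"
        using regular_elementsD(3)[OF L q.hom_closed[OF r]] m[OF r c] that coset_eq_zero_iff[OF r] by blast
    qed
  next
    assume R: ?R
    show ?L
      unfolding regular_elements_def
    proof (intro CollectI conjI ballI impI)
      show "I +> c \<in> carrier (R Quot I)" using c by simp
      fix y assume y: "y \<in> carrier (R Quot I)"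
      obtain x where x: "x \<in> carrier R" "y = I +> x" using Quot_cases[OF y] .
      show "y = \<zero>\<^bsub>R Quot I\<^esub>" if "(I +> c) \<otimes>\<^bsub>R Quot I\<^esub> y = \<zero>\<^bsub>R Quot I\<^esub>"
        using that[unfolded x(2)] m[OF c x(1)] R x coset_eq_zero_iff[OF x(1)] by blast
      show "y = \<zero>\<^bsub>R Quot I\<^esub>" if "y \<otimes>\<^bsub>R Quot I\<^esub> (I +> c) = \<zero>\<^bsub>R Quot I\<^esub>"
        using that[unfolded x(2)] m[OF x(1) c] R x coset_eq_zero_iff[OF x(1)] by blast
    qed
  qed
qed

lemma left_ideal_coset_vimage:
  assumes J: "left_ideal J (R Quot I)"
  shows "left_ideal {x \<in> carrier R. I +> x \<in> J} R"
  using left_ideal_vimage[OF ring_axioms quotient_is_ring rcos_ring_hom J] .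

lemma left_ideal_coset_image:
  assumes J: "left_ideal J R"
  shows "left_ideal ((+>) I ` J) (R Quot I)"
proof -
  interpret q: ring_hom_ring R "R Quot I" "(+>) I" by (rule rcos_ring_hom_ring)
  note Jc = left_idealD[OF J]
  show ?thesis
  proof (rule q.S.left_idealI)
    show "(+>) I ` J \<subseteq> carrier (R Quot I)" using Jc by auto
    show "\<zero>\<^bsub>R Quot I\<^esub> \<in> (+>) I ` J" using Jc(3) q.hom_zero by (metis imageI)
    show "y \<oplus>\<^bsub>R Quot I\<^esub> z \<in> (+>) I ` J" if yz: "y \<in> (+>) I ` J" "z \<in> (+>) I ` J" for y z
    proof -
      obtain u v where "u \<in> J" "v \<in> J" "y = I +> u" "z = I +> v" using yz by blast
      then show ?thesis using Jc(2,4) q.hom_add by (metis imageI)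
    qed
    show "y \<otimes>\<^bsub>R Quot I\<^esub> z \<in> (+>) I ` J" if y: "y \<in> carrier (R Quot I)" and z: "z \<in> (+>) I ` J" for y z
    proof -
      obtain u where "u \<in> carrier R" "y = I +> u" using Quot_cases[OF y] .
      moreover obtain v where "v \<in> J" "z = I +> v" using z by blast
      ultimately show ?thesis using Jc(2,5) q.hom_mult by (metis imageI)
    qed
  qed
qed

lemma coset_image_mem_iff:
  assumes J: "left_ideal J R" "I \<subseteq> J" and x: "x \<in> carrier R"
  shows "I +> x \<in> (+>) I ` J \<longleftrightarrow> x \<in> J"
proof
  interpret q: ring_hom_ring R "R Quot I" "(+>) I" by (rule rcos_ring_hom_ring)
  assume "I +> x \<in> (+>) I ` J"
  then obtain y where y: "y \<in> J" "I +> x = I +> y" by blast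
  have yc: "y \<in> carrier R" using left_idealD(2)[OF J(1) y(1)] .
  have "I +> x = I +> y" using y(2) .
  then have "I +> (x \<ominus> y) = \<zero>\<^bsub>R Quot I\<^esub>"
    using x yc by (simp add: a_minus_def q.S.r_neg)
  then have "x \<ominus> y \<in> J" using coset_eq_zero_iff[of "x \<ominus> y"] x yc J(2) by auto
  moreover have "x = (x \<ominus> y) \<oplus> y" using x yc by algebra
  ultimately show "x \<in> J" using left_idealD(4)[OF J(1)] y(1) by metis
qed blast

end

lemma regular_mod_radical_iff:
  assumes "ring R"
  shows "c \<in> regular_mod_radical R \<longleftrightarrow> c \<in> carrier R \<and> (\<forall>r\<in>carrier R.
    (c \<otimes>\<^bsub>R\<^esub> r \<in> prime_radical R \<longrightarrow> r \<in> prime_radical R) \<and>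
    (r \<otimes>\<^bsub>R\<^esub> c \<in> prime_radical R \<longrightarrow> r \<in> prime_radical R))"
  using ideal.coset_regular_iff[OF ring.ideal_prime_radical[OF assms]]
  unfolding regular_mod_radical_def by auto

section \<open>From the quotient ring to the ring\<close>

context ring
begin

lemma one_regular: "\<one> \<in> regular_elements R"
  by (simp add: regular_elements_def)

lemma regular_mult:
  assumes c: "c \<in> regular_elements R" and d: "d \<in> regular_elements R"
  shows "c \<otimes> d \<in> regular_elements R"
  unfolding regular_elements_def
proof (intro CollectI conjI ballI impI)
  note cd = regular_elementsD(1)[OF c] regular_elementsD(1)[OF d]
  then show "c \<otimes> d \<in> carrier R" by simp
  fix r assume r: "r \<in> carrier R"
  show "r = \<zero>" if "c \<otimes> d \<otimes> r = \<zero>"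
    using regular_elementsD(2)[OF c, of "d \<otimes> r"] regular_elementsD(2)[OF d r] that r cd
    by (simp add: m_assoc)
  show "r = \<zero>" if "r \<otimes> (c \<otimes> d) = \<zero>"
    using regular_elementsD(3)[OF d, of "r \<otimes> c"] regular_elementsD(3)[OF c r] that r cd
    by (simp add: m_assoc)
qed

end

text \<open>If \<open>x\<close> in \<open>I n\<close> lies in the closure of the sum of the earlier
  summands, some regular \<open>c\<close> carries it into the intersection of \<open>I n\<close>
  with that sum, which is zero. So each nonzero \<open>I n\<close> strictly enlarges the
  closure.\<close>

lemma (in ring) left_goldieI:
  assumes Ore: "\<And>c r. c \<in> regular_elements R \<Longrightarrow> r \<in> carrier R \<Longrightarrow>
      \<exists>c'\<in>regular_elements R. \<exists>r'\<in>carrier R. c' \<otimes> r = r' \<otimes> c"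
    and acc: "acc_on {I. left_ideal I R \<and> closed_under R (regular_elements R) I}"
  shows "left_goldie R"
  unfolding left_goldie_def
proof (intro conjI ring_axioms notI)
  let ?C = "regular_elements R"
  have Cc: "c \<in> carrier R" if "c \<in> ?C" for c using regular_elementsD(1)[OF that] .
  have "left_annihilator R Y \<in> {I. left_ideal I R \<and> closed_under R ?C I}" if Y: "Y \<subseteq> carrier R" for Y
  proof -
    have Yc: "y \<in> carrier R" if "y \<in> Y" for y using Y that by blast
    have "left_ideal (left_annihilator R Y) R"
      using Yc by (intro left_idealI) (auto simp: left_annihilator_def l_distr m_assoc)
    moreover have "r \<otimes> y = \<zero>" if "c \<in> ?C" "r \<in> carrier R" "y \<in> Y" "c \<otimes> r \<otimes> y = \<zero>" for c r y
      using regular_elementsD(2)[OF that(1), of "r \<otimes> y"] that Yc Cc by (simp add: m_assoc)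
    ultimately show ?thesis by (auto simp: closed_under_def left_annihilator_def)
  qed
  then show "acc_on {left_annihilator R Y | Y. Y \<subseteq> carrier R}"
    by (intro acc_on_subset[OF acc]) blast
  assume "\<exists>I :: nat \<Rightarrow> 'a set. (\<forall>n. left_ideal (I n) R \<and> I n \<noteq> {\<zero>}) \<and> direct_family R I"
  then obtain I :: "nat \<Rightarrow> 'a set" where I: "\<And>n. left_ideal (I n) R" "\<And>n. I n \<noteq> {\<zero>}"
    and direct: "direct_family R I" by blast
  have Ic: "x \<in> carrier R" if "x \<in> I n" for x n using left_idealD(2)[OF I(1) that] .
  \<comment> \<open>The sum of \<open>I 0\<close> up to \<open>I (n-1)\<close>; index
    \<open>n\<close> is left out so that \<open>I n\<close> is the next summand.\<close>
  define T where "T n = {finsum R x {..<n} | x. \<forall>i<n. x i \<in> I i}" for n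
  have T: "left_ideal (T n) R" for n
  proof (rule left_idealI)
    show "T n \<subseteq> carrier R" unfolding T_def using Ic by (auto intro!: finsum_closed)
    show "\<zero> \<in> T n"
      unfolding T_def
      by (rule CollectI, rule exI[of _ "\<lambda>_. \<zero>"]) (use left_idealD(3)[OF I(1)] in simp)
    fix y z assume "y \<in> T n" "z \<in> T n"
    then obtain u v where u: "\<forall>i<n. u i \<in> I i" "y = finsum R u {..<n}"
      and v: "\<forall>i<n. v i \<in> I i" "z = finsum R v {..<n}" unfolding T_def by blast
    have "y \<oplus> z = finsum R (\<lambda>i. u i \<oplus> v i) {..<n}"
      unfolding u v using u(1) v(1) Ic by (subst finsum_addf) auto
    moreover have "\<forall>i<n. u i \<oplus> v i \<in> I i" using u(1) v(1) left_idealD(4)[OF I(1)] by blast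
    ultimately show "y \<oplus> z \<in> T n" unfolding T_def by blast
  next
    fix n r y assume r: "r \<in> carrier R" and "y \<in> T n"
    then obtain u where u: "\<forall>i<n. u i \<in> I i" "y = finsum R u {..<n}" unfolding T_def by blast
    have "r \<otimes> y = finsum R (\<lambda>i. r \<otimes> u i) {..<n}"
      unfolding u using u(1) Ic r by (intro finsum_rdistr) auto
    moreover have "\<forall>i<n. r \<otimes> u i \<in> I i" using u(1) left_idealD(5)[OF I(1) r] by blast
    ultimately show "r \<otimes> y \<in> T n" unfolding T_def by blast
  qed
  have step: "x \<oplus> y \<in> T (Suc n)" if xy: "x \<in> I n" "y \<in> T n" for n x y
  proof -
    obtain u where u: "\<forall>i<n. u i \<in> I i" "y = finsum R u {..<n}" using xy(2) unfolding T_def by blast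
    let ?u = "u(n := x)"
    have "finsum R ?u {..<n} = y" unfolding u(2) using u(1) Ic by (intro finsum_cong') auto
    moreover have "finsum R ?u {..<Suc n} = ?u n \<oplus> finsum R ?u {..<n}"
      unfolding lessThan_Suc using u(1) Ic[OF xy(1)] Ic by (intro finsum_insert) auto
    ultimately have "finsum R ?u {..<Suc n} = x \<oplus> y" by simp
    moreover have "\<forall>i<Suc n. ?u i \<in> I i" using u(1) xy(1) by auto
    ultimately show ?thesis unfolding T_def by (intro CollectI exI[of _ ?u]) simp
  qed
  have disj: "x = \<zero>" if x: "x \<in> I n" "x \<in> T n" for n x
  proof -
    obtain u where u: "\<forall>i<n. u i \<in> I i" "x = finsum R u {..<n}" using x(2) unfolding T_def by blast
    \<comment> \<open>Putting \<open>\<ominus> x\<close> in slot \<open>n\<close> turns the equation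
      for \<open>x\<close> into a relation with sum zero, to which directness applies.\<close>
    let ?u = "u(n := \<ominus> x)"
    have xc: "x \<in> carrier R" using Ic x(1) by blast
    have "finsum R ?u {..<n} = x" unfolding u(2) using u(1) Ic by (intro finsum_cong') auto
    moreover have "finsum R ?u {..<Suc n} = ?u n \<oplus> finsum R ?u {..<n}"
      unfolding lessThan_Suc using u(1) xc Ic by (intro finsum_insert) auto
    ultimately have "finsum R ?u {..<Suc n} = \<zero>" using xc by (simp add: l_neg)
    moreover have "\<forall>i\<in>{..<Suc n}. ?u i \<in> I i" using u(1) left_ideal_a_inv[OF I(1) x(1)] by auto
    ultimately have "\<forall>i\<in>{..<Suc n}. ?u i = \<zero>"
      using direct unfolding direct_family_def by blast
    then have "?u n = \<zero>" by (rule bspec) simp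
    then have "\<ominus> x = \<zero>" by simp
    then show ?thesis using xc by simp
  qed
  \<comment> \<open>The closure of \<open>T n\<close>; the Ore condition provides the multipliers
    that make it a left ideal.\<close>
  define cl where "cl n = {r \<in> carrier R. \<exists>c\<in>?C. c \<otimes> r \<in> T n}" for n
  have cl: "left_ideal (cl n) R" for n
  proof (rule left_idealI)
    show "cl n \<subseteq> carrier R" by (auto simp: cl_def)
    show "\<zero> \<in> cl n" using one_regular left_idealD(3)[OF T] by (auto simp: cl_def intro!: bexI[of _ \<one>])
    fix x y assume "x \<in> cl n" "y \<in> cl n"
    then obtain c d where c: "x \<in> carrier R" "c \<in> ?C" "c \<otimes> x \<in> T n"
      and d: "y \<in> carrier R" "d \<in> ?C" "d \<otimes> y \<in> T n" by (auto simp: cl_def)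
    obtain e r where e: "e \<in> ?C" "r \<in> carrier R" "e \<otimes> d = r \<otimes> c" using Ore[OF c(2) Cc[OF d(2)]] by blast
    have "(e \<otimes> d) \<otimes> (x \<oplus> y) = (e \<otimes> d) \<otimes> x \<oplus> (e \<otimes> d) \<otimes> y" using c(1) d(1,2) e(1) Cc by (simp add: r_distr)
    also have "(e \<otimes> d) \<otimes> x = r \<otimes> (c \<otimes> x)" unfolding e(3) using c(1,2) e(2) Cc by (simp add: m_assoc)
    also have "(e \<otimes> d) \<otimes> y = e \<otimes> (d \<otimes> y)" using d(1,2) e(1) Cc by (simp add: m_assoc)
    also have "r \<otimes> (c \<otimes> x) \<oplus> e \<otimes> (d \<otimes> y) \<in> T n" using left_idealD(4,5)[OF T] c(3) d(3) e(1,2) Cc by simp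
    finally show "x \<oplus> y \<in> cl n" using regular_mult[OF e(1) d(2)] c(1) d(1) by (auto simp: cl_def)
  next
    fix n x y assume x: "x \<in> carrier R" and "y \<in> cl n"
    then obtain c where c: "y \<in> carrier R" "c \<in> ?C" "c \<otimes> y \<in> T n" by (auto simp: cl_def)
    obtain e r where e: "e \<in> ?C" "r \<in> carrier R" "e \<otimes> x = r \<otimes> c" using Ore[OF c(2) x] by blast
    have "e \<otimes> (x \<otimes> y) = (e \<otimes> x) \<otimes> y" using x c(1) e(1) Cc by (simp add: m_assoc)
    also have "\<dots> = r \<otimes> (c \<otimes> y)" unfolding e(3) using c(1,2) e(2) Cc by (simp add: m_assoc)
    also have "\<dots> \<in> T n" using left_idealD(5)[OF T] c(3) e(2) by simp
    finally show "x \<otimes> y \<in> cl n" using x c(1) e(1) by (auto simp: cl_def)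
  qed
  have "closed_under R ?C (cl n)" for n
    unfolding closed_under_def
  proof (intro ballI impI)
    fix c r assume c: "c \<in> ?C" and r: "r \<in> carrier R" and "c \<otimes> r \<in> cl n"
    then obtain d where "d \<in> ?C" "d \<otimes> (c \<otimes> r) \<in> T n" by (auto simp: cl_def)
    then show "r \<in> cl n" using regular_mult[of d c] c r Cc by (auto simp: cl_def m_assoc intro!: bexI[of _ "d \<otimes> c"])
  qed
  moreover have "cl n \<subseteq> cl (Suc n)" for n
    using step[OF left_idealD(3)[OF I(1)]] left_idealD(2)[OF T] by (force simp: cl_def)
  ultimately have "\<exists>N. \<forall>n\<ge>N. cl n = cl N" using cl by (intro acc_onD[OF acc]) auto
  then obtain n where n: "cl (Suc n) = cl n" by (meson le_SucI order_refl)
  obtain x where x: "x \<in> I n" "x \<noteq> \<zero>" using I left_idealD(3)[OF I(1)] by blast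
  have xc: "x \<in> carrier R" using Ic x(1) by blast
  have "\<one> \<otimes> x \<in> T (Suc n)" using step[OF x(1) left_idealD(3)[OF T]] xc by simp
  then have "x \<in> cl (Suc n)" unfolding cl_def using xc one_regular by blast
  then have "x \<in> cl n" using n by simp
  then obtain c where c: "c \<in> ?C" "c \<otimes> x \<in> T n" by (auto simp: cl_def)
  then have "c \<otimes> x = \<zero>" using disj left_idealD(5)[OF I(1) Cc x(1)] by blast
  then show False using regular_elementsD(2)[OF c(1) xc] x(2) by blast
qed

context left_localization
begin

lemma ideal_contr: "ideal K Q \<Longrightarrow> ideal (contr K) R"
  using left_ideal_contr[OF Q.left_ideal_of_ideal] ideal.I_r_closed[of K Q]
  by (intro R.idealI_left) (auto simp: contr_def)

lemma prime_ideal_contr: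
  assumes acc: "acc_on {K. left_ideal K Q}" and P: "prime_ideal P Q"
  shows "prime_ideal (contr P) R"
  unfolding prime_ideal_def
proof (intro conjI allI impI)
  note iP = Q.prime_idealD(1)[OF P]
  note LP = Q.left_ideal_of_ideal[OF iP]
  show "ideal (contr P) R" using ideal_contr[OF iP] .
  show "contr P \<noteq> carrier R"
  proof
    assume "contr P = carrier R"
    then have "\<one>\<^bsub>Q\<^esub> \<in> P" using f.hom_one R.one_closed unfolding contr_def by force
    then show False using Q.prime_idealD(2)[OF P] ideal.one_imp_carrier[OF iP] by blast
  qed
  fix A B assume "ideal A R \<and> ideal B R \<and> A \<cdot>\<^bsub>R\<^esub> B \<subseteq> contr P"
  then have A: "ideal A R" and B: "ideal B R" and AB: "A \<cdot>\<^bsub>R\<^esub> B \<subseteq> contr P" by auto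
  note eA = ideal_ext[OF acc A] and eB = ideal_ext[OF acc B]
  have "ext A \<cdot>\<^bsub>Q\<^esub> ext B \<subseteq> P"
  proof (rule Q.ideal_prod_least[OF LP])
    fix x y assume x: "x \<in> ext A" and "y \<in> ext B"
    then obtain d b where d: "y \<in> carrier Q" "d \<in> S" "b \<in> B" "f d \<otimes>\<^bsub>Q\<^esub> y = f b" by (auto simp: ext_def)
    have xc: "x \<in> carrier Q" using x by (simp add: ext_def)
    have v: "inv\<^bsub>Q\<^esub> (f d) \<in> carrier Q" using unit[OF d(2)] by simp
    \<comment> \<open>Two-sidedness of \<open>ext A\<close> absorbs the denominator of
      \<open>y\<close> into \<open>x\<close>, so that \<open>x y\<close> becomes a left fraction
      with numerator \<open>a b\<close>.\<close>
    have "x \<otimes>\<^bsub>Q\<^esub> inv\<^bsub>Q\<^esub> (f d) \<in> ext A" using ideal.I_r_closed[OF eA x v] .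
    then obtain c a where c: "c \<in> S" "a \<in> A" "f c \<otimes>\<^bsub>Q\<^esub> (x \<otimes>\<^bsub>Q\<^esub> inv\<^bsub>Q\<^esub> (f d)) = f a" by (auto simp: ext_def)
    have abc: "a \<in> carrier R" "b \<in> carrier R" using ideal.Icarr[OF A c(2)] ideal.Icarr[OF B d(3)] by auto
    have y: "y = inv\<^bsub>Q\<^esub> (f d) \<otimes>\<^bsub>Q\<^esub> f b"
      unfolding d(4)[symmetric] using d(1,2) unit[OF d(2)] v by (simp add: Q.m_assoc[symmetric] S_in_carrier)
    have "f c \<otimes>\<^bsub>Q\<^esub> (x \<otimes>\<^bsub>Q\<^esub> y) = f c \<otimes>\<^bsub>Q\<^esub> (x \<otimes>\<^bsub>Q\<^esub> inv\<^bsub>Q\<^esub> (f d)) \<otimes>\<^bsub>Q\<^esub> f b"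
      unfolding y using c(1) xc v abc by (simp add: Q.m_assoc S_in_carrier)
    also have "\<dots> = f (a \<otimes>\<^bsub>R\<^esub> b)" unfolding c(3) using abc by simp
    also have "\<dots> \<in> P" using AB ideal_prod.prod[OF c(2) d(3), of R] by (auto simp: contr_def)
    finally show "x \<otimes>\<^bsub>Q\<^esub> y \<in> P" using left_ideal_unit_cancel[OF LP c(1)] xc d(1) by simp
  qed
  then have "ext A \<subseteq> P \<or> ext B \<subseteq> P" using Q.prime_idealD(3)[OF P eA eB] by blast
  moreover have sub: "D \<subseteq> contr P" if "ext D \<subseteq> P" "ideal D R" for D
  proof
    have D: "D \<subseteq> carrier R" using R.left_idealD(1)[OF R.left_ideal_of_ideal[OF that(2)]] .
    fix x assume "x \<in> D"
    then show "x \<in> contr P" using ext_mem[OF D] that(1) D unfolding contr_def by blast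
  qed
  ultimately show "A \<subseteq> contr P \<or> B \<subseteq> contr P" using sub[OF _ A] sub[OF _ B] by blast
qed

lemma foldr_mult_hom:
  "set xs \<subseteq> carrier R \<Longrightarrow> f (foldr (\<otimes>\<^bsub>R\<^esub>) xs \<one>\<^bsub>R\<^esub>) = foldr (\<otimes>\<^bsub>Q\<^esub>) (map f xs) \<one>\<^bsub>Q\<^esub>"
  using R.foldr_mult_closed by (induct xs) auto

text \<open>One inclusion comes from contracting primes. For the other, the contracted radical
  inherits nilpotency because \<open>f\<close> is injective and multiplicative, and a nilpotent
  ideal lies in every prime.\<close>

lemma prime_radical_contr:
  assumes acc: "acc_on {K. left_ideal K Q}"
  shows "prime_radical R = contr (prime_radical Q)" and "nilpotent_ideal (prime_radical R) R"
proof -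
  have nil: "nilpotent_ideal (contr (prime_radical Q)) R"
  proof -
    obtain k where k: "\<And>ys. set ys \<subseteq> prime_radical Q \<Longrightarrow> length ys = k \<Longrightarrow> foldr (\<otimes>\<^bsub>Q\<^esub>) ys \<one>\<^bsub>Q\<^esub> = \<zero>\<^bsub>Q\<^esub>"
      using Q.noetherian_prime_radical_products[OF acc] by blast
    show ?thesis
    proof (rule R.nilpotent_idealI[OF ideal_contr[OF Q.ideal_prime_radical]])
      fix xs assume xs: "set xs \<subseteq> contr (prime_radical Q)" "length xs = k"
      then have c: "set xs \<subseteq> carrier R" by (auto simp: contr_def)
      have "set (map f xs) \<subseteq> prime_radical Q" using xs(1) by (auto simp: contr_def)
      then have "f (foldr (\<otimes>\<^bsub>R\<^esub>) xs \<one>\<^bsub>R\<^esub>) = f \<zero>\<^bsub>R\<^esub>"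
        using k[of "map f xs"] xs(2) foldr_mult_hom[OF c] by simp
      then show "foldr (\<otimes>\<^bsub>R\<^esub>) xs \<one>\<^bsub>R\<^esub> = \<zero>\<^bsub>R\<^esub>"
        using f_eqD R.foldr_mult_closed[OF c] by blast
    qed
  qed
  have "prime_radical R \<subseteq> contr (prime_radical Q)"
  proof
    fix x assume x: "x \<in> prime_radical R"
    then have xc: "x \<in> carrier R" by (simp add: prime_radical_def)
    have "f x \<in> P" if "prime_ideal P Q" for P
      using R.prime_radical_least[OF prime_ideal_contr[OF acc that]] x by (auto simp: contr_def)
    then show "x \<in> contr (prime_radical Q)" using xc by (simp add: contr_def prime_radical_def)
  qed
  then show eq: "prime_radical R = contr (prime_radical Q)"
    using R.nilpotent_subset_prime_radical[OF nil] by blast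
  show "nilpotent_ideal (prime_radical R) R" unfolding eq by (rule nil)
qed

end

text \<open>With \<open>j = \<one> - x\<close>, the partial sums of the geometric series in
  \<open>j\<close> invert \<open>x\<close> up to \<open>j^n\<close>, which vanishes for
  \<open>n = k\<close>.\<close>

lemma (in ring) unit_mod_nilpotent:
  assumes J: "ideal J R" and nil: "\<And>xs. set xs \<subseteq> J \<Longrightarrow> length xs = k \<Longrightarrow> foldr (\<otimes>) xs \<one> = \<zero>"
    and x: "x \<in> carrier R" "\<one> \<ominus> x \<in> J"
  shows "\<exists>y\<in>carrier R. y \<otimes> x = \<one>"
proof -
  define j where "j = \<one> \<ominus> x"
  have j: "j \<in> J" "j \<in> carrier R" using x by (auto simp: j_def)
  have xj: "x = \<one> \<ominus> j" unfolding j_def using x(1) by algebra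
  have rep: "foldr (\<otimes>) (replicate n j) \<one> = j [^] n" for n
    using j(2) nat_pow_Suc2[OF j(2)] by (induct n) (auto simp del: nat_pow_Suc)
  have "\<exists>y\<in>carrier R. y \<otimes> x = \<one> \<ominus> j [^] n" for n :: nat
  proof (induct n)
    case 0
    then show ?case using x(1) by (intro bexI[of _ \<zero>]) (auto simp: a_minus_def r_neg)
  next
    case (Suc n)
    then obtain y where y: "y \<in> carrier R" "y \<otimes> x = \<one> \<ominus> j [^] n" by blast
    have p: "j [^] n \<in> carrier R" using j(2) by simp
    have "(y \<oplus> j [^] n) \<otimes> x = y \<otimes> x \<oplus> j [^] n \<otimes> x" using y(1) x(1) p by (simp add: l_distr)
    also have "\<dots> = (\<one> \<ominus> j [^] n) \<oplus> j [^] n \<otimes> (\<one> \<ominus> j)" unfolding y(2) using xj by simp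
    also have "\<dots> = (\<one> \<ominus> j [^] n) \<oplus> (j [^] n \<ominus> j [^] n \<otimes> j)"
      using p j(2) by (simp add: a_minus_def r_distr r_minus)
    also have "\<dots> = \<one> \<ominus> j [^] n \<otimes> j" using p j(2) by algebra
    finally show ?case using y(1) p by (intro bexI[of _ "y \<oplus> j [^] n"]) auto
  qed
  moreover have "j [^] k = \<zero>" using nil[of "replicate k j"] j(1) rep by (auto simp: set_replicate_conv_if simp del: foldr_replicate)
  ultimately show ?thesis by (metis a_minus_def minus_zero one_closed r_zero)
qed

lemma left_quotient_ring_localization:
  assumes R: "ring R" and Q: "left_quotient_ring R Q f"
  shows "left_localization R Q (regular_elements R) f"
proof -
  interpret R: ring R by fact
  interpret Q: ring Q using Q by (simp add: left_quotient_ring_def)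
  show ?thesis
  proof unfold_locales
    show "regular_elements R \<subseteq> carrier R" by (rule subsetI) (rule regular_elementsD(1))
    show "\<one>\<^bsub>R\<^esub> \<in> regular_elements R" by (rule R.one_regular)
    show "c \<otimes>\<^bsub>R\<^esub> d \<in> regular_elements R" if "c \<in> regular_elements R" "d \<in> regular_elements R" for c d
      using R.regular_mult that .
  qed (use Q in \<open>auto simp: left_quotient_ring_def\<close>)
qed

lemma artinian_quotient_ring_conditions:
  assumes R: "ring R" and Q: "left_quotient_ring R Q f" and art: "left_artinian Q"
  shows "left_goldie (R Quot prime_radical R)"
    and "nilpotent_ideal (prime_radical R) R"
    and "regular_mod_radical R \<subseteq> regular_elements R"
    and "c \<in> regular_mod_radical R \<Longrightarrow> n \<in> prime_radical R \<Longrightarrow>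
      \<exists>c'\<in>regular_mod_radical R. \<exists>n'\<in>prime_radical R. c' \<otimes>\<^bsub>R\<^esub> n = n' \<otimes>\<^bsub>R\<^esub> c"
    and "acc_on {I. left_ideal I R \<and> closed_under R (regular_mod_radical R) I}"
proof -
  let ?N = "prime_radical R" and ?J = "prime_radical Q" and ?C = "regular_elements R"
  interpret left_localization R Q ?C f by (rule left_quotient_ring_localization[OF R Q])
  have dcc: "dcc_on {K. left_ideal K Q}" using art by (simp add: left_artinian_def)
  have acc: "acc_on {K. left_ideal K Q}" using Q.left_artinian_imp_noetherian[OF dcc] .
  note N = prime_radical_contr[OF acc]
  interpret N: ideal ?N R by (rule R.ideal_prime_radical)
  interpret J: ideal ?J Q by (rule Q.ideal_prime_radical)
  have LJ: "left_ideal ?J Q" using Q.left_ideal_of_ideal[OF Q.ideal_prime_radical] .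
  have Nmem: "x \<in> ?N \<longleftrightarrow> f x \<in> ?J" if "x \<in> carrier R" for x
    using that unfolding N(1) by (simp add: contr_def)
  show "nilpotent_ideal ?N R" by (rule N(2))
  have sub: "?C \<subseteq> regular_mod_radical R"
  proof
    fix c assume c: "c \<in> ?C"
    have cc: "c \<in> carrier R" using S_in_carrier[OF c] .
    have "r \<in> ?N" if "r \<in> carrier R" "c \<otimes>\<^bsub>R\<^esub> r \<in> ?N" for r
    proof -
      have "f c \<otimes>\<^bsub>Q\<^esub> f r \<in> ?J" using that cc Nmem[of "c \<otimes>\<^bsub>R\<^esub> r"] by simp
      then have "f r \<in> ?J" using left_ideal_unit_cancel[OF LJ c] that(1) by simp
      then show ?thesis using Nmem that(1) by simp
    qed
    moreover have "r \<in> ?N" if "r \<in> carrier R" "r \<otimes>\<^bsub>R\<^esub> c \<in> ?N" for r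
    proof -
      have "f r \<otimes>\<^bsub>Q\<^esub> f c \<in> ?J" using that cc Nmem[of "r \<otimes>\<^bsub>R\<^esub> c"] by simp
      then have "f r \<otimes>\<^bsub>Q\<^esub> f c \<otimes>\<^bsub>Q\<^esub> inv\<^bsub>Q\<^esub> (f c) \<in> ?J" using J.I_r_closed unit[OF c] by simp
      moreover have "f r \<otimes>\<^bsub>Q\<^esub> f c \<otimes>\<^bsub>Q\<^esub> inv\<^bsub>Q\<^esub> (f c) = f r"
        using that(1) cc unit[OF c] by (simp add: Q.m_assoc)
      ultimately show ?thesis using Nmem that(1) by simp
    qed
    ultimately show "c \<in> regular_mod_radical R" using regular_mod_radical_iff[OF R] cc by blast
  qed
  show sup: "regular_mod_radical R \<subseteq> ?C"
  proof
    fix c assume c: "c \<in> regular_mod_radical R"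
    then have cc: "c \<in> carrier R" and cN: "\<And>r. r \<in> carrier R \<Longrightarrow> r \<otimes>\<^bsub>R\<^esub> c \<in> ?N \<Longrightarrow> r \<in> ?N"
      using regular_mod_radical_iff[OF R] by blast+
    \<comment> \<open>Clearing the denominator of \<open>y\<close> reduces right cancellation of
      \<open>f c\<close> modulo \<open>?J\<close> to that of \<open>c\<close> modulo
      \<open>?N\<close>.\<close>
    have cancel: "y \<in> ?J" if y: "y \<in> carrier Q" "y \<otimes>\<^bsub>Q\<^esub> f c \<in> ?J" for y
    proof -
      obtain s r where s: "s \<in> ?C" "r \<in> carrier R" "f s \<otimes>\<^bsub>Q\<^esub> y = f r" using numerator[OF y(1)] by blast
      have "f s \<otimes>\<^bsub>Q\<^esub> (y \<otimes>\<^bsub>Q\<^esub> f c) \<in> ?J" using J.I_l_closed[OF y(2)] S_in_carrier[OF s(1)] by simp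
      also have "f s \<otimes>\<^bsub>Q\<^esub> (y \<otimes>\<^bsub>Q\<^esub> f c) = f (r \<otimes>\<^bsub>R\<^esub> c)"
        using s y(1) cc S_in_carrier[OF s(1)] by (simp add: Q.m_assoc[symmetric])
      finally have "r \<in> ?N" using cN Nmem s(2) cc by simp
      then have "f s \<otimes>\<^bsub>Q\<^esub> y \<in> ?J" using Nmem s by simp
      then show ?thesis using left_ideal_unit_cancel[OF LJ s(1) y(1)] by blast
    qed
    \<comment> \<open>The chain condition gives a left inverse of \<open>f c\<close> modulo
      \<open>?J\<close>, nilpotency of the radical corrects it to a true left inverse, and in a left
      Artinian ring this makes \<open>f c\<close> a unit.\<close>
    obtain x where x: "x \<in> carrier Q" "\<one>\<^bsub>Q\<^esub> \<ominus>\<^bsub>Q\<^esub> x \<otimes>\<^bsub>Q\<^esub> f c \<in> ?J"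
      using Q.left_artinian_left_inverse_mod[OF dcc LJ f.hom_closed[OF cc] cancel] J.I_r_closed cc by auto
    obtain k where k: "\<And>ys. set ys \<subseteq> ?J \<Longrightarrow> length ys = k \<Longrightarrow> foldr (\<otimes>\<^bsub>Q\<^esub>) ys \<one>\<^bsub>Q\<^esub> = \<zero>\<^bsub>Q\<^esub>"
      using Q.noetherian_prime_radical_products[OF acc] by blast
    have "\<exists>y\<in>carrier Q. y \<otimes>\<^bsub>Q\<^esub> (x \<otimes>\<^bsub>Q\<^esub> f c) = \<one>\<^bsub>Q\<^esub>"
      by (rule Q.unit_mod_nilpotent[OF Q.ideal_prime_radical k]) (use x cc in auto)
    then obtain y where y: "y \<in> carrier Q" "y \<otimes>\<^bsub>Q\<^esub> (x \<otimes>\<^bsub>Q\<^esub> f c) = \<one>\<^bsub>Q\<^esub>" by blast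
    then have "(y \<otimes>\<^bsub>Q\<^esub> x) \<otimes>\<^bsub>Q\<^esub> f c = \<one>\<^bsub>Q\<^esub>" using x(1) cc by (simp add: Q.m_assoc)
    then have u: "f c \<in> Units Q"
      using Q.left_artinian_left_inverse_unit[OF dcc f.hom_closed[OF cc], of "y \<otimes>\<^bsub>Q\<^esub> x"] x(1) y(1) by simp
    show "c \<in> ?C"
      unfolding regular_elements_def
    proof (intro CollectI conjI ballI impI cc)
      fix r assume r: "r \<in> carrier R"
      show "r = \<zero>\<^bsub>R\<^esub>" if "c \<otimes>\<^bsub>R\<^esub> r = \<zero>\<^bsub>R\<^esub>"
      proof -
        have "f c \<otimes>\<^bsub>Q\<^esub> f r = f \<zero>\<^bsub>R\<^esub>" using f.hom_mult[OF cc r] unfolding that by (rule sym)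
        also have "\<dots> = f c \<otimes>\<^bsub>Q\<^esub> f \<zero>\<^bsub>R\<^esub>" using cc by simp
        finally have "f r = f \<zero>\<^bsub>R\<^esub>" using Q.Units_l_cancel[OF u, of "f r" "f \<zero>\<^bsub>R\<^esub>"] r by simp
        then show ?thesis using f_eqD r by blast
      qed
      show "r = \<zero>\<^bsub>R\<^esub>" if "r \<otimes>\<^bsub>R\<^esub> c = \<zero>\<^bsub>R\<^esub>"
      proof -
        have "f r \<otimes>\<^bsub>Q\<^esub> f c = f \<zero>\<^bsub>R\<^esub>" using f.hom_mult[OF r cc] unfolding that by (rule sym)
        then have "f r \<otimes>\<^bsub>Q\<^esub> f c \<otimes>\<^bsub>Q\<^esub> inv\<^bsub>Q\<^esub> (f c) = \<zero>\<^bsub>Q\<^esub>" using u by simp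
        then have "f r = f \<zero>\<^bsub>R\<^esub>" using u r cc by (simp add: Q.m_assoc)
        then show ?thesis using f_eqD r by blast
      qed
    qed
  qed
  have C: "regular_mod_radical R = ?C" using sub sup by blast
  show acc': "acc_on {I. left_ideal I R \<and> closed_under R (regular_mod_radical R) I}"
    using acc unfolding C acc_on_left_ideals_iff .
  show "\<exists>c'\<in>regular_mod_radical R. \<exists>n'\<in>?N. c' \<otimes>\<^bsub>R\<^esub> n = n' \<otimes>\<^bsub>R\<^esub> c"
    if c: "c \<in> regular_mod_radical R" and n: "n \<in> ?N"
  proof -
    have cC: "c \<in> ?C" using c C by simp
    have cc: "c \<in> carrier R" "n \<in> carrier R" using S_in_carrier[OF cC] N.Icarr[OF n] by auto
    obtain c' r where c': "c' \<in> ?C" "r \<in> carrier R" "c' \<otimes>\<^bsub>R\<^esub> n = r \<otimes>\<^bsub>R\<^esub> c" using Ore[OF cC cc(2)] by blast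
    have "c' \<otimes>\<^bsub>R\<^esub> n \<in> ?N" using N.I_l_closed[OF n] S_in_carrier[OF c'(1)] by blast
    \<comment> \<open>The Ore equation \<open>c' n = r c\<close> has its left side in the radical,
      and \<open>c\<close> is regular modulo the radical.\<close>
    then have "r \<in> ?N" using c c' regular_mod_radical_iff[OF R] by metis
    then show ?thesis using c' C by blast
  qed
  interpret q: ring_hom_ring R "R Quot ?N" "(+>\<^bsub>R\<^esub>) ?N" by (rule N.rcos_ring_hom_ring)
  show "left_goldie (R Quot ?N)"
  proof (rule q.S.left_goldieI)
    let ?D = "regular_elements (R Quot ?N)"
    \<comment> \<open>As \<open>\<C>' = \<C>\<close>, a coset is regular exactly when its
      representatives are, so the Ore condition descends to the factor ring.\<close>
    have D: "?N +>\<^bsub>R\<^esub> c \<in> ?D \<longleftrightarrow> c \<in> ?C" if "c \<in> carrier R" for c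
      using that C unfolding regular_mod_radical_def by blast
    fix y z assume y: "y \<in> ?D" and z: "z \<in> carrier (R Quot ?N)"
    obtain c where c: "c \<in> carrier R" "y = ?N +>\<^bsub>R\<^esub> c" using N.Quot_cases[OF regular_elementsD(1)[OF y]] .
    obtain r where r: "r \<in> carrier R" "z = ?N +>\<^bsub>R\<^esub> r" using N.Quot_cases[OF z] .
    obtain c' r' where c': "c' \<in> ?C" "r' \<in> carrier R" "c' \<otimes>\<^bsub>R\<^esub> r = r' \<otimes>\<^bsub>R\<^esub> c"
      using Ore[of c r] y c r D by blast
    have c'c: "c' \<in> carrier R" using S_in_carrier[OF c'(1)] .
    have "(?N +>\<^bsub>R\<^esub> c') \<otimes>\<^bsub>R Quot ?N\<^esub> z = (?N +>\<^bsub>R\<^esub> r') \<otimes>\<^bsub>R Quot ?N\<^esub> y"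
      unfolding c r using q.hom_mult[OF c'c r(1)] q.hom_mult[OF c'(2) c(1)] c'(3) by simp
    then show "\<exists>y'\<in>?D. \<exists>z'\<in>carrier (R Quot ?N). y' \<otimes>\<^bsub>R Quot ?N\<^esub> z = z' \<otimes>\<^bsub>R Quot ?N\<^esub> y"
      using D[OF c'c] c'(1,2) q.hom_closed by blast
  next
    let ?D = "regular_elements (R Quot ?N)"
    show "acc_on {I. left_ideal I (R Quot ?N) \<and> closed_under (R Quot ?N) ?D I}"
      unfolding acc_on_def
    proof (intro allI impI)
      fix I :: "nat \<Rightarrow> _"
      assume "\<forall>n. I n \<in> {I. left_ideal I (R Quot ?N) \<and> closed_under (R Quot ?N) ?D I} \<and> I n \<subseteq> I (Suc n)"
      then have I: "\<And>n. left_ideal (I n) (R Quot ?N)" "\<And>n. closed_under (R Quot ?N) ?D (I n)"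
        and mono: "\<And>n. I n \<subseteq> I (Suc n)" by auto
      let ?K = "\<lambda>n. {x \<in> carrier R. ?N +>\<^bsub>R\<^esub> x \<in> I n}"
      have "\<exists>M. \<forall>n\<ge>M. ?K n = ?K M"
      proof (rule acc_onD[OF acc'])
        fix n
        have "r \<in> ?K n" if "c \<in> regular_mod_radical R" "r \<in> carrier R" "c \<otimes>\<^bsub>R\<^esub> r \<in> ?K n" for c r
        proof -
          have c: "c \<in> carrier R" "?N +>\<^bsub>R\<^esub> c \<in> ?D" using that(1) by (auto simp: regular_mod_radical_def)
          have "(?N +>\<^bsub>R\<^esub> c) \<otimes>\<^bsub>R Quot ?N\<^esub> (?N +>\<^bsub>R\<^esub> r) \<in> I n" using that c by simp
          then have "?N +>\<^bsub>R\<^esub> r \<in> I n" using I(2) c q.hom_closed[OF that(2)] unfolding closed_under_def by blast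
          then show ?thesis using that(2) by simp
        qed
        then show "?K n \<in> {I. left_ideal I R \<and> closed_under R (regular_mod_radical R) I}"
          using N.left_ideal_coset_vimage[OF I(1)] unfolding closed_under_def by blast
        show "?K n \<subseteq> ?K (Suc n)" using mono by blast
      qed
      moreover have "I n = I m" if "?K n = ?K m" for n m
      proof -
        have "I n = (+>\<^bsub>R\<^esub>) ?N ` ?K n" for n
          using q.S.left_idealD(2)[OF I(1)] by (auto elim!: N.Quot_cases)
        from this[of n] this[of m] show ?thesis using that by (simp only:)
      qed
      ultimately show "\<exists>M. \<forall>n\<ge>M. I n = I M" by blast
    qed
  qed
qed

section \<open>From the ring to the quotient ring\<close>

lemma regular_mod_radical_left_ore_set:
  assumes R: "ring R" and goldie: "left_goldie (R Quot prime_radical R)"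
    and sub: "regular_mod_radical R \<subseteq> regular_elements R"
    and swap: "\<forall>c \<in> regular_mod_radical R. \<forall>n \<in> prime_radical R.
      \<exists>c' \<in> regular_mod_radical R. \<exists>n' \<in> prime_radical R. c' \<otimes>\<^bsub>R\<^esub> n = n' \<otimes>\<^bsub>R\<^esub> c"
  shows "semiprime_left_goldie (R Quot prime_radical R)" (is ?semiprime)
    and "left_ore_set R (regular_mod_radical R)" (is ?ore)
proof -
  let ?N = "prime_radical R" and ?C = "regular_mod_radical R"
  interpret R: ring R by fact
  interpret N: ideal ?N R by (rule R.ideal_prime_radical)
  interpret q: ring_hom_ring R "R Quot ?N" "(+>\<^bsub>R\<^esub>) ?N" by (rule N.rcos_ring_hom_ring)
  show ?semiprime
  proof unfold_locales
    show "left_goldie (R Quot ?N)" by (rule goldie)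
    fix y assume y: "y \<in> carrier (R Quot ?N)"
      and yry: "\<And>z. z \<in> carrier (R Quot ?N) \<Longrightarrow> y \<otimes>\<^bsub>R Quot ?N\<^esub> z \<otimes>\<^bsub>R Quot ?N\<^esub> y = \<zero>\<^bsub>R Quot ?N\<^esub>"
    obtain a where a: "a \<in> carrier R" "y = ?N +>\<^bsub>R\<^esub> a" using N.Quot_cases[OF y] .
    have "a \<otimes>\<^bsub>R\<^esub> r \<otimes>\<^bsub>R\<^esub> a \<in> ?N" if "r \<in> carrier R" for r
    proof -
      have "?N +>\<^bsub>R\<^esub> (a \<otimes>\<^bsub>R\<^esub> r \<otimes>\<^bsub>R\<^esub> a) = \<zero>\<^bsub>R Quot ?N\<^esub>"
        using yry[OF q.hom_closed[OF that]] a that by simp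
      then show ?thesis using N.coset_eq_zero_iff a(1) that by (simp del: q.hom_mult)
    qed
    then have "a \<in> ?N" by (rule R.prime_radical_semiprime[OF a(1)])
    then show "y = \<zero>\<^bsub>R Quot ?N\<^esub>" using N.coset_eq_zero_iff a by simp
  qed
  then interpret G: semiprime_left_goldie "R Quot ?N" .
  have iff: "c \<in> ?C \<longleftrightarrow> c \<in> carrier R \<and> ?N +>\<^bsub>R\<^esub> c \<in> regular_elements (R Quot ?N)" for c
    by (simp add: regular_mod_radical_def)
  have mult: "c \<otimes>\<^bsub>R\<^esub> d \<in> ?C" if c: "c \<in> ?C" and d: "d \<in> ?C" for c d
  proof -
    have cd: "c \<in> carrier R" "d \<in> carrier R" using c d iff by auto
    note reg = regular_mod_radical_iff[OF R, THEN iffD1, THEN conjunct2, rule_format]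
    have "r \<in> ?N" if "r \<in> carrier R" "c \<otimes>\<^bsub>R\<^esub> d \<otimes>\<^bsub>R\<^esub> r \<in> ?N" for r
    proof -
      have "c \<otimes>\<^bsub>R\<^esub> (d \<otimes>\<^bsub>R\<^esub> r) \<in> ?N" using that cd by (simp add: R.m_assoc)
      then show ?thesis using reg[OF c, of "d \<otimes>\<^bsub>R\<^esub> r"] reg[OF d that(1)] that(1) cd by simp
    qed
    moreover have "r \<in> ?N" if "r \<in> carrier R" "r \<otimes>\<^bsub>R\<^esub> (c \<otimes>\<^bsub>R\<^esub> d) \<in> ?N" for r
    proof -
      have "(r \<otimes>\<^bsub>R\<^esub> c) \<otimes>\<^bsub>R\<^esub> d \<in> ?N" using that cd by (simp add: R.m_assoc)
      then show ?thesis using reg[OF d, of "r \<otimes>\<^bsub>R\<^esub> c"] reg[OF c that(1)] that(1) cd by simp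
    qed
    ultimately show ?thesis unfolding regular_mod_radical_iff[OF R] using R.m_closed[OF cd] by blast
  qed
  show ?ore
  proof unfold_locales
    show "?C \<subseteq> regular_elements R" by (rule sub)
    show "\<one>\<^bsub>R\<^esub> \<in> ?C" using regular_mod_radical_iff[OF R] by simp
    show "c \<otimes>\<^bsub>R\<^esub> d \<in> ?C" if "c \<in> ?C" "d \<in> ?C" for c d using mult that .
    fix c r assume c: "c \<in> ?C" and r: "r \<in> carrier R"
    have cc: "c \<in> carrier R" using c iff by simp
    obtain y z where y: "y \<in> regular_elements (R Quot ?N)" "z \<in> carrier (R Quot ?N)"
        "y \<otimes>\<^bsub>R Quot ?N\<^esub> (?N +>\<^bsub>R\<^esub> r) = z \<otimes>\<^bsub>R Quot ?N\<^esub> (?N +>\<^bsub>R\<^esub> c)"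
      using G.goldie_left_Ore[of "?N +>\<^bsub>R\<^esub> c" "?N +>\<^bsub>R\<^esub> r"] c iff q.hom_closed[OF r] by blast
    obtain c1 where c1: "c1 \<in> carrier R" "y = ?N +>\<^bsub>R\<^esub> c1" using N.Quot_cases[OF regular_elementsD(1)[OF y(1)]] .
    obtain r1 where r1: "r1 \<in> carrier R" "z = ?N +>\<^bsub>R\<^esub> r1" using N.Quot_cases[OF y(2)] .
    have c1C: "c1 \<in> ?C" using c1 y(1) iff by simp
    \<comment> \<open>The Ore equation holds only for cosets, and \<open>n\<close> is its error.
      Condition (d) gives \<open>c2 n = n2 c\<close>, whence
      \<open>(c2 c1) r = (n2 + c2 r1) c\<close>.\<close>
    define n where "n = c1 \<otimes>\<^bsub>R\<^esub> r \<ominus>\<^bsub>R\<^esub> r1 \<otimes>\<^bsub>R\<^esub> c"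
    have nc: "n \<in> carrier R" using c1 r r1 cc by (simp add: n_def)
    have "?N +>\<^bsub>R\<^esub> (c1 \<otimes>\<^bsub>R\<^esub> r) = ?N +>\<^bsub>R\<^esub> (r1 \<otimes>\<^bsub>R\<^esub> c)" using y(3) c1 r1 r cc by simp
    then have "?N +>\<^bsub>R\<^esub> n = \<zero>\<^bsub>R Quot ?N\<^esub>"
      unfolding n_def a_minus_def using c1(1) r1(1) r cc
      by (simp del: q.hom_mult add: q.S.r_neg)
    then have "n \<in> ?N" using N.coset_eq_zero_iff[OF nc] by simp
    then obtain c2 n2 where c2: "c2 \<in> ?C" "n2 \<in> ?N" "c2 \<otimes>\<^bsub>R\<^esub> n = n2 \<otimes>\<^bsub>R\<^esub> c" using swap c by blast
    have c2c: "c2 \<in> carrier R" "n2 \<in> carrier R" using c2 iff N.Icarr by auto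
    have "(c2 \<otimes>\<^bsub>R\<^esub> c1) \<otimes>\<^bsub>R\<^esub> r = c2 \<otimes>\<^bsub>R\<^esub> n \<oplus>\<^bsub>R\<^esub> (c2 \<otimes>\<^bsub>R\<^esub> r1) \<otimes>\<^bsub>R\<^esub> c"
      unfolding n_def using c1(1) r1(1) r cc c2c by algebra
    also have "\<dots> = (n2 \<oplus>\<^bsub>R\<^esub> c2 \<otimes>\<^bsub>R\<^esub> r1) \<otimes>\<^bsub>R\<^esub> c"
      unfolding c2(3) using r1(1) cc c2c by (simp add: R.l_distr)
    finally show "\<exists>c'\<in>?C. \<exists>r'\<in>carrier R. c' \<otimes>\<^bsub>R\<^esub> r = r' \<otimes>\<^bsub>R\<^esub> c"
      using mult[OF c2(1) c1C] r1(1) c2c by blast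
  qed
qed

text \<open>Left ideals above the radical are unions of cosets and so are recovered from their
  images. Closedness passes to the images, where \<open>goldie_dcc_closed\<close> applies.\<close>

lemma dcc_closed_above_radical:
  assumes R: "ring R" and "semiprime_left_goldie (R Quot prime_radical R)"
  shows "dcc_on {I. left_ideal I R \<and> closed_under R (regular_mod_radical R) I \<and> prime_radical R \<subseteq> I}"
  unfolding dcc_on_def
proof (intro allI impI)
  let ?N = "prime_radical R" and ?C = "regular_mod_radical R"
  interpret R: ring R by fact
  interpret N: ideal ?N R by (rule R.ideal_prime_radical)
  interpret q: ring_hom_ring R "R Quot ?N" "(+>\<^bsub>R\<^esub>) ?N" by (rule N.rcos_ring_hom_ring)
  interpret G: semiprime_left_goldie "R Quot ?N" by fact
  fix I :: "nat \<Rightarrow> _"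
  assume "\<forall>n. I n \<in> {I. left_ideal I R \<and> closed_under R ?C I \<and> ?N \<subseteq> I} \<and> I (Suc n) \<subseteq> I n"
  then have I: "\<And>n. left_ideal (I n) R" "\<And>n. closed_under R ?C (I n)" "\<And>n. ?N \<subseteq> I n"
    and mono: "\<And>n. I (Suc n) \<subseteq> I n" by auto
  let ?K = "\<lambda>n. (+>\<^bsub>R\<^esub>) ?N ` I n"
  have "\<exists>M. \<forall>n\<ge>M. ?K n = ?K M"
  proof (rule dcc_onD[OF G.goldie_dcc_closed])
    fix n
    have "closed_under (R Quot ?N) (regular_elements (R Quot ?N)) (?K n)"
      unfolding closed_under_def
    proof (intro ballI impI)
      fix y z assume y: "y \<in> regular_elements (R Quot ?N)" and z: "z \<in> carrier (R Quot ?N)"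
        and yz: "y \<otimes>\<^bsub>R Quot ?N\<^esub> z \<in> ?K n"
      obtain c where c: "c \<in> carrier R" "y = ?N +>\<^bsub>R\<^esub> c" using N.Quot_cases[OF regular_elementsD(1)[OF y]] .
      obtain r where r: "r \<in> carrier R" "z = ?N +>\<^bsub>R\<^esub> r" using N.Quot_cases[OF z] .
      have "?N +>\<^bsub>R\<^esub> (c \<otimes>\<^bsub>R\<^esub> r) \<in> ?K n" using yz unfolding c(2) r(2) using c(1) r(1) by simp
      then have "c \<otimes>\<^bsub>R\<^esub> r \<in> I n" using N.coset_image_mem_iff[OF I(1,3)] c(1) r(1) by (simp del: q.hom_mult)
      moreover have "c \<in> ?C" using c y by (simp add: regular_mod_radical_def)
      ultimately have "r \<in> I n" using I(2) r(1) unfolding closed_under_def by blast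
      then show "z \<in> ?K n" using r(2) by blast
    qed
    then show "?K n \<in> {I. left_ideal I (R Quot ?N) \<and> closed_under (R Quot ?N) (regular_elements (R Quot ?N)) I}"
      using N.left_ideal_coset_image[OF I(1)] by blast
    show "?K (Suc n) \<subseteq> ?K n" using mono by (rule image_mono)
  qed
  moreover have "I n = {x \<in> carrier R. ?N +>\<^bsub>R\<^esub> x \<in> ?K n}" for n
    using N.coset_image_mem_iff[OF I(1,3)] R.left_idealD(2)[OF I(1)] by blast
  ultimately show "\<exists>M. \<forall>n\<ge>M. I n = I M" by metis
qed

lemma artinian_quotient_ring_exists:
  fixes R :: "('a, 'm) ring_scheme"
  assumes R: "ring R" and goldie: "left_goldie (R Quot prime_radical R)"
    and nil: "nilpotent_ideal (prime_radical R) R"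
    and sub: "regular_mod_radical R \<subseteq> regular_elements R"
    and swap: "\<forall>c \<in> regular_mod_radical R. \<forall>n \<in> prime_radical R.
      \<exists>c' \<in> regular_mod_radical R. \<exists>n' \<in> prime_radical R. c' \<otimes>\<^bsub>R\<^esub> n = n' \<otimes>\<^bsub>R\<^esub> c"
    and acc: "acc_on {I. left_ideal I R \<and> closed_under R (regular_mod_radical R) I}"
  shows "\<exists>(Q :: ('a \<times> 'a) set ring) f. left_quotient_ring R Q f \<and> left_artinian Q"
proof -
  let ?N = "prime_radical R" and ?C = "regular_mod_radical R"
  interpret R: ring R by fact
  note ore = regular_mod_radical_left_ore_set[OF R goldie sub swap]
  interpret O: left_ore_set R ?C by (rule ore(2))
  let ?Q = "O.frac_ring" and ?f = "O.fraction \<one>\<^bsub>R\<^esub>"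
  interpret left_localization R ?Q ?C ?f by (rule O.left_localization_frac_ring)
  interpret N: ideal ?N R by (rule R.ideal_prime_radical)
  have Nc: "?N \<subseteq> carrier R" by (auto simp: prime_radical_def)
  have accQ: "acc_on {K. left_ideal K ?Q}" using acc acc_on_left_ideals_iff by blast
  have LN: "left_ideal (ext ?N) ?Q" using left_ideal_ext[OF R.left_ideal_of_ideal[OF R.ideal_prime_radical]] .
  obtain k where k: "ideal_power R ?N k = {\<zero>\<^bsub>R\<^esub>}" using nil unfolding nilpotent_ideal_def by blast
  have dcc: "dcc_on {K. left_ideal K ?Q}"
  proof (rule Q.left_noetherian_imp_artinian[OF accQ Q.left_idealD(1)[OF LN]])
    show "dcc_on {K. left_ideal K ?Q \<and> ext ?N \<subseteq> K}"
      using dcc_on_left_ideals_above[OF dcc_closed_above_radical[OF R ore(1)] Nc] .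
    fix K assume K: "left_ideal K ?Q" and "K \<noteq> carrier ?Q"
    note LK = left_ideal_contr[OF K]
    have "contr K \<noteq> carrier R"
    proof
      assume "contr K = carrier R"
      moreover have "contr (carrier ?Q) = carrier R" unfolding contr_def using f.hom_closed by blast
      ultimately have "contr K = contr (carrier ?Q)" by simp
      then show False using contr_eq_iff[OF K Q.left_ideal_carrier] \<open>K \<noteq> carrier ?Q\<close> by blast
    qed
    then have "\<not> ideal_power R ?N 0 \<subseteq> contr K" by (auto simp: contr_def)
    moreover have "ideal_power R ?N k \<subseteq> contr K" using k R.left_idealD(3)[OF LK] by simp
    \<comment> \<open>The last power of the radical not inside \<open>contr K\<close>. For
      \<open>y\<close> in it, each \<open>n y\<close> lies in the next power, hence in
      \<open>contr K\<close>, so \<open>?f y\<close> is killed by \<open>ext ?N\<close> modulo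
      \<open>K\<close>.\<close>
    ultimately obtain m where m: "\<not> ideal_power R ?N m \<subseteq> contr K" "ideal_power R ?N (Suc m) \<subseteq> contr K"
      by (induct k) blast+
    then obtain y where y: "y \<in> ideal_power R ?N m" "y \<notin> contr K" by blast
    have yc: "y \<in> carrier R"
      using R.left_idealD(2)[OF R.left_ideal_of_ideal[OF R.ideal_ideal_power[OF R.ideal_prime_radical]] y(1)] .
    \<comment> \<open>Elements of \<open>ext ?N\<close> have their denominators on the left, so
      multiplying by \<open>?f s\<close> turns \<open>j ?f y\<close> into the image of
      \<open>n y\<close>.\<close>
    have "j \<otimes>\<^bsub>?Q\<^esub> ?f y \<in> K" if j: "j \<in> ext ?N" for j
    proof -
      obtain s n where s: "j \<in> carrier ?Q" "s \<in> ?C" "n \<in> ?N" "?f s \<otimes>\<^bsub>?Q\<^esub> j = ?f n"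
        using j by (auto simp: ext_def)
      have "n \<otimes>\<^bsub>R\<^esub> y \<in> ideal_power R ?N (Suc m)" using ideal_prod.prod[OF s(3) y(1), of R] by simp
      then have "?f (n \<otimes>\<^bsub>R\<^esub> y) \<in> K" using m(2) by (auto simp: contr_def)
      moreover have "?f (n \<otimes>\<^bsub>R\<^esub> y) = ?f s \<otimes>\<^bsub>?Q\<^esub> (j \<otimes>\<^bsub>?Q\<^esub> ?f y)"
        unfolding f.hom_mult[OF N.Icarr[OF s(3)] yc] s(4)[symmetric]
        by (rule Q.m_assoc[OF f.hom_closed[OF S_in_carrier[OF s(2)]] s(1) f.hom_closed[OF yc]])
      ultimately show ?thesis
        using left_ideal_unit_cancel[OF K s(2)] Q.m_closed[OF s(1) f.hom_closed[OF yc]] by metis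
    qed
    moreover have "?f y \<in> carrier ?Q - K" using y(2) yc f.hom_closed[OF yc] by (auto simp: contr_def)
    ultimately show "\<exists>x\<in>carrier ?Q - K. \<forall>j\<in>ext ?N. j \<otimes>\<^bsub>?Q\<^esub> x \<in> K" by blast
  qed
  have "left_quotient_ring R ?Q ?f"
    unfolding left_quotient_ring_def
  proof (intro conjI ballI Q.ring_axioms hom inj)
    show "?f c \<in> Units ?Q" if c: "c \<in> regular_elements R" for c
    proof (rule Q.left_artinian_unit[OF dcc f.hom_closed[OF regular_elementsD(1)[OF c]]])
      have cc: "c \<in> carrier R" using regular_elementsD(1)[OF c] .
      fix y assume y: "y \<in> carrier ?Q" "y \<otimes>\<^bsub>?Q\<^esub> ?f c = \<zero>\<^bsub>?Q\<^esub>"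
      obtain s r where s: "s \<in> ?C" "r \<in> carrier R" "?f s \<otimes>\<^bsub>?Q\<^esub> y = ?f r" using numerator[OF y(1)] by blast
      note sc = f.hom_closed[OF S_in_carrier[OF s(1)]]
      have "?f (r \<otimes>\<^bsub>R\<^esub> c) = ?f s \<otimes>\<^bsub>?Q\<^esub> (y \<otimes>\<^bsub>?Q\<^esub> ?f c)"
        unfolding f.hom_mult[OF s(2) cc] s(3)[symmetric] by (rule Q.m_assoc[OF sc y(1) f.hom_closed[OF cc]])
      also have "\<dots> = ?f \<zero>\<^bsub>R\<^esub>" unfolding y(2) Q.r_null[OF sc] f.hom_zero by (rule refl)
      finally have "r \<otimes>\<^bsub>R\<^esub> c = \<zero>\<^bsub>R\<^esub>" using f_eqD s(2) cc by blast
      then have "r = \<zero>\<^bsub>R\<^esub>" using regular_elementsD(3)[OF c s(2)] by blast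
      then have "?f s \<otimes>\<^bsub>?Q\<^esub> y = ?f s \<otimes>\<^bsub>?Q\<^esub> \<zero>\<^bsub>?Q\<^esub>"
        unfolding s(3) Q.r_null[OF sc] by (simp only: f.hom_zero)
      then show "y = \<zero>\<^bsub>?Q\<^esub>" using unit_cancel[OF s(1) y(1) Q.zero_closed] by blast
    qed
    show "\<exists>c\<in>regular_elements R. \<exists>r\<in>carrier R. q = inv\<^bsub>?Q\<^esub> (?f c) \<otimes>\<^bsub>?Q\<^esub> ?f r" if "q \<in> carrier ?Q" for q
      using frac[OF that] sub by blast
  qed
  moreover have "left_artinian ?Q" unfolding left_artinian_def using Q.ring_axioms dcc by blast
  ultimately show ?thesis by blast
qed

text \<open>The type of \<open>Q\<close> is the one on which fractions, encoded as graphs, are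
  constructed; \<open>left_quotient_ring_on_fractions\<close> transfers quotient rings on other
  types to it.\<close>

theorem theorem4p2:
  fixes R :: "('a, 'm) ring_scheme"
  assumes "ring R"
  shows "(\<exists>(Q :: ('a \<times> 'a) set ring) f. left_quotient_ring R Q f \<and> left_artinian Q) \<longleftrightarrow>
    (left_goldie (R Quot prime_radical R) \<and>
     nilpotent_ideal (prime_radical R) R \<and>
     regular_mod_radical R \<subseteq> regular_elements R \<and>
     (\<forall>c \<in> regular_mod_radical R. \<forall>n \<in> prime_radical R.
        \<exists>c\<^sub>1 \<in> regular_mod_radical R. \<exists>n\<^sub>1 \<in> prime_radical R. c\<^sub>1 \<otimes>\<^bsub>R\<^esub> n = n\<^sub>1 \<otimes>\<^bsub>R\<^esub> c) \<and>
     acc_on {I. left_ideal I R \<and> closed_under R (regular_mod_radical R) I})"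
  (is "?L \<longleftrightarrow> ?R")
proof
  assume ?L
  then obtain Q :: "('a \<times> 'a) set ring" and f where Q: "left_quotient_ring R Q f" "left_artinian Q" by blast
  show ?R
    using artinian_quotient_ring_conditions[OF assms Q] by (intro conjI ballI)
next
  assume ?R
  then show ?L by (elim conjE) (rule artinian_quotient_ring_exists[OF assms])
qed

end
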